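(* Let $P\subset\mathbb R^d$ be a $d$-dimensional parallelohedron. Then $P$ can be represented as a direct product $P=P_1\times P_2$ of two parallelohedra of smaller dimension (that is, $\dim P_1<d$ and $\dim P_2<d$) if and only if the red Venkov graph $G_P^r$ of $P$ is disconnected.
   Context: A parallelohedron of dimension $d$ is a $d$-dimensional (convex) polytope $P$ such that there exists a face-to-face tiling of $\mathbb R^d$ by translates of $P$. Direct product: $P=P_1\times P_2$ means that $P$ is the direct Minkowski sum $P=P_1\oplus P_2=\{x_1+x_2: x_1\in P_1,\ x_2\in P_2\}$ with $P_1\subset L_1$, $P_2\subset L_2$ for some complementary linear subspaces $L_1,L_2$, $\mathbb R^d=L_1\oplus L_2$ (not necessarily orthogonal), $\dim P_i=\dim L_i$, where $P_i$ is a parallelohedron in $L_i$. Known facts (Minkowski, Venkov) making the following definitions meaningful: a convex polytope $P$ is a parallelohedron if and only if (1) $P$ is centrally symmetric, (2) every facet ($(d-1)$-dimensional face) of $P$ is centrally symmetric, (3) every belt of $P$ consists of four or six facets. Here, for a $(d-2)$-dimensional face $F$ of $P$, the belt determined by $F$ is the set of all facets of $P$ parallel to $F$. A belt with $k$ facets is called a $k$-belt ($k=4$ or $6$). Two facets of $P$ are antipodal if they are exchanged by the central symmetry of $P$. The Venkov graph $G_P$ is the graph with edges coloured red or blue defined as follows. Its vertices are the unordered pairs $\{F,F'\}$ of antipodal facets of $P$. Two distinct vertices $\{F_1,F_1'\}$ and $\{F_2,F_2'\}$ are joined by a red edge if and only if $F_1,F_1',F_2,F_2'$ belong to one and the same 6-belt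 of $P$, and by a blue edge if and only if $F_1,F_1',F_2,F_2'$ form a 4-belt of $P$. The red Venkov graph $G_P^r$ is the graph on the same vertex set whose edges are all the red edges of $G_P$. A graph is disconnected if its vertex set can be partitioned into two nonempty sets with no edge between them. *)

theory Defs
  imports "HOL-Analysis.Analysis"
begin

section \<open>Parallelohedra\<close>

text \<open>Everything is relative to a linear subspace \<open>L\<close>, because the factors of a direct product
  are parallelohedra in proper subspaces. Tiles have full dimension in \<open>L\<close>, so their
  interior in \<open>L\<close> is their relative interior.\<close>

definition face_to_face_tiling :: "'a::euclidean_space set \<Rightarrow> 'a set set \<Rightarrow> bool" where
  "face_to_face_tiling L \<T> \<longleftrightarrow>
     (\<forall>C\<in>\<T>. polytope C \<and> C \<subseteq> L \<and> aff_dim C = int (dim L)) \<and>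
     \<Union>\<T> = L \<and>
     (\<forall>C\<in>\<T>. \<forall>D\<in>\<T>. C \<noteq> D \<longrightarrow>
        rel_interior C \<inter> rel_interior D = {} \<and>
        (C \<inter> D) face_of C \<and> (C \<inter> D) face_of D)"

definition parallelohedron_in :: "'a::euclidean_space set \<Rightarrow> 'a set \<Rightarrow> bool" where
  "parallelohedron_in L P \<longleftrightarrow>
     subspace L \<and> polytope P \<and> P \<subseteq> L \<and> aff_dim P = int (dim L) \<and>
     (\<exists>T. T \<subseteq> L \<and> face_to_face_tiling L {(+) t ` P | t. t \<in> T})"

abbreviation parallelohedron :: "'a::euclidean_space set \<Rightarrow> bool" where
  "parallelohedron P \<equiv> parallelohedron_in UNIV P"

definition direct_product :: "'a::euclidean_space set \<Rightarrow> 'a set \<Rightarrow> 'a set \<Rightarrow> bool" where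
  "direct_product P P\<^sub>1 P\<^sub>2 \<longleftrightarrow>
     P = {x + y | x y. x \<in> P\<^sub>1 \<and> y \<in> P\<^sub>2} \<and>
     (\<exists>L\<^sub>1 L\<^sub>2. subspace L\<^sub>1 \<and> subspace L\<^sub>2 \<and>
        L\<^sub>1 \<inter> L\<^sub>2 = {0} \<and> {x + y | x y. x \<in> L\<^sub>1 \<and> y \<in> L\<^sub>2} = UNIV \<and>
        parallelohedron_in L\<^sub>1 P\<^sub>1 \<and> parallelohedron_in L\<^sub>2 P\<^sub>2)"


section \<open>Belts\<close>

text \<open>A facet \<open>G\<close> is parallel to a face \<open>F\<close> of smaller dimension if a translate
  of the affine hull of \<open>F\<close> lies in the affine hull of \<open>G\<close>.\<close>

definition parallel_to_face :: "'a::euclidean_space set \<Rightarrow> 'a set \<Rightarrow> bool" where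
  "parallel_to_face G F \<longleftrightarrow> (\<exists>S. affine_parallel (affine hull F) S \<and> S \<subseteq> affine hull G)"

definition belt :: "'a::euclidean_space set \<Rightarrow> 'a set \<Rightarrow> 'a set set" where
  "belt P F = {G. G facet_of P \<and> parallel_to_face G F}"

definition k_belt :: "nat \<Rightarrow> 'a::euclidean_space set \<Rightarrow> 'a set set \<Rightarrow> bool" where
  "k_belt k P B \<longleftrightarrow>
     (\<exists>F. F face_of P \<and> F \<noteq> {} \<and> aff_dim F = aff_dim P - 2 \<and> B = belt P F) \<and> card B = k"


section \<open>The Venkov graph\<close>

text \<open>The centre \<open>c\<close> of a nonempty bounded set is unique, so the quantifier below
  speaks about the central symmetry of \<open>P\<close>.\<close>

definition antipodal :: "'a::euclidean_space set \<Rightarrow> 'a set \<Rightarrow> 'a set \<Rightarrow> bool" where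
  "antipodal P F F' \<longleftrightarrow>
     F facet_of P \<and> F' facet_of P \<and>
     (\<exists>c. (\<lambda>x. 2 *\<^sub>R c - x) ` P = P \<and> (\<lambda>x. 2 *\<^sub>R c - x) ` F = F')"

datatype colour = Red | Blue

definition venkov_vertices :: "'a::euclidean_space set \<Rightarrow> 'a set set set" where
  "venkov_vertices P = {{F, F'} | F F'. antipodal P F F'}"

fun venkov_adjacent ::
    "'a::euclidean_space set \<Rightarrow> colour \<Rightarrow> 'a set set \<Rightarrow> 'a set set \<Rightarrow> bool" where
  "venkov_adjacent P Red v w \<longleftrightarrow> v \<noteq> w \<and> (\<exists>B. k_belt 6 P B \<and> v \<union> w \<subseteq> B)"
| "venkov_adjacent P Blue v w \<longleftrightarrow> v \<noteq> w \<and> (\<exists>B. k_belt 4 P B \<and> v \<union> w = B)"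

text \<open>A graph is a pair of its vertices and its edges, an edge being a two-element set of
  vertices, tagged with its colour in the coloured case.\<close>

definition venkov_graph ::
    "'a::euclidean_space set \<Rightarrow> 'a set set set \<times> ('a set set set \<times> colour) set" where
  "venkov_graph P =
     (venkov_vertices P,
      {({v, w}, c) | v w c. v \<in> venkov_vertices P \<and> w \<in> venkov_vertices P \<and>
                            venkov_adjacent P c v w})"

definition red_venkov_graph ::
    "'a::euclidean_space set \<Rightarrow> 'a set set set \<times> 'a set set set set" where
  "red_venkov_graph P = (fst (venkov_graph P), {e. (e, Red) \<in> snd (venkov_graph P)})"

definition graph_disconnected :: "'v set \<times> 'v set set \<Rightarrow> bool" where
  "graph_disconnected G \<longleftrightarrow>
     (\<exists>A B. A \<noteq> {} \<and> B \<noteq> {} \<and> A \<inter> B = {} \<and> A \<union> B = fst G \<and>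
            (\<forall>a\<in>A. \<forall>b\<in>B. {a, b} \<notin> snd G))"

end

theory Submission
  imports Defs
begin

text \<open>
  Let \<open>P\<close> be a parallelohedron. Three things have to be shown: that \<open>P\<close> is centrally symmetric
  (otherwise its Venkov graph need not have any vertices), that a product has no red edge between
  the facets coming from the two factors, and that a colouring of the facets without red edges
  between the colours comes from a product.

  \<^emph>\<open>Central symmetry.\<close> The set \<open>(P - P) / 2\<close> has the same differences as \<open>P\<close>, so its translates
  along the tiling are a packing and its volume is at most that of \<open>P\<close>
  (\<open>packing_density\<close>). By the Brunn--Minkowski inequality (\<open>brunn_minkowski_midsum\<close>) it is also at
  least that of \<open>P\<close>. The inequality holds for the parts of \<open>P\<close> and \<open>- P\<close> below and above parallel
  hyperplanes as well, and the resulting equalities make the distribution of the volume of \<open>P\<close> in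
  every direction symmetric (\<open>symmetric_profile\<close>). Hence the centroid is midway between any two
  parallel supporting hyperplanes and is a centre of symmetry
  (\<open>translative_tile_centrally_symmetric\<close>).

  From now on the centre is the origin. A facet is indexed by the vector \<open>a\<close> for which it is the
  intersection of \<open>P\<close> with \<open>a \<bullet> x = 1\<close>, and \<open>shift a\<close> is the translation to the neighbour across this
  facet. Reflection in the midpoint of two neighbours exchanges them, so the facet is
  symmetric about \<open>shift a / 2\<close>.

  \<^emph>\<open>Products are disconnected.\<close> Every facet normal of a product vanishes on one of the two
  subspaces. The normals of a belt lie in a plane; if the belt contains facets of both kinds, then
  the only normals in this plane are plus or minus the two given ones, so it has at most four facets
  (\<open>product_disconnected\<close>).

  \<^emph>\<open>Colourings are products.\<close> Let the facets have colours \<open>A\<close> and \<open>B\<close> such that no 6-belt contains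
  both. If facets \<open>a\<close> and \<open>b\<close> of different colour meet in a ridge, then following the reflections of the
  facets around the ridge shows that either the belt has six members or \<open>b \<bullet> shift a = 0\<close>
  (\<open>ridge_dichotomy\<close>). In the second case the facet \<open>b\<close> of the tile and that of its
  neighbour across \<open>a\<close> continue each other in one hyperplane (\<open>mixed_ridge_wall\<close>).
  Consider the wall, the union of all facets of colour \<open>B\<close> of all
  tiles. A component of its complement is locally convex at ridges, and hence convex. What is needed
  from this is that segments from a generic point \<open>x\<close> to points of the axis \<open>s * shift a\<close>, which does
  not meet the wall when \<open>a\<close> has colour \<open>A\<close>, do not meet it either: while \<open>s\<close> varies, a first contact
  with the wall could only occur at a facet or a ridge of it, and \<open>wall_crossing\<close> says that segments
  close to one that touches the wall there touch it as well. If \<open>b \<bullet> shift a\<close> were positive for some \<open>b\<close>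
  of colour \<open>B\<close>, a segment to a far point of the axis starting close to the facet \<open>b\<close> would pass
  through this facet. Therefore \<open>b \<bullet> shift a = 0\<close> for all facets of different colours
  (\<open>mixed_orthogonal\<close>), whether adjacent or not. The shifts span the space, so the space is the
  direct sum of the common kernels of the two sets of normals, and \<open>P\<close> and the tiling split
  accordingly (\<open>direct_decomposition\<close>).
\<close>

section \<open>The Brunn--Minkowski inequality for midpoint sets\<close>

abbreviation vol :: "'a::euclidean_space set \<Rightarrow> real" where
  "vol \<equiv> measure lebesgue"

definition midsum :: "'a::real_vector set \<Rightarrow> 'a set \<Rightarrow> 'a set" where
  "midsum A B = {(1/2) *\<^sub>R (x + y) | x y. x \<in> A \<and> y \<in> B}"

lemma midsum_iff: "z \<in> midsum A B \<longleftrightarrow> (\<exists>x\<in>A. \<exists>y\<in>B. z = (1/2) *\<^sub>R (x + y))"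
  unfolding midsum_def by blast

lemma midsum_commute: "midsum A B = midsum B A"
  by (rule set_eqI, unfold midsum_iff, subst add.commute, blast)

lemma midsum_mono: "A \<subseteq> A' \<Longrightarrow> B \<subseteq> B' \<Longrightarrow> midsum A B \<subseteq> midsum A' B'"
  unfolding midsum_def by blast

lemma open_midsum:
  fixes A :: "'a::real_normed_vector set"
  assumes "open A"
  shows "open (midsum A B)"
proof -
  have eq: "midsum A B = (\<Union>y\<in>B. (\<lambda>x. (1/2) *\<^sub>R x) ` ((\<lambda>x. y + x) ` A))"
  proof (rule set_eqI)
    fix z
    have "z \<in> midsum A B \<longleftrightarrow> (\<exists>y\<in>B. \<exists>x\<in>A. z = (1/2) *\<^sub>R (x + y))"
      unfolding midsum_def by blast
    also have "\<dots> \<longleftrightarrow> (\<exists>y\<in>B. \<exists>x\<in>A. z = (1/2) *\<^sub>R (y + x))"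
      by (simp only: add.commute)
    finally show "z \<in> midsum A B \<longleftrightarrow> z \<in> (\<Union>y\<in>B. (\<lambda>x. (1/2) *\<^sub>R x) ` ((\<lambda>x. y + x) ` A))"
      unfolding UN_iff image_iff bex_simps by blast
  qed
  have "open ((\<lambda>x. (1/2) *\<^sub>R x) ` ((\<lambda>x. y + x) ` A))" for y
    by (rule open_scaling) (simp_all add: open_translation assms)
  then show ?thesis unfolding eq by (intro open_UN) simp
qed

lemma bounded_midsum:
  fixes A :: "'a::real_normed_vector set"
  assumes "bounded A" "bounded B"
  shows "bounded (midsum A B)"
proof -
  obtain M N where M: "\<And>x. x \<in> A \<Longrightarrow> norm x \<le> M" and N: "\<And>x. x \<in> B \<Longrightarrow> norm x \<le> N"
    using assms unfolding bounded_iff by metis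
  have "norm ((1/2) *\<^sub>R (x + y)) \<le> (M + N) / 2" if "x \<in> A" "y \<in> B" for x y
    using norm_triangle_ineq[of x y] M[OF that(1)] N[OF that(2)] by simp
  then show ?thesis unfolding bounded_iff midsum_def by blast
qed

lemma lmeasurable_midsum:
  fixes A :: "'a::euclidean_space set"
  assumes "open A" "bounded A" "bounded B"
  shows "midsum A B \<in> lmeasurable"
  by (simp add: assms bounded_midsum lmeasurable_open open_midsum)

lemma lmeasurable_Int_open:
  fixes S :: "'a::euclidean_space set"
  assumes "S \<in> lmeasurable" "open U"
  shows "S \<inter> U \<in> lmeasurable"
proof -
  have "U \<in> sets lebesgue" using assms(2) by (simp add: borel_open)
  then show ?thesis using assms(1) by (simp add: fmeasurable_Int_fmeasurable)
qed

text \<open>Hyperplanes are null sets, so the indicator functions converge almost everywhere and dominated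
  convergence applies.\<close>

lemma measure_slab_continuous:
  fixes S :: "'a::euclidean_space set"
  assumes S: "S \<in> lmeasurable" and u: "u \<noteq> 0"
  shows "continuous_on UNIV (\<lambda>s. vol (S \<inter> {x. u \<bullet> x < s}))"
proof (rule continuous_on_sequentiallyI)
  fix \<sigma> :: "nat \<Rightarrow> real" and s
  assume lim: "\<sigma> \<longlonglongrightarrow> s"
  have m: "S \<inter> {x. u \<bullet> x < r} \<in> lmeasurable" for r
    by (rule lmeasurable_Int_open[OF S open_halfspace_lt])
  have eq: "vol (S \<inter> {x. u \<bullet> x < r}) = (LINT x|lebesgue. indicator (S \<inter> {x. u \<bullet> x < r}) x)" for r
    using m by simp
  show "(\<lambda>n. vol (S \<inter> {x. u \<bullet> x < \<sigma> n})) \<longlonglongrightarrow> vol (S \<inter> {x. u \<bullet> x < s})"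
    unfolding eq
  proof (rule integral_dominated_convergence)
    show "integrable lebesgue (indicator S :: 'a \<Rightarrow> real)"
      using S unfolding lmeasurable_iff_integrable .
    show "indicator (S \<inter> {x. u \<bullet> x < s}) \<in> borel_measurable lebesgue"
      using fmeasurableD[OF m] by simp
    show "indicator (S \<inter> {x. u \<bullet> x < \<sigma> n}) \<in> borel_measurable lebesgue" for n
      using fmeasurableD[OF m] by simp
    show "AE x in lebesgue. (\<lambda>n. indicator (S \<inter> {x. u \<bullet> x < \<sigma> n}) x :: real) \<longlonglongrightarrow> indicator (S \<inter> {x. u \<bullet> x < s}) x"
    proof (rule AE_I')
      show "{x. u \<bullet> x = s} \<in> null_sets lebesgue"
        using negligible_hyperplane[of u s] u by (simp add: negligible_iff_null_sets)
      show "{x \<in> space lebesgue. \<not> (\<lambda>n. indicator (S \<inter> {x. u \<bullet> x < \<sigma> n}) x :: real) \<longlonglongrightarrow> indicator (S \<inter> {x. u \<bullet> x < s}) x}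
            \<subseteq> {x. u \<bullet> x = s}"
      proof (clarsimp, rule ccontr)
        fix x
        assume no: "\<not> (\<lambda>n. indicator (S \<inter> {x. u \<bullet> x < \<sigma> n}) x :: real) \<longlonglongrightarrow> indicator (S \<inter> {x. u \<bullet> x < s}) x"
          and "u \<bullet> x \<noteq> s"
        then consider "u \<bullet> x < s" | "u \<bullet> x > s" by linarith
        then have "\<forall>\<^sub>F n in sequentially. indicator (S \<inter> {x. u \<bullet> x < \<sigma> n}) x = (indicator (S \<inter> {x. u \<bullet> x < s}) x :: real)"
        proof cases
          case 1
          have "\<forall>\<^sub>F n in sequentially. u \<bullet> x < \<sigma> n" using order_tendstoD(1)[OF lim 1] .
          then show ?thesis by eventually_elim (use 1 in \<open>auto simp: indicator_def\<close>)
        next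
          case 2
          have "\<forall>\<^sub>F n in sequentially. u \<bullet> x > \<sigma> n" using order_tendstoD(2)[OF lim 2] .
          then show ?thesis by eventually_elim (use 2 in \<open>auto simp: indicator_def\<close>)
        qed
        then show False using no tendsto_eventually by metis
      qed
    qed
    show "AE x in lebesgue. norm (indicator (S \<inter> {x. u \<bullet> x < \<sigma> n}) x :: real) \<le> indicator S x" for n
      by (auto simp: indicator_def)
  qed
qed

lemma measure_slab_split:
  fixes S :: "'a::euclidean_space set"
  assumes S: "S \<in> lmeasurable" and u: "u \<noteq> 0"
  shows "vol S = vol (S \<inter> {x. u \<bullet> x < s}) + vol (S \<inter> {x. u \<bullet> x > s})"
proof -
  have m: "S \<inter> {x. u \<bullet> x < s} \<in> lmeasurable" "S \<inter> {x. u \<bullet> x > s} \<in> lmeasurable"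
    by (rule lmeasurable_Int_open[OF S open_halfspace_lt]) (rule lmeasurable_Int_open[OF S open_halfspace_gt])
  have "vol ((S \<inter> {x. u \<bullet> x < s}) \<union> (S \<inter> {x. u \<bullet> x > s}))
      = vol (S \<inter> {x. u \<bullet> x < s}) + vol (S \<inter> {x. u \<bullet> x > s})"
  proof -
    have e: "(S \<inter> {x. u \<bullet> x < s}) \<inter> (S \<inter> {x. u \<bullet> x > s}) = {}" by auto
    show ?thesis using measure_Un3[OF m] unfolding e by simp
  qed
  moreover have "vol S = vol ((S \<inter> {x. u \<bullet> x < s}) \<union> (S \<inter> {x. u \<bullet> x > s}))"
  proof (rule measure_negligible_symdiff)
    show "(S \<inter> {x. u \<bullet> x < s}) \<union> (S \<inter> {x. u \<bullet> x > s}) \<in> lmeasurable" using m by auto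
    show "negligible (sym_diff (S \<inter> {x. u \<bullet> x < s} \<union> S \<inter> {x. s < u \<bullet> x}) S)"
      by (rule negligible_subset[OF negligible_hyperplane[of u s]]) (use u in auto)
  qed
  ultimately show ?thesis by simp
qed

text \<open>Open boxes can be cut along a coordinate hyperplane into disjoint open boxes at the cost of a
  null set, and their midpoint sets are open, hence measurable.\<close>

definition box_family :: "'a::euclidean_space set set \<Rightarrow> bool" where
  "box_family s \<longleftrightarrow> finite s \<and> pairwise disjnt s \<and> (\<forall>K\<in>s. K \<noteq> {} \<and> (\<exists>a b. K = box a b))"

lemma box_Int_halfspace:
  fixes a :: "'a::euclidean_space"
  assumes "k \<in> Basis"
  shows "\<exists>a' b'. box a b \<inter> {x. k \<bullet> x < c} = box a' b'" "\<exists>a' b'. box a b \<inter> {x. k \<bullet> x > c} = box a' b'"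
proof -
  have "box a b \<inter> {x. k \<bullet> x < c} = box a (\<Sum>i\<in>Basis. (if i = k then min (b \<bullet> k) c else b \<bullet> i) *\<^sub>R i)"
    using assms by (auto simp: mem_box inner_commute[of k] split: if_splits)
  moreover have "box a b \<inter> {x. k \<bullet> x > c} = box (\<Sum>i\<in>Basis. (if i = k then max (a \<bullet> k) c else a \<bullet> i) *\<^sub>R i) b"
    using assms by (auto simp: mem_box inner_commute[of k] split: if_splits)
  ultimately show "\<exists>a' b'. box a b \<inter> {x. k \<bullet> x < c} = box a' b'" "\<exists>a' b'. box a b \<inter> {x. k \<bullet> x > c} = box a' b'"
    by - (rule exI, rule exI, assumption)+
qed

lemma box_family_restrict:
  assumes "box_family s" and H: "\<And>a b. \<exists>a' b'. box a b \<inter> H = box a' b'"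
  obtains s' where "box_family s'" "\<Union>s' = \<Union>s \<inter> H" "card s' \<le> card {K \<in> s. K \<inter> H \<noteq> {}}"
proof
  let ?s = "(\<lambda>K. K \<inter> H) ` {K \<in> s. K \<inter> H \<noteq> {}}"
  have fin: "finite s" and pw: "pairwise disjnt s" and bx: "\<And>K. K \<in> s \<Longrightarrow> \<exists>a b. K = box a b"
    using assms(1) by (auto simp: box_family_def)
  have "pairwise disjnt ?s"
    using pw unfolding pairwise_def disjnt_def by blast
  moreover have "\<exists>a b. K = box a b" if "K \<in> ?s" for K
  proof -
    from that obtain K' where K': "K' \<in> s" "K = K' \<inter> H" by auto
    then obtain a b where "K' = box a b" using bx by blast
    with K' H[of a b] show ?thesis by simp
  qed
  ultimately show "box_family ?s"
    using fin by (auto simp: box_family_def)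
  show "\<Union>?s = \<Union>s \<inter> H" by auto
  show "card ?s \<le> card {K \<in> s. K \<inter> H \<noteq> {}}"
    using fin by (intro card_image_le) auto
qed

lemma box_family_open: "box_family s \<Longrightarrow> open (\<Union>s)"
  by (auto simp: box_family_def intro!: open_Union)

lemma box_family_bounded: "box_family s \<Longrightarrow> bounded (\<Union>s)"
  by (auto simp: box_family_def intro!: bounded_Union)

lemma box_family_lmeasurable: "box_family s \<Longrightarrow> \<Union>s \<in> lmeasurable"
  by (simp add: box_family_bounded box_family_open lmeasurable_open)

lemma measure_open_pos:
  fixes S :: "'a::euclidean_space set"
  assumes "open S" "bounded S" "S \<noteq> {}"
  shows "vol S > 0"
proof -
  have "vol S \<noteq> 0"
    using negligible_iff_measure0[OF lmeasurable_open] open_not_negligible assms by blast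
  then show ?thesis by (simp add: less_eq_real_def zero_less_measure_iff)
qed

text \<open>For two boxes this is the inequality between the arithmetic and the geometric mean of the side
  lengths, one coordinate at a time.\<close>

lemma midsum_boxes:
  fixes a b c d :: "'a::euclidean_space"
  assumes "box a b \<noteq> {}" "box c d \<noteq> {}"
  shows "vol (box a b) * vol (box c d) \<le> (vol (midsum (box a b) (box c d)))\<^sup>2"
proof -
  have ab: "\<And>i. i \<in> Basis \<Longrightarrow> a \<bullet> i < b \<bullet> i" and cd: "\<And>i. i \<in> Basis \<Longrightarrow> c \<bullet> i < d \<bullet> i"
    using assms by (auto simp: box_ne_empty)
  let ?l = "(1/2) *\<^sub>R (a + c)" and ?u = "(1/2) *\<^sub>R (b + d)"
  have sub: "box ?l ?u \<subseteq> midsum (box a b) (box c d)"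
  proof
    fix z assume z: "z \<in> box ?l ?u"
    \<comment> \<open>\<open>x\<close> and \<open>y\<close> divide the sides of their boxes in the same ratio as \<open>z\<close> does\<close>
    define \<theta> where "\<theta> i = (z \<bullet> i - ?l \<bullet> i) / (?u \<bullet> i - ?l \<bullet> i)" for i
    have th: "0 < \<theta> i \<and> \<theta> i < 1 \<and> z \<bullet> i = ?l \<bullet> i + \<theta> i * (?u \<bullet> i - ?l \<bullet> i)" if "i \<in> Basis" for i
      using z ab[OF that] cd[OF that] that by (auto simp: \<theta>_def mem_box field_simps inner_add_left)
    define x where "x = (\<Sum>i\<in>Basis. (a \<bullet> i + \<theta> i * (b \<bullet> i - a \<bullet> i)) *\<^sub>R i)"
    define y where "y = (\<Sum>i\<in>Basis. (c \<bullet> i + \<theta> i * (d \<bullet> i - c \<bullet> i)) *\<^sub>R i)"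
    have conv: "p + t * (q - p) < q" "p < p + t * (q - p)" if "p < q" "0 < t" "t < 1" for p q t :: real
    proof -
      have "t * (q - p) < 1 * (q - p)" using that by (intro mult_strict_right_mono) auto
      then show "p + t * (q - p) < q" by simp
      show "p < p + t * (q - p)" using that by simp
    qed
    have "x \<in> box a b" "y \<in> box c d"
      using th ab cd conv by (auto simp: x_def y_def mem_box)
    moreover have "z = (1/2) *\<^sub>R (x + y)"
    proof (rule euclidean_eqI)
      fix i :: 'a assume "i \<in> Basis"
      then show "z \<bullet> i = ((1/2) *\<^sub>R (x + y)) \<bullet> i"
        using th[of i] by (simp add: x_def y_def inner_add_left) (simp add: field_simps)
    qed
    ultimately show "z \<in> midsum (box a b) (box c d)" unfolding midsum_iff by blast
  qed
  have "vol (box a b) * vol (box c d) = (\<Prod>i\<in>Basis. (b \<bullet> i - a \<bullet> i) * (d \<bullet> i - c \<bullet> i))"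
    using ab cd by (simp add: measure_lborel_box_eq less_imp_le inner_diff_left prod.distrib)
  also have "\<dots> \<le> (\<Prod>i\<in>Basis. (?u \<bullet> i - ?l \<bullet> i)\<^sup>2)"
  proof (rule prod_mono)
    fix i :: 'a assume i: "i \<in> Basis"
    have "0 \<le> ((b \<bullet> i - a \<bullet> i) - (d \<bullet> i - c \<bullet> i))\<^sup>2" by simp
    then have "(b \<bullet> i - a \<bullet> i) * (d \<bullet> i - c \<bullet> i) \<le> (?u \<bullet> i - ?l \<bullet> i)\<^sup>2"
      by (simp add: power2_eq_square inner_add_left field_simps)
    then show "0 \<le> (b \<bullet> i - a \<bullet> i) * (d \<bullet> i - c \<bullet> i) \<and> (b \<bullet> i - a \<bullet> i) * (d \<bullet> i - c \<bullet> i) \<le> (?u \<bullet> i - ?l \<bullet> i)\<^sup>2"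
      using ab[OF i] cd[OF i] by simp
  qed
  also have "\<dots> = (vol (box ?l ?u))\<^sup>2"
  proof -
    have "?l \<bullet> i < ?u \<bullet> i" if "i \<in> Basis" for i using ab[OF that] cd[OF that] by (simp add: inner_add_left)
    then have "vol (box ?l ?u) = (\<Prod>i\<in>Basis. ?u \<bullet> i - ?l \<bullet> i)"
      by (simp add: measure_lborel_box_eq less_imp_le inner_diff_left)
    then show ?thesis by (simp add: prod_power_distrib)
  qed
  also have "\<dots> \<le> (vol (midsum (box a b) (box c d)))\<^sup>2"
    by (intro power_mono measure_mono_fmeasurable sub) (auto intro: lmeasurable_midsum)
  finally show ?thesis .
qed

text \<open>The induction of Hadwiger and Ohmann on the number of boxes. Two boxes of one family are
  separated by a coordinate hyperplane. The other family is cut by a parallel hyperplane in the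
  same ratio of volumes. The midpoint sets of corresponding parts lie on different sides of a
  third parallel hyperplane, so that their volumes add up, and since the ratios agree, so do the
  lower bounds that the induction hypothesis gives for them.\<close>

lemma box_family_midsum:
  assumes "box_family s" "box_family t" "s \<noteq> {}" "t \<noteq> {}"
  shows "vol (\<Union>s) * vol (\<Union>t) \<le> (vol (midsum (\<Union>s) (\<Union>t)))\<^sup>2"
  using assms
proof (induction "card s + card t" arbitrary: s t rule: less_induct)
  case less
  have pos: "vol (\<Union>r) > 0" if "box_family r" "r \<noteq> {}" for r :: "'a set set"
    using that by (intro measure_open_pos box_family_open box_family_bounded) (auto simp: box_family_def)
  have split: "vol (\<Union>s) * vol (\<Union>t) \<le> (vol (midsum (\<Union>s) (\<Union>t)))\<^sup>2"
    if s: "box_family s" "s \<noteq> {}" and t: "box_family t" "t \<noteq> {}" and two: "card s \<ge> 2"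
    and IH: "\<And>(s' :: 'a set set) (t' :: 'a set set). card s' + card t' < card s + card t \<Longrightarrow> box_family s' \<Longrightarrow> box_family t' \<Longrightarrow> s' \<noteq> {} \<Longrightarrow> t' \<noteq> {} \<Longrightarrow>
        vol (\<Union>s') * vol (\<Union>t') \<le> (vol (midsum (\<Union>s') (\<Union>t')))\<^sup>2"
    for s t :: "'a set set"
  proof -
    have fs: "finite s" and ft: "finite t" using s t by (auto simp: box_family_def)
    obtain K L where KL: "K \<in> s" "L \<in> s" "K \<noteq> L"
      using two by (metis card_le_Suc0_iff_eq fs not_less_eq_eq numeral_2_eq_2)
    obtain k c K L where kc: "k \<in> Basis" "K \<in> s" "L \<in> s" "K \<subseteq> {x. k \<bullet> x < c}" "L \<subseteq> {x. k \<bullet> x > c}"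
    proof -
      obtain a b a' b' where ab: "K = box a b" "L = box a' b'" "K \<noteq> {}" "L \<noteq> {}" "K \<inter> L = {}"
        using s KL unfolding box_family_def pairwise_def disjnt_def by metis
      have ne: "a \<bullet> i < b \<bullet> i" "a' \<bullet> i < b' \<bullet> i" if "i \<in> Basis" for i
        using ab(3,4) that unfolding ab(1,2) box_ne_empty by blast+
      have "\<exists>i\<in>Basis. b \<bullet> i \<le> a \<bullet> i \<or> b' \<bullet> i \<le> a' \<bullet> i \<or> b \<bullet> i \<le> a' \<bullet> i \<or> b' \<bullet> i \<le> a \<bullet> i"
        using ab(5) unfolding ab(1,2) disjoint_interval .
      then obtain k where k: "k \<in> Basis" and "b \<bullet> k \<le> a \<bullet> k \<or> b' \<bullet> k \<le> a' \<bullet> k \<or> b \<bullet> k \<le> a' \<bullet> k \<or> b' \<bullet> k \<le> a \<bullet> k" ..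
      then have k2: "b \<bullet> k \<le> a' \<bullet> k \<or> b' \<bullet> k \<le> a \<bullet> k" using ne[OF k] by linarith
      have sub: "box p q \<subseteq> {x. k \<bullet> x < q \<bullet> k}" "r \<le> p \<bullet> k \<Longrightarrow> box p q \<subseteq> {x. k \<bullet> x > r}" for p q r
      proof -
        have x: "p \<bullet> k < x \<bullet> k \<and> x \<bullet> k < q \<bullet> k" if "x \<in> box p q" for x
          using that k unfolding mem_box by blast
        show "box p q \<subseteq> {x. k \<bullet> x < q \<bullet> k}" using x by (simp add: subset_iff inner_commute[of k])
        show "box p q \<subseteq> {x. k \<bullet> x > r}" if "r \<le> p \<bullet> k" 
          using x that by (simp add: subset_iff inner_commute[of k]) (meson le_less_trans)
      qed
      from k2 show ?thesis
      proof
        assume "b \<bullet> k \<le> a' \<bullet> k"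
        then have l: "L \<subseteq> {x. k \<bullet> x > b \<bullet> k}" unfolding ab(2) by (rule sub(2))
        have "K \<subseteq> {x. k \<bullet> x < b \<bullet> k}" unfolding ab(1) by (rule sub(1))
        from that[OF k KL(1,2) this l] show ?thesis .
      next
        assume "b' \<bullet> k \<le> a \<bullet> k"
        then have l: "K \<subseteq> {x. k \<bullet> x > b' \<bullet> k}" unfolding ab(1) by (rule sub(2))
        have "L \<subseteq> {x. k \<bullet> x < b' \<bullet> k}" unfolding ab(2) by (rule sub(1))
        from that[OF k KL(2,1) this l] show ?thesis .
      qed
    qed
    have k0: "k \<noteq> 0" using kc(1) by auto
    obtain s1 where s1: "box_family s1" "\<Union>s1 = \<Union>s \<inter> {x. k \<bullet> x < c}" "card s1 \<le> card {K \<in> s. K \<inter> {x. k \<bullet> x < c} \<noteq> {}}"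
      using box_family_restrict[OF s(1) box_Int_halfspace(1)[OF kc(1)]] by blast
    obtain s2 where s2: "box_family s2" "\<Union>s2 = \<Union>s \<inter> {x. k \<bullet> x > c}" "card s2 \<le> card {K \<in> s. K \<inter> {x. k \<bullet> x > c} \<noteq> {}}"
      using box_family_restrict[OF s(1) box_Int_halfspace(2)[OF kc(1)]] by blast
    have neK: "K \<noteq> {}" "L \<noteq> {}" using s kc(2,3) by (auto simp: box_family_def)
    have "L \<inter> {x. k \<bullet> x < c} = {}" "K \<inter> {x. k \<bullet> x > c} = {}" using kc(4,5) by auto
    then have "{K \<in> s. K \<inter> {x. k \<bullet> x < c} \<noteq> {}} \<subset> s" "{K \<in> s. K \<inter> {x. k \<bullet> x > c} \<noteq> {}} \<subset> s"
      using kc(2,3) by auto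
    from this[THEN psubset_card_mono[OF fs]] have c1: "card s1 < card s" and c2: "card s2 < card s"
      using s1(3) s2(3) by linarith+
    have "\<Union>s1 \<noteq> {}" "\<Union>s2 \<noteq> {}" using s1(2) s2(2) kc neK by blast+
    then have ne: "s1 \<noteq> {}" "s2 \<noteq> {}" by auto
    define \<mu> \<mu>1 \<mu>2 \<nu> where "\<mu> = vol (\<Union>s)" "\<mu>1 = vol (\<Union>s1)"
      "\<mu>2 = vol (\<Union>s2)" "\<nu> = vol (\<Union>t)"
    note defs = this
    have mpos: "\<mu> > 0" "\<mu>1 > 0" "\<mu>2 > 0" "\<nu> > 0"
      unfolding defs using pos s t s1(1) s2(1) ne by auto
    have sum: "\<mu> = \<mu>1 + \<mu>2"
      unfolding defs s1 s2 by (rule measure_slab_split[OF box_family_lmeasurable[OF s(1)] k0])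
    have bt: "bounded (\<Union>t)" using box_family_bounded t(1) by blast
    define f where "f r = vol (\<Union>t \<inter> {x. k \<bullet> x < r})" for r
    obtain M where M: "\<And>x. x \<in> \<Union>t \<Longrightarrow> norm x \<le> M" using bt unfolding bounded_iff by blast
    have Mk: "\<bar>k \<bullet> x\<bar> \<le> M" if "x \<in> \<Union>t" for x
      using Basis_le_norm[OF kc(1), of x] M[OF that] by (simp add: inner_commute)
    have "\<Union>t \<inter> {x. k \<bullet> x < -M-1} = {}" using Mk by fastforce
    then have f0: "f (-M-1) = 0" unfolding f_def by simp
    have "\<Union>t \<inter> {x. k \<bullet> x < M+1} = \<Union>t" using Mk by fastforce
    then have f1: "f (M+1) = \<nu>" unfolding f_def defs by simp
    have M0: "M \<ge> 0"
    proof -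
      obtain x where "x \<in> \<Union>t" using t unfolding box_family_def by blast
      then show ?thesis using M[of x] norm_ge_zero[of x] by linarith
    qed
    have cont: "continuous_on {-M-1..M+1} f"
      unfolding f_def
      by (rule continuous_on_subset[OF measure_slab_continuous[OF box_family_lmeasurable[OF t(1)] k0]]) simp
    have "\<nu> * \<mu>1 / \<mu> \<le> \<nu>" using mpos sum by (simp add: field_simps)
    then obtain r where r: "f r = \<nu> * \<mu>1 / \<mu>"
      using IVT'[of f "-M-1" "\<nu> * \<mu>1 / \<mu>" "M+1"] cont f0 f1 mpos M0 by auto
    obtain t1 where t1: "box_family t1" "\<Union>t1 = \<Union>t \<inter> {x. k \<bullet> x < r}" "card t1 \<le> card {K \<in> t. K \<inter> {x. k \<bullet> x < r} \<noteq> {}}"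
      using box_family_restrict[OF t(1) box_Int_halfspace(1)[OF kc(1)]] by blast
    obtain t2 where t2: "box_family t2" "\<Union>t2 = \<Union>t \<inter> {x. k \<bullet> x > r}" "card t2 \<le> card {K \<in> t. K \<inter> {x. k \<bullet> x > r} \<noteq> {}}"
      using box_family_restrict[OF t(1) box_Int_halfspace(2)[OF kc(1)]] by blast
    have "card {K \<in> t. K \<inter> {x. k \<bullet> x < r} \<noteq> {}} \<le> card t" "card {K \<in> t. K \<inter> {x. k \<bullet> x > r} \<noteq> {}} \<le> card t"
      by (intro card_mono ft; blast)+
    then have ct: "card t1 \<le> card t" "card t2 \<le> card t" using t1 t2 by linarith+
    define \<nu>1 \<nu>2 where "\<nu>1 = vol (\<Union>t1)" "\<nu>2 = vol (\<Union>t2)"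
    note defs2 = this
    have n1: "\<nu>1 = \<nu> * \<mu>1 / \<mu>" using r unfolding defs2 f_def t1 .
    have "\<nu> = \<nu>1 + \<nu>2"
      unfolding defs defs2 t1 t2 by (rule measure_slab_split[OF box_family_lmeasurable[OF t(1)] k0])
    then have n2: "\<nu>2 = \<nu> * \<mu>2 / \<mu>" using n1 sum mpos by (simp add: field_simps)
    have "\<nu>1 > 0" "\<nu>2 > 0" using n1 n2 mpos by auto
    then have net: "t1 \<noteq> {}" "t2 \<noteq> {}" unfolding defs2 by auto
    define m m1 m2 where "m = vol (midsum (\<Union>s) (\<Union>t))" "m1 = vol (midsum (\<Union>s1) (\<Union>t1))"
      "m2 = vol (midsum (\<Union>s2) (\<Union>t2))"
    note defs3 = this
    have i1: "\<mu>1 * \<nu>1 \<le> m1\<^sup>2" unfolding defs defs2 defs3 using IH[of s1 t1] c1 ct(1) s1(1) t1(1) ne net by linarith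
    have i2: "\<mu>2 * \<nu>2 \<le> m2\<^sup>2" unfolding defs defs2 defs3 using IH[of s2 t2] c2 ct(2) s2(1) t2(1) ne net by linarith
    have meas: "midsum (\<Union>s') (\<Union>t') \<in> lmeasurable" if "box_family s'" "box_family t'" for s' t' :: "'a set set"
      using that by (intro lmeasurable_midsum box_family_open box_family_bounded)
    have "midsum (\<Union>s1) (\<Union>t1) \<subseteq> {x. k \<bullet> x < (c + r) / 2}"
      unfolding s1 t1 midsum_def by (auto simp: inner_add_right)
    moreover have "midsum (\<Union>s2) (\<Union>t2) \<subseteq> {x. k \<bullet> x > (c + r) / 2}"
      unfolding s2 t2 midsum_def by (auto simp: inner_add_right)
    ultimately have dj: "midsum (\<Union>s1) (\<Union>t1) \<inter> midsum (\<Union>s2) (\<Union>t2) = {}" by fastforce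
    have "m1 + m2 = vol (midsum (\<Union>s1) (\<Union>t1) \<union> midsum (\<Union>s2) (\<Union>t2))"
      using measure_Un3[OF meas[OF s1(1) t1(1)] meas[OF s2(1) t2(1)]] unfolding dj defs3 by simp
    also have "\<dots> \<le> m"
      unfolding defs3
    proof (rule measure_mono_fmeasurable)
      show "midsum (\<Union>s1) (\<Union>t1) \<union> midsum (\<Union>s2) (\<Union>t2) \<subseteq> midsum (\<Union>s) (\<Union>t)"
        using s1 s2 t1 t2 by (intro Un_least midsum_mono) auto
      show "midsum (\<Union>s1) (\<Union>t1) \<union> midsum (\<Union>s2) (\<Union>t2) \<in> sets lebesgue"
        by (intro sets.Un fmeasurableD meas s1(1) s2(1) t1(1) t2(1))
      show "midsum (\<Union>s) (\<Union>t) \<in> lmeasurable" using meas s t by blast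
    qed
    finally have m12: "m1 + m2 \<le> m" .
    \<comment> \<open>the induction hypothesis bounds the two parts by \<open>\<mu>1 * q\<close> and \<open>\<mu>2 * q\<close>\<close>
    define q where "q = sqrt (\<nu> / \<mu>)"
    have q: "q > 0" "q\<^sup>2 = \<nu> / \<mu>" using mpos by (auto simp: q_def)
    have "m1 \<ge> 0" "m2 \<ge> 0" unfolding defs3 by auto
    have "(\<mu>1 * q)\<^sup>2 \<le> m1\<^sup>2" "(\<mu>2 * q)\<^sup>2 \<le> m2\<^sup>2"
      using i1 i2 unfolding n1 n2 power_mult_distrib q by (simp_all add: power2_eq_square mult.commute mult.left_commute)
    then have "\<mu>1 * q \<le> m1" "\<mu>2 * q \<le> m2"
      using \<open>m1 \<ge> 0\<close> \<open>m2 \<ge> 0\<close> power2_le_imp_le by blast+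
    then have "\<mu> * q \<le> m" using m12 sum by (simp add: algebra_simps)
    then have "(\<mu> * q)\<^sup>2 \<le> m\<^sup>2" using mpos q by (intro power_mono) auto
    then show ?thesis unfolding power_mult_distrib q defs(1)[symmetric] defs(4)[symmetric] defs3(1)[symmetric]
      using mpos by (simp add: power2_eq_square field_simps)
  qed
  consider "card s \<ge> 2" | "card t \<ge> 2" | "card s < 2" "card t < 2" by linarith
  then show ?case
  proof cases
    case 1 then show ?thesis using split less by blast
  next
    case 2
    have "vol (\<Union>t) * vol (\<Union>s) \<le> (vol (midsum (\<Union>t) (\<Union>s)))\<^sup>2"
    proof (rule split)
      fix s' t' :: "'a set set"
      assume *: "card s' + card t' < card t + card s" "box_family s'" "box_family t'" "s' \<noteq> {}" "t' \<noteq> {}"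
      then show "vol (\<Union>s') * vol (\<Union>t') \<le> (vol (midsum (\<Union>s') (\<Union>t')))\<^sup>2"
        using less.hyps[of s' t'] by linarith
    qed (use less 2 in auto)
    then show ?thesis by (simp add: mult.commute midsum_commute)
  next
    case 3
    have "card s \<noteq> 0" "card t \<noteq> 0" using less.prems by (auto simp: box_family_def)
    with 3 have "card s = 1" "card t = 1" by linarith+
    then obtain K L where "s = {K}" "t = {L}" by (metis card_1_singletonE)
    moreover obtain a b where "K = box a b" "K \<noteq> {}"
      using less.prems(1) unfolding \<open>s = {K}\<close> box_family_def by auto
    moreover obtain c d where "L = box c d" "L \<noteq> {}"
      using less.prems(2) unfolding \<open>t = {L}\<close> box_family_def by auto
    ultimately show ?thesis using midsum_boxes[of a b c d] by simp
  qed
qed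

lemma open_inner_box_family:
  fixes S :: "'a::euclidean_space set"
  assumes "open S" "bounded S" "e > 0"
  obtains s where "box_family s" "\<Union>s \<subseteq> S" "vol S < vol (\<Union>s) + e"
proof -
  obtain \<D> where \<D>: "countable \<D>" "\<D> \<subseteq> Pow S" "\<And>X. X \<in> \<D> \<Longrightarrow> \<exists>a b. X = cbox a b" "\<Union>\<D> = S"
    using open_countable_Union_open_cbox[OF assms(1)] by blast
  have "\<exists>\<F>. finite \<F> \<and> \<F> \<subseteq> \<D> \<and> vol S < vol (\<Union>\<F>) + e"
  proof -
    have mD: "\<And>D. D \<in> \<D> \<Longrightarrow> D \<in> lmeasurable" using \<D>(3) by fastforce
    have "vol (\<Union>\<F>) \<le> vol S" if "\<F> \<subseteq> \<D>" "finite \<F>" for \<F>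
    proof (rule measure_mono_fmeasurable)
      show "\<Union>\<F> \<subseteq> S" using that \<D>(4) by blast
      show "\<Union>\<F> \<in> sets lebesgue" using that mD by (intro sets.finite_Union) auto
      show "S \<in> lmeasurable" using assms lmeasurable_open by blast
    qed
    then obtain \<F> where "\<F> \<subseteq> \<D>" "finite \<F>" "vol (\<Union>\<D>) - e < vol (\<Union>\<F>)"
      using measure_countable_Union_approachable[OF \<D>(1) assms(3) mD, of "vol S"] by blast
    then show ?thesis unfolding \<D>(4) by (intro exI[of _ \<F>]) auto
  qed
  then obtain \<F> where F: "finite \<F>" "\<F> \<subseteq> \<D>" "vol S < vol (\<Union>\<F>) + e" by blast
  obtain p where p: "p division_of \<Union>\<F>"
    using elementary_unions_intervals[OF F(1)] \<D>(3) F(2) by (metis subsetD)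
  define s where "s = interior ` p - {{}}"
  have bs: "box_family s"
    unfolding box_family_def
  proof (intro conjI ballI)
    show "finite s" using division_ofD(1)[OF p] by (simp add: s_def)
    show "pairwise disjnt s"
      using division_ofD(5)[OF p] unfolding s_def pairwise_def disjnt_def by blast
    fix K assume "K \<in> s"
    then obtain K' where "K' \<in> p" "K = interior K'" "K \<noteq> {}" by (auto simp: s_def)
    then show "K \<noteq> {}" "\<exists>a b. K = box a b" using division_ofD(4)[OF p] by (metis interior_cbox)+
  qed
  have sub: "\<Union>s \<subseteq> \<Union>p" using interior_subset unfolding s_def by fastforce
  have neg: "negligible (\<Union>K\<in>p. frontier K)"
  proof (rule negligible_Union)
    show "finite (frontier ` p)" using division_ofD(1)[OF p] by simp
    show "negligible T" if "T \<in> frontier ` p" for T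
      using that division_ofD(4)[OF p] by (metis convex_box(1) image_iff negligible_convex_frontier)
  qed
  have "vol (\<Union>p) = vol (\<Union>s)"
  proof (rule measure_negligible_symdiff[OF box_family_lmeasurable[OF bs]])
    have "\<Union>p - \<Union>s \<subseteq> (\<Union>K\<in>p. frontier K)"
    proof
      fix x assume x: "x \<in> \<Union>p - \<Union>s"
      then obtain K where K: "K \<in> p" "x \<in> K" by blast
      then have "x \<notin> interior K" using x unfolding s_def by blast
      then show "x \<in> (\<Union>K\<in>p. frontier K)"
        using K closure_subset[of K] unfolding frontier_def by blast
    qed
    then have "sym_diff (\<Union>s) (\<Union>p) \<subseteq> (\<Union>K\<in>p. frontier K)" using sub by blast
    then show "negligible (sym_diff (\<Union>s) (\<Union>p))" using neg negligible_subset by blast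
  qed
  then have m: "vol (\<Union>\<F>) = vol (\<Union>s)" using division_ofD(6)[OF p] by simp
  have "\<Union>s \<subseteq> S" using sub division_ofD(6)[OF p] F(2) \<D>(4) by blast
  with bs that F(3) m show ?thesis by metis
qed

text \<open>The multiplicative form does not mention the dimension; it passes from families of boxes to
  open sets by approximation from inside.\<close>

lemma brunn_minkowski_midsum:
  fixes A B :: "'a::euclidean_space set"
  assumes A: "open A" "bounded A" and B: "open B" "bounded B"
  shows "vol A * vol B \<le> (vol (midsum A B))\<^sup>2"
proof (cases "vol A = 0 \<or> vol B = 0")
  case True then show ?thesis by auto
next
  case False
  define a b m where "a = vol A" "b = vol B" "m = vol (midsum A B)"
  note defs = this
  have ab: "a > 0" "b > 0" using False by (auto simp: defs zero_less_measure_iff)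
  have *: "(a - e) * (b - e) \<le> m\<^sup>2" if e: "e > 0" "e < a" "e < b" for e
  proof -
    obtain s where s: "box_family s" "\<Union>s \<subseteq> A" "vol A < vol (\<Union>s) + e"
      using open_inner_box_family[OF A e(1)] by blast
    obtain t where t: "box_family t" "\<Union>t \<subseteq> B" "vol B < vol (\<Union>t) + e"
      using open_inner_box_family[OF B e(1)] by blast
    have "s \<noteq> {}" "t \<noteq> {}" using s t e defs by auto
    have "(a - e) * (b - e) \<le> vol (\<Union>s) * vol (\<Union>t)"
      using s t e defs by (intro mult_mono) auto
    also have "\<dots> \<le> (vol (midsum (\<Union>s) (\<Union>t)))\<^sup>2"
      using box_family_midsum s t \<open>s \<noteq> {}\<close> \<open>t \<noteq> {}\<close> by blast
    also have "\<dots> \<le> m\<^sup>2"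
      unfolding defs
      by (intro power_mono measure_mono_fmeasurable midsum_mono s t)
        (use A B s t in \<open>auto intro!: lmeasurable_midsum fmeasurableD[OF lmeasurable_midsum] box_family_open box_family_bounded\<close>)
    finally show ?thesis .
  qed
  have "((\<lambda>e. (a - e) * (b - e)) \<longlongrightarrow> (a - 0) * (b - 0)) (at_right 0)"
    by (intro tendsto_intros)
  moreover have "\<forall>\<^sub>F e in at_right 0. (a - e) * (b - e) \<le> m\<^sup>2"
    unfolding eventually_at_right_field using * ab by (intro exI[of _ "min a b"]) auto
  ultimately have "(a - 0) * (b - 0) \<le> m\<^sup>2"
    by (intro tendsto_upperbound) auto
  then show ?thesis by (simp add: defs)
qed

section \<open>The equality case for a convex body and its reflection\<close>

text \<open>Applied to the terms number \<open>k\<close> and \<open>k + 2\<close> of an arithmetic progression, the hypothesis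
  bounds an increment of \<open>A\<close> by the next increment of \<open>B\<close>. The sum over the progression
  telescopes up to a shift by one step, which disappears as the step tends to zero.\<close>

lemma midpoint_inequality_increments:
  fixes A B :: "real \<Rightarrow> real"
  assumes cont: "continuous_on {..<0} B"
    and mid: "\<And>x y. x < 0 \<Longrightarrow> y < 0 \<Longrightarrow> A ((x + y) / 2) + B ((x + y) / 2) \<le> A x + B y"
    and xy: "x < y" "y < 0"
  shows "A y - A x \<le> B y - B x"
proof -
  define h where "h N = (y - x) / real N" for N
  have h0: "h \<longlonglongrightarrow> 0" unfolding h_def by (rule lim_const_over_n)
  have step: "A y - A x \<le> B (y + h N) - B (x + h N)" if N: "N > 0" "y + h N < 0" for N
  proof -
    have hp: "h N > 0" and yh: "x + real N * h N = y" using xy N by (auto simp: h_def)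
    have neg: "x + real k * h N < 0" if "k \<le> Suc N" for k
    proof -
      have "real k * h N \<le> real (Suc N) * h N" using that hp by (intro mult_right_mono) auto
      then show ?thesis using yh N(2) by (simp add: algebra_simps)
    qed
    have "A (x + real (Suc k) * h N) - A (x + real k * h N)
        \<le> B (x + h N + real (Suc k) * h N) - B (x + h N + real k * h N)" if "k < N" for k
    proof -
      have e: "((x + real k * h N) + (x + real (Suc (Suc k)) * h N)) / 2 = x + real (Suc k) * h N"
        by (simp add: algebra_simps)
      have e2: "x + h N + real (Suc k) * h N = x + real (Suc (Suc k)) * h N" "x + h N + real k * h N = x + real (Suc k) * h N"
        by (simp_all add: algebra_simps)
      show ?thesis
        using mid[OF neg[of k] neg[of "Suc (Suc k)"]] that unfolding e e2 by simp
    qed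
    then have "(\<Sum>k<N. A (x + real (Suc k) * h N) - A (x + real k * h N))
        \<le> (\<Sum>k<N. B (x + h N + real (Suc k) * h N) - B (x + h N + real k * h N))"
      by (intro sum_mono) auto
    then have "A (x + real N * h N) - A x \<le> B (x + h N + real N * h N) - B (x + h N)"
      using sum_lessThan_telescope[of "\<lambda>k. A (x + real k * h N)" N]
        sum_lessThan_telescope[of "\<lambda>k. B (x + h N + real k * h N)" N] by simp
    moreover have "x + h N + real N * h N = y + h N" using yh by simp
    ultimately show ?thesis using yh by simp
  qed
  have iso: "isCont B z" if "z < 0" for z
    using cont that by (simp add: continuous_on_eq_continuous_at)
  have shift: "(\<lambda>N. z + h N) \<longlonglongrightarrow> z" for z
    using tendsto_add[OF tendsto_const[of z] h0] by simp
  have lim: "(\<lambda>N. B (y + h N) - B (x + h N)) \<longlonglongrightarrow> B y - B x"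
    using xy by (intro tendsto_diff isCont_tendsto_compose[OF iso shift]) auto
  have "\<forall>\<^sub>F N in sequentially. y + h N < 0" using order_tendstoD(2)[OF shift[of y]] xy by blast
  then have "\<forall>\<^sub>F N in sequentially. A y - A x \<le> B (y + h N) - B (x + h N)"
    using eventually_gt_at_top[of 0] by eventually_elim (use step in blast)
  then show ?thesis using tendsto_lowerbound[OF lim] by simp
qed

text \<open>Here \<open>F s\<close> is the volume of a convex body of volume \<open>V\<close> below the level \<open>s\<close>, and
  \<open>V - F (- s)\<close> that of its reflection; \<open>\<Phi>\<close> belongs to the midpoint set of both, which has
  volume \<open>W\<close>. The hypotheses \<open>low\<close> and \<open>up\<close> are the Brunn--Minkowski inequalities for the parts
  below and above a level. Let \<open>a p\<close> and \<open>b p\<close> be the levels at which the volume \<open>p\<close> is cut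
  off from the body and from its reflection. As \<open>W \<le> V\<close>, both inequalities are equalities
  there, that is, \<open>\<Phi>\<close> takes the value \<open>p\<close> at \<open>e p = (a p + b p) / 2\<close>. For different \<open>p\<close>
  and \<open>q\<close> the lower inequality then says that \<open>e (sqrt (p * q)) \<le> (a p + b q) / 2\<close>,
  which is a midpoint inequality on a logarithmic scale and makes \<open>a - b\<close> constant.\<close>

lemma symmetric_profile:
  fixes F \<Phi> :: "real \<Rightarrow> real"
  assumes V: "V > 0" "W \<le> V" and ab: "\<alpha> < \<beta>"
    and F: "strict_mono_on {\<alpha><..<\<beta>} F" "F ` {\<alpha><..<\<beta>} = {0<..<V}"
    and \<Phi>: "mono \<Phi>" "\<And>r. 0 \<le> \<Phi> r" "\<And>r. \<Phi> r \<le> W"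
    and low: "\<And>x y. F x * (V - F (- y)) \<le> (\<Phi> ((x + y) / 2))\<^sup>2"
    and up: "\<And>x y. (V - F x) * F (- y) \<le> (W - \<Phi> ((x + y) / 2))\<^sup>2"
    and x: "x \<in> {\<alpha><..<\<beta>}"
  shows "F (\<alpha> + \<beta> - x) = V - F x"
proof -
  define I where "I = {\<alpha><..<\<beta>}"
  have inj: "inj_on F I" using F(1) strict_mono_on_imp_inj_on I_def by blast
  define a where "a = the_inv_into I F"
  have aF: "a (F z) = z" if "z \<in> I" for z using the_inv_into_f_f[OF inj that] by (simp add: a_def)
  have Fa: "F (a p) = p" "a p \<in> I" if "p \<in> {0<..<V}" for p
    using that F(2) f_the_inv_into_f[OF inj, of p] the_inv_into_into[OF inj, of p I] by (auto simp: a_def I_def)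
  have amono: "a p \<le> a q" if "p \<in> {0<..<V}" "q \<in> {0<..<V}" "p \<le> q" for p q
  proof (rule ccontr)
    assume "\<not> a p \<le> a q"
    then have "F (a q) < F (a p)"
      using F(1) Fa(2)[OF that(1)] Fa(2)[OF that(2)] unfolding I_def by (intro strict_mono_onD[OF F(1)]) auto
    then show False using Fa(1) that by simp
  qed
  have aim: "a ` {0<..<V} = I"
  proof
    show "a ` {0<..<V} \<subseteq> I" using Fa by blast
    show "I \<subseteq> a ` {0<..<V}" using aF F(2) I_def by (metis imageI image_eqI subsetI)
  qed
  have acont: "continuous_on {0<..<V} a"
    by (rule continuous_onI_mono) (use amono in \<open>auto simp: aim I_def\<close>)
  define b where "b p = - a (V - p)" for p
  have bcont: "continuous_on {0<..<V} b"
  proof -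
    have "continuous_on {0<..<V} (\<lambda>p. a (V - p))"
      by (rule continuous_on_compose2[OF acont, of _ "\<lambda>p. V - p"]) (auto intro!: continuous_intros)
    then show ?thesis unfolding b_def by (rule continuous_on_minus)
  qed
  define e where "e p = (a p + b p) / 2" for p
  have econt: "continuous_on {0<..<V} e"
    unfolding e_def by (intro continuous_intros acont bcont) auto
  have FB: "F (- b p) = V - p" if "p \<in> {0<..<V}" for p
    using Fa(1)[of "V - p"] that by (simp add: b_def)
  have Phie: "\<Phi> (e p) = p" if p: "p \<in> {0<..<V}" for p
  proof -
    have "p\<^sup>2 \<le> (\<Phi> (e p))\<^sup>2"
      using low[of "a p" "b p"] FB[OF p] Fa(1)[OF p] by (simp add: e_def power2_eq_square)
    then have 1: "p \<le> \<Phi> (e p)" using \<Phi>(2) power2_le_imp_le by blast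
    have "(V - p)\<^sup>2 \<le> (W - \<Phi> (e p))\<^sup>2"
      using up[of "a p" "b p"] FB[OF p] Fa(1)[OF p] by (simp add: e_def power2_eq_square)
    then have "V - p \<le> W - \<Phi> (e p)" using \<Phi>(3)[of "e p"] power2_le_imp_le[of "V - p" "W - \<Phi> (e p)"] by simp
    with 1 V show ?thesis by linarith
  qed
  have key: "e (sqrt (p * q)) \<le> (a p + b q) / 2" if p: "p \<in> {0<..<V}" and q: "q \<in> {0<..<V}" for p q
  proof (rule ccontr)
    let ?g = "sqrt (p * q)"
    assume "\<not> e ?g \<le> (a p + b q) / 2"
    then have lt: "(a p + b q) / 2 < e ?g" by simp
    have "p * q < V * V" using p q by (intro mult_strict_mono) auto
    then have "?g < sqrt (V * V)" using real_sqrt_less_mono by blast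
    then have g: "?g \<in> {0<..<V}" using p q V by simp
    have "isCont e ?g" using econt g by (simp add: continuous_on_eq_continuous_at)
    then have "(e \<longlongrightarrow> e ?g) (at_left ?g)" by (simp add: isCont_def filterlim_at_split)
    from order_tendstoD(1)[OF this lt]
    have "\<forall>\<^sub>F p' in at_left ?g. (a p + b q) / 2 < e p'" .
    moreover have "\<forall>\<^sub>F p' in at_left ?g. p' \<in> {0<..<?g}"
      using g by (intro eventually_at_left_real) auto
    ultimately have "\<forall>\<^sub>F p' in at_left ?g. (a p + b q) / 2 < e p' \<and> p' \<in> {0<..<?g}" by eventually_elim auto
    then obtain p' where p': "(a p + b q) / 2 < e p'" "p' \<in> {0<..<?g}"
      using eventually_happens'[OF trivial_limit_at_left_real] by blast
    have "p * q \<le> (\<Phi> ((a p + b q) / 2))\<^sup>2"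
      using low[of "a p" "b q"] FB[OF q] Fa(1)[OF p] by simp
    then have "?g \<le> \<Phi> ((a p + b q) / 2)" using \<Phi>(2) real_le_lsqrt by simp
    also have "\<dots> \<le> \<Phi> (e p')" by (rule monoD[OF \<Phi>(1)]) (use p' in simp)
    also have "\<dots> = p'" using Phie p' g by auto
    finally show False using p' by simp
  qed
  define A B where "A c = a (V * exp c)" "B c = b (V * exp c)" for c
  note ABdef = this
  have inV: "V * exp c \<in> {0<..<V}" if "c < 0" for c using that V by simp
  have Acont: "continuous_on {..<0} A" and Bcont: "continuous_on {..<0} B"
  proof -
    have e: "continuous_on {..<0} (\<lambda>c. V * exp c)" "(\<lambda>c. V * exp c) ` {..<0} \<subseteq> {0<..<V}"
      using inV by (auto intro!: continuous_intros)
    show "continuous_on {..<0} A" unfolding ABdef by (rule continuous_on_compose2[OF acont e])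
    show "continuous_on {..<0} B" unfolding ABdef by (rule continuous_on_compose2[OF bcont e])
  qed
  have mid: "A ((s + t) / 2) + B ((s + t) / 2) \<le> A s + B t" if "s < 0" "t < 0" for s t
  proof -
    have "sqrt (V * exp s * (V * exp t)) = V * exp ((s + t) / 2)"
    proof (rule real_sqrt_unique)
      have "exp ((s + t) / 2) * exp ((s + t) / 2) = exp s * exp t"
        unfolding mult_exp_exp by (simp add: field_simps)
      then show "(V * exp ((s + t) / 2))\<^sup>2 = V * exp s * (V * exp t)"
        by (simp add: power2_eq_square ac_simps)
    qed (use V in simp)
    then show ?thesis using key[OF inV[OF that(1)] inV[OF that(2)]] by (simp add: ABdef e_def)
  qed
  have const: "A s - B s = A t - B t" if "s < 0" "t < 0" for s t
  proof -
    have "A y - A x = B y - B x" if "x < y" "y < 0" for x y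
    proof (rule antisym)
      show "A y - A x \<le> B y - B x"
        by (rule midpoint_inequality_increments[where A = A and B = B, OF Bcont mid that])
      show "B y - B x \<le> A y - A x"
      proof (rule midpoint_inequality_increments[where A = B and B = A, OF Acont _ that])
        fix x y :: real assume "x < 0" "y < 0"
        then show "B ((x + y) / 2) + A ((x + y) / 2) \<le> B x + A y"
          using mid[of y x] by (simp add: add.commute)
      qed
    qed
    from this[of s t] this[of t s] that show ?thesis by (cases s t rule: linorder_cases) auto
  qed
  define m where "m = A (-1) - B (-1)"
  have am: "a p + a (V - p) = m" if p: "p \<in> {0<..<V}" for p
  proof -
    have "ln (p / V) < 0" "V * exp (ln (p / V)) = p" using p V by (auto simp: field_simps)
    then show ?thesis using const[of "ln (p / V)" "-1"] unfolding m_def ABdef by (simp add: b_def)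
  qed
  have Fm: "m - z \<in> I \<and> F (m - z) = V - F z" if z: "z \<in> I" for z
  proof -
    have p: "F z \<in> {0<..<V}" using F(2) z I_def by blast
    then have p': "V - F z \<in> {0<..<V}" by auto
    have "a (V - F z) = m - z" using am[OF p] aF[OF z] by simp
    then show ?thesis using Fa[OF p'] by simp
  qed
  have "m = \<alpha> + \<beta>"
  proof (rule antisym)
    show "m \<le> \<alpha> + \<beta>"
    proof (rule field_le_epsilon)
      fix \<epsilon> :: real assume "\<epsilon> > 0"
      define z where "z = \<alpha> + min \<epsilon> ((\<beta> - \<alpha>) / 2)"
      have "z \<in> I" "z \<le> \<alpha> + \<epsilon>" using \<open>\<epsilon> > 0\<close> ab by (auto simp: z_def I_def min_def field_simps)
      then show "m \<le> \<alpha> + \<beta> + \<epsilon>" using Fm[of z] by (auto simp: I_def)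
    qed
    show "\<alpha> + \<beta> \<le> m"
    proof (rule field_le_epsilon)
      fix \<epsilon> :: real assume "\<epsilon> > 0"
      define z where "z = \<beta> - min \<epsilon> ((\<beta> - \<alpha>) / 2)"
      have "z \<in> I" "z \<ge> \<beta> - \<epsilon>" using \<open>\<epsilon> > 0\<close> ab by (auto simp: z_def I_def min_def field_simps)
      then show "\<alpha> + \<beta> \<le> m + \<epsilon>" using Fm[of z] by (auto simp: I_def)
    qed
  qed
  then show ?thesis using Fm x I_def by simp
qed

lemma measure_uminus_image:
  fixes S :: "'a::euclidean_space set"
  shows "vol (uminus ` S) = vol S"
  using measure_lebesgue_affine[of "-1" "0::'a" S] by simp

lemma convex_slab_volume:
  fixes K :: "'a::euclidean_space set"
  assumes K: "open K" "convex K" "bounded K" "K \<noteq> {}" and u: "u \<noteq> 0"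
  defines "F \<equiv> \<lambda>s. vol (K \<inter> {x. u \<bullet> x < s})"
  defines "\<alpha> \<equiv> Inf ((\<bullet>) u ` K)" and "\<beta> \<equiv> Sup ((\<bullet>) u ` K)"
  shows "\<alpha> < \<beta>" and "strict_mono_on {\<alpha><..<\<beta>} F" and "F ` {\<alpha><..<\<beta>} = {0<..<vol K}"
    and "\<And>s. s \<le> \<alpha> \<Longrightarrow> F s = 0" and "\<And>s. s \<ge> \<beta> \<Longrightarrow> F s = vol K"
    and "\<And>x. x \<in> K \<Longrightarrow> \<alpha> < u \<bullet> x \<and> u \<bullet> x < \<beta>"
proof -
  let ?J = "(\<bullet>) u ` K"
  have mK: "K \<in> lmeasurable" using K lmeasurable_open by blast
  have bJ: "bounded ?J" using K(3) bounded_linear_image bounded_linear_inner_right by blast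
  have lo: "\<alpha> \<le> u \<bullet> x" and hi: "u \<bullet> x \<le> \<beta>" if "x \<in> K" for x
    unfolding \<alpha>_def \<beta>_def using that bJ
    by (auto intro!: cInf_lower cSup_upper bounded_imp_bdd_below bounded_imp_bdd_above)
  show strict: "\<alpha> < u \<bullet> x \<and> u \<bullet> x < \<beta>" if "x \<in> K" for x
  proof -
    obtain e where e: "e > 0" "cball x e \<subseteq> K" using K(1) \<open>x \<in> K\<close> open_contains_cball by blast
    let ?t = "e / norm u"
    have "x + ?t *\<^sub>R u \<in> cball x e" "x - ?t *\<^sub>R u \<in> cball x e" using e u by (auto simp: dist_norm)
    then have "x + ?t *\<^sub>R u \<in> K" "x - ?t *\<^sub>R u \<in> K" using e by blast+
    from hi[OF this(1)] lo[OF this(2)] have "u \<bullet> x + ?t * (u \<bullet> u) \<le> \<beta>" "\<alpha> \<le> u \<bullet> x - ?t * (u \<bullet> u)"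
      by (simp_all add: inner_add_right inner_diff_right)
    moreover have "?t * (u \<bullet> u) > 0" using e u by simp
    ultimately show ?thesis by linarith
  qed
  show ab: "\<alpha> < \<beta>" using strict K(4) by fastforce
  have hit: "\<exists>x\<in>K. u \<bullet> x = s" if "\<alpha> < s" "s < \<beta>" for s
  proof -
    have "?J \<noteq> {}" using K(4) by simp
    then have "\<exists>p\<in>?J. p < s" "\<exists>q\<in>?J. s < q"
      using cInf_lessD[of ?J s] less_cSupD[of ?J s] that unfolding \<alpha>_def \<beta>_def by blast+
    then obtain x y where xy: "x \<in> K" "u \<bullet> x < s" "y \<in> K" "s < u \<bullet> y" by blast
    have "continuous_on K ((\<bullet>) u)" by (intro continuous_intros)
    then have "connected ?J" using convex_connected[OF K(2)] connected_continuous_image by blast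
    then have "s \<in> ?J" using xy by (meson connectedD_interval imageI less_imp_le)
    then show ?thesis by auto
  qed
  have pos: "vol (K \<inter> U) > 0" if "open U" "x \<in> K" "x \<in> U" for U x
    using that K by (intro measure_open_pos) (auto intro: bounded_subset)
  have comp: "vol K - F s = vol (K \<inter> {x. u \<bullet> x > s})" for s
    using measure_slab_split[OF mK u, of s] by (simp add: F_def)
  show "strict_mono_on {\<alpha><..<\<beta>} F"
  proof (rule strict_mono_onI)
    fix s t assume st: "s \<in> {\<alpha><..<\<beta>}" "t \<in> {\<alpha><..<\<beta>}" "s < t"
    obtain z where z: "z \<in> K" "u \<bullet> z = (s + t) / 2" using hit[of "(s + t) / 2"] st by auto
    let ?A = "K \<inter> {x. u \<bullet> x < t}"
    have mA: "?A \<in> lmeasurable" by (rule lmeasurable_Int_open[OF mK open_halfspace_lt])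
    have "?A \<inter> {x. u \<bullet> x < s} = K \<inter> {x. u \<bullet> x < s}" using st by auto
    then have "F t = F s + vol (?A \<inter> {x. u \<bullet> x > s})"
      using measure_slab_split[OF mA u, of s] by (simp add: F_def)
    moreover have "vol (K \<inter> ({x. u \<bullet> x < t} \<inter> {x. u \<bullet> x > s})) > 0"
      using z st by (intro pos[of _ z] open_Int open_halfspace_lt open_halfspace_gt) auto
    ultimately show "F s < F t" by (simp add: Int_assoc)
  qed
  show F0: "F s = 0" if "s \<le> \<alpha>" for s
  proof -
    have "K \<inter> {x. u \<bullet> x < s} = {}" using strict that by fastforce
    then show ?thesis by (simp add: F_def)
  qed
  show FV: "F s = vol K" if "s \<ge> \<beta>" for s
  proof -
    have "K \<inter> {x. u \<bullet> x < s} = K" using strict that by fastforce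
    then show ?thesis by (simp add: F_def)
  qed
  show "F ` {\<alpha><..<\<beta>} = {0<..<vol K}"
  proof (intro equalityI subsetI)
    fix p assume "p \<in> F ` {\<alpha><..<\<beta>}"
    then obtain s where s: "\<alpha> < s" "s < \<beta>" "p = F s" by auto
    obtain x y where "x \<in> K" "u \<bullet> x = (\<alpha> + s) / 2" "y \<in> K" "u \<bullet> y = (s + \<beta>) / 2"
      using hit[of "(\<alpha> + s) / 2"] hit[of "(s + \<beta>) / 2"] s by auto
    then have "vol (K \<inter> {x. u \<bullet> x < s}) > 0" "vol (K \<inter> {x. u \<bullet> x > s}) > 0"
      using s by (intro pos[of _ x] pos[of _ y] open_halfspace_lt open_halfspace_gt; simp)+
    then have "F s > 0" "vol K - F s > 0" unfolding comp by (simp_all add: F_def)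
    then show "p \<in> {0<..<vol K}" using s by simp
  next
    fix p assume p: "p \<in> {0<..<vol K}"
    have "continuous_on {\<alpha>..\<beta>} F"
      unfolding F_def by (rule continuous_on_subset[OF measure_slab_continuous[OF mK u]]) simp
    then obtain s where s: "\<alpha> \<le> s" "s \<le> \<beta>" "F s = p"
      using IVT'[of F \<alpha> p \<beta>] p F0[of \<alpha>] FV[of \<beta>] ab by auto
    then have "s \<noteq> \<alpha>" "s \<noteq> \<beta>" using p F0[of \<alpha>] FV[of \<beta>] by auto
    then show "p \<in> F ` {\<alpha><..<\<beta>}" using s by force
  qed
qed

text \<open>The images of the volume under \<open>u \<bullet> x\<close> and under \<open>m - u \<bullet> x\<close> are the same measure on the
  line, hence have the same mean.\<close>

lemma symmetric_profile_mean:
  fixes K :: "'a::euclidean_space set"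
  assumes K: "open K" "bounded K"
    and sym: "\<And>s. vol (K \<inter> {x. u \<bullet> x < m - s}) = vol (K \<inter> {x. u \<bullet> x > s})"
  shows "integrable (lebesgue_on K) (\<lambda>x. u \<bullet> x)"
    and "2 * (LINT x|lebesgue_on K. u \<bullet> x) = m * vol K"
proof -
  let ?M = "lebesgue_on K"
  have mK: "K \<in> lmeasurable" using K lmeasurable_open by blast
  have sK: "K \<in> sets lebesgue" using mK by (rule fmeasurableD)
  interpret M: finite_measure ?M using finite_measure_lebesgue_on[OF mK] .
  have meas: "(\<lambda>x. u \<bullet> x) \<in> borel_measurable ?M"
    by (intro continuous_imp_measurable_on_sets_lebesgue continuous_intros sK)
  obtain B where B: "\<And>x. x \<in> K \<Longrightarrow> norm x \<le> B" using K(2) unfolding bounded_iff by blast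
  show int: "integrable ?M (\<lambda>x. u \<bullet> x)"
  proof (rule M.integrable_const_bound[OF _ meas])
    show "AE x in ?M. norm (u \<bullet> x) \<le> norm u * B"
    proof (rule AE_I2)
      fix x assume "x \<in> space ?M"
      then have "norm x \<le> B" using B by (simp add: space_restrict_space)
      then show "norm (u \<bullet> x) \<le> norm u * B"
        by (metis Cauchy_Schwarz_ineq2 mult_left_mono norm_ge_zero order_trans real_norm_def)
    qed
  qed
  define \<nu> where "\<nu> = distr ?M borel (\<lambda>x. u \<bullet> x)"
  define \<nu>' where "\<nu>' = distr ?M borel (\<lambda>x. m - u \<bullet> x)"
  have meas': "(\<lambda>x. m - u \<bullet> x) \<in> borel_measurable ?M" using meas by simp
  have em: "emeasure ?M {x \<in> K. P x} = ennreal (vol (K \<inter> {x. P x}))" if "open {x. P x}" for P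
  proof -
    have "K \<inter> {x. P x} \<in> lmeasurable" by (rule lmeasurable_Int_open[OF mK that])
    moreover have "{x \<in> K. P x} = K \<inter> {x. P x}" by blast
    ultimately show ?thesis using sK
      by (simp add: emeasure_restrict_space emeasure_eq_measure2 fmeasurableD)
  qed
  have e1: "emeasure \<nu> {s<..} = ennreal (vol (K \<inter> {x. u \<bullet> x > s}))" for s
  proof -
    have "(\<lambda>x. u \<bullet> x) -` {s<..} \<inter> space ?M = {x \<in> K. u \<bullet> x > s}" by auto
    then show ?thesis unfolding \<nu>_def using meas em[OF open_halfspace_gt[of s u]] by (simp add: emeasure_distr)
  qed
  have e2: "emeasure \<nu>' {s<..} = ennreal (vol (K \<inter> {x. u \<bullet> x < m - s}))" for s
  proof -
    have "(\<lambda>x. m - u \<bullet> x) -` {s<..} \<inter> space ?M = {x \<in> K. u \<bullet> x < m - s}" by auto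
    then show ?thesis unfolding \<nu>'_def using meas' em[OF open_halfspace_lt[of u "m - s"]] by (simp add: emeasure_distr)
  qed
  have "\<nu> = \<nu>'"
    by (rule measure_eqI_lessThan) (auto simp: e1 e2 sym, auto simp: \<nu>_def \<nu>'_def)
  have "(LINT x|?M. u \<bullet> x) = (LINT s|\<nu>. s)" unfolding \<nu>_def by (simp add: integral_distr meas)
  also have "\<dots> = (LINT x|?M. m - u \<bullet> x)" unfolding \<open>\<nu> = \<nu>'\<close> \<nu>'_def by (simp add: integral_distr meas')
  also have "\<dots> = m * vol K - (LINT x|?M. u \<bullet> x)"
    using int sK by (simp add: measure_restrict_space)
  finally show "2 * (LINT x|?M. u \<bullet> x) = m * vol K" by simp
qed

text \<open>The centroid is halfway between the two supporting hyperplanes orthogonal to any direction,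
  because the volume profile in this direction is symmetric. A point whose reflection in the
  centroid is outside the body would contradict this for the direction of a separating
  hyperplane.\<close>

lemma convex_central_symmetry:
  fixes K :: "'a::euclidean_space set"
  assumes K: "open K" "convex K" "bounded K" "K \<noteq> {}"
    and le: "vol (midsum K (uminus ` K)) \<le> vol K"
  obtains c where "\<And>x. x \<in> closure K \<Longrightarrow> 2 *\<^sub>R c - x \<in> closure K"
proof -
  define V where "V = vol K"
  have V: "V > 0" unfolding V_def using measure_open_pos K by blast
  have mK: "K \<in> lmeasurable" using K lmeasurable_open by blast
  let ?K' = "uminus ` K" and ?M = "lebesgue_on K"
  have K': "open ?K'" "bounded ?K'" using K by (auto simp: open_negations)
  have mK': "?K' \<in> lmeasurable" using K' lmeasurable_open by blast
  let ?Q = "midsum K ?K'"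
  have oQ: "open ?Q" "bounded ?Q" using open_midsum[OF K(1)] bounded_midsum[OF K(3) K'(2)] by auto
  have mQ: "?Q \<in> lmeasurable" using oQ lmeasurable_open by blast
  interpret M: finite_measure ?M using finite_measure_lebesgue_on[OF mK] .
  have int: "integrable ?M (\<lambda>x. x)"
  proof -
    obtain B where B: "\<And>x. x \<in> K \<Longrightarrow> norm x \<le> B" using K(3) unfolding bounded_iff by blast
    have "AE x in ?M. norm x \<le> B" by (rule AE_I2) (use B in \<open>simp add: space_restrict_space\<close>)
    then show ?thesis
      by (rule M.integrable_const_bound)
        (intro continuous_imp_measurable_on_sets_lebesgue continuous_intros fmeasurableD[OF mK])
  qed
  define c where "c = (1 / V) *\<^sub>R (LINT x|?M. x)"
  have mean: "Sup ((\<bullet>) u ` K) + Inf ((\<bullet>) u ` K) = 2 * (u \<bullet> c)" if u: "u \<noteq> 0" for u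
  proof -
    define \<alpha> \<beta> where "\<alpha> = Inf ((\<bullet>) u ` K)" "\<beta> = Sup ((\<bullet>) u ` K)"
    note ab = this
    define F where "F s = vol (K \<inter> {x. u \<bullet> x < s})" for s
    define \<Phi> where "\<Phi> s = vol (?Q \<inter> {x. u \<bullet> x < s})" for s
    note slab = convex_slab_volume[OF K u, folded ab V_def, folded F_def]
    have Fc: "V - F s = vol (K \<inter> {x. u \<bullet> x > s})" for s
      using measure_slab_split[OF mK u, of s] by (simp add: V_def F_def)
    have Gl: "vol (?K' \<inter> {x. u \<bullet> x < y}) = V - F (- y)" for y
    proof -
      have "?K' \<inter> {x. u \<bullet> x < y} = uminus ` (K \<inter> {x. u \<bullet> x > - y})"
        by (auto simp: image_iff)
      then show ?thesis using measure_uminus_image Fc by metis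
    qed
    have Gu: "vol (?K' \<inter> {x. u \<bullet> x > y}) = F (- y)" for y
      using measure_slab_split[OF mK' u, of y] Gl[of y] by (simp add: V_def measure_uminus_image)
    have bd: "open (A \<inter> {x. u \<bullet> x < x0}) \<and> bounded (A \<inter> {x. u \<bullet> x < x0}) \<and> open (A \<inter> {x. u \<bullet> x > x0}) \<and> bounded (A \<inter> {x. u \<bullet> x > x0})"
      if "open A" "bounded A" for x0 A
      using that by (auto intro: open_Int open_halfspace_lt open_halfspace_gt bounded_subset)
    have sF: "F (\<alpha> + \<beta> - x) = V - F x" if x: "x \<in> {\<alpha><..<\<beta>}" for x
    proof (rule symmetric_profile[where \<Phi> = \<Phi> and W = "vol ?Q", OF V _ slab(1-3) _ _ _ _ _ x])
      show "vol ?Q \<le> V" using le by (simp add: V_def)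
      have sub: "?Q \<inter> {x. u \<bullet> x < r} \<in> lmeasurable" "?Q \<inter> {x. u \<bullet> x > r} \<in> lmeasurable" for r
        by (rule lmeasurable_Int_open[OF mQ open_halfspace_lt]) (rule lmeasurable_Int_open[OF mQ open_halfspace_gt])
      show "mono \<Phi>"
        unfolding \<Phi>_def by (intro monoI measure_mono_fmeasurable) (auto intro: fmeasurableD sub)
      show "0 \<le> \<Phi> r" for r by (simp add: \<Phi>_def)
      show "\<Phi> r \<le> vol ?Q" for r
        unfolding \<Phi>_def by (intro measure_mono_fmeasurable) (auto intro: fmeasurableD sub mQ)
      fix x y
      have "F x * (V - F (- y)) \<le> (vol (midsum (K \<inter> {z. u \<bullet> z < x}) (?K' \<inter> {z. u \<bullet> z < y})))\<^sup>2"
        unfolding F_def[of x] Gl[symmetric] using bd[OF K(1,3)] bd[OF K'] by (intro brunn_minkowski_midsum) blast+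
      also have "\<dots> \<le> (\<Phi> ((x + y) / 2))\<^sup>2"
        unfolding \<Phi>_def
      proof (intro power_mono measure_mono_fmeasurable sub)
        show "midsum (K \<inter> {z. u \<bullet> z < x}) (?K' \<inter> {z. u \<bullet> z < y}) \<subseteq> ?Q \<inter> {z. u \<bullet> z < (x + y) / 2}"
          unfolding midsum_def by (auto simp: inner_add_right inner_diff_right)
        show "midsum (K \<inter> {z. u \<bullet> z < x}) (?K' \<inter> {z. u \<bullet> z < y}) \<in> sets lebesgue"
          using bd[OF K(1,3)] bd[OF K'] by (intro fmeasurableD lmeasurable_midsum) blast+
      qed simp
      finally show "F x * (V - F (- y)) \<le> (\<Phi> ((x + y) / 2))\<^sup>2" .
      have "(V - F x) * F (- y) \<le> (vol (midsum (K \<inter> {z. u \<bullet> z > x}) (?K' \<inter> {z. u \<bullet> z > y})))\<^sup>2"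
        unfolding Fc[of x] Gu[symmetric] using bd[OF K(1,3)] bd[OF K'] by (intro brunn_minkowski_midsum) blast+
      also have "\<dots> \<le> (vol (?Q \<inter> {z. u \<bullet> z > (x + y) / 2}))\<^sup>2"
      proof (intro power_mono measure_mono_fmeasurable sub)
        show "midsum (K \<inter> {z. u \<bullet> z > x}) (?K' \<inter> {z. u \<bullet> z > y}) \<subseteq> ?Q \<inter> {z. u \<bullet> z > (x + y) / 2}"
          unfolding midsum_def by (auto simp: inner_add_right inner_diff_right)
        show "midsum (K \<inter> {z. u \<bullet> z > x}) (?K' \<inter> {z. u \<bullet> z > y}) \<in> sets lebesgue"
          using bd[OF K(1,3)] bd[OF K'] by (intro fmeasurableD lmeasurable_midsum) blast+
      qed simp
      also have "vol (?Q \<inter> {z. u \<bullet> z > (x + y) / 2}) = vol ?Q - \<Phi> ((x + y) / 2)"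
        using measure_slab_split[OF mQ u, of "(x + y) / 2"] by (simp add: \<Phi>_def)
      finally show "(V - F x) * F (- y) \<le> (vol ?Q - \<Phi> ((x + y) / 2))\<^sup>2" .
    qed
    have sF': "F (\<alpha> + \<beta> - s) = V - F s" for s
    proof -
      consider "s \<le> \<alpha>" | "s \<ge> \<beta>" | "s \<in> {\<alpha><..<\<beta>}" by force
      then show ?thesis
        by cases (use slab(1,4,5) sF in auto)
    qed
    have sym: "vol (K \<inter> {x. u \<bullet> x < \<alpha> + \<beta> - s}) = vol (K \<inter> {x. u \<bullet> x > s})" for s
      using sF'[of s] Fc[of s] by (simp add: F_def)
    have "2 * (LINT x|?M. u \<bullet> x) = (\<alpha> + \<beta>) * V"
      unfolding V_def by (rule symmetric_profile_mean(2)[OF K(1,3) sym])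
    moreover have "(LINT x|?M. u \<bullet> x) = u \<bullet> (LINT x|?M. x)"
      by (rule integral_inner_right) (rule int)
    ultimately have "2 * (u \<bullet> (LINT x|?M. x)) = (\<alpha> + \<beta>) * V" by simp
    then show ?thesis using V unfolding c_def ab[symmetric] by (simp add: field_simps)
  qed
  show thesis
  proof
    fix x assume x: "x \<in> closure K"
    show "2 *\<^sub>R c - x \<in> closure K"
    proof (rule ccontr)
      assume "2 *\<^sub>R c - x \<notin> closure K"
      then obtain u b where ub: "u \<bullet> (2 *\<^sub>R c - x) < b" "\<And>z. z \<in> closure K \<Longrightarrow> u \<bullet> z > b"
        using separating_hyperplane_closed_point[of "closure K" "2 *\<^sub>R c - x"] K(2) by (metis closed_closure convex_closure)
      have "u \<noteq> 0" using ub x by force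
      have bK: "bounded ((\<bullet>) u ` K)" using K(3) bounded_linear_image bounded_linear_inner_right by blast
      have "b \<le> Inf ((\<bullet>) u ` K)"
        using ub(2) K(4) closure_subset by (intro cInf_greatest) (auto intro: less_imp_le)
      moreover have "u \<bullet> x \<le> Sup ((\<bullet>) u ` K)"
      proof -
        have "K \<subseteq> {z. u \<bullet> z \<le> Sup ((\<bullet>) u ` K)}"
          using bK by (auto intro: cSup_upper bounded_imp_bdd_above)
        then have "closure K \<subseteq> {z. u \<bullet> z \<le> Sup ((\<bullet>) u ` K)}"
          by (intro closure_minimal closed_halfspace_le)
        then show ?thesis using x by blast
      qed
      ultimately show False using mean[OF \<open>u \<noteq> 0\<close>] ub(1) by (simp add: inner_diff_right)
    qed
  qed
qed

section \<open>Central symmetry of tiles\<close>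

lemma packing_finite:
  fixes K :: "'a::euclidean_space set"
  assumes K: "open K" "K \<noteq> {}" "K \<subseteq> ball 0 D"
    and disj: "\<And>t t'. t \<in> T \<Longrightarrow> t' \<in> T \<Longrightarrow> t \<noteq> t' \<Longrightarrow> (+) t ` K \<inter> (+) t' ` K = {}"
  shows "finite (T \<inter> ball 0 R)"
    and "real (card (T \<inter> ball 0 R)) * vol K \<le> vol (ball (0::'a) (R + D))"
proof -
  have bK: "bounded K" using K(3) bounded_ball bounded_subset by blast
  have pos: "vol K > 0" using measure_open_pos K bK by blast
  have mK: "(+) t ` K \<in> lmeasurable" for t
    using K bK by (intro lmeasurable_open open_translation bounded_translation)
  have bound: "real (card S) * vol K \<le> vol (ball (0::'a) (R + D))"
    if "finite S" "S \<subseteq> T \<inter> ball 0 R" for S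
  proof -
    have "real (card S) * vol K = (\<Sum>t\<in>S. vol ((+) t ` K))"
      by (simp add: measure_translation)
    also have "\<dots> = vol (\<Union>t\<in>S. (+) t ` K)"
      using that disj by (intro measure_UNION'[symmetric] mK) (auto simp: pairwise_def disjnt_def)
    also have "\<dots> \<le> vol (ball (0::'a) (R + D))"
    proof (rule measure_mono_fmeasurable)
      show "(\<Union>t\<in>S. (+) t ` K) \<subseteq> ball 0 (R + D)"
      proof clarsimp
        fix t x assume "t \<in> S" "x \<in> K"
        then have "norm t < R" "norm x < D" using that(2) K(3) by auto
        then show "norm (t + x) < R + D" using norm_triangle_ineq[of t x] by linarith
      qed
      show "(\<Union>t\<in>S. (+) t ` K) \<in> sets lebesgue" using that mK by (intro sets.finite_UN fmeasurableD) auto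
    qed simp
    finally show ?thesis .
  qed
  show fin: "finite (T \<inter> ball 0 R)"
  proof (rule ccontr)
    assume inf: "infinite (T \<inter> ball 0 R)"
    obtain n :: nat where n: "vol (ball (0::'a) (R + D)) < real n * vol K"
      using reals_Archimedean3[OF pos] by blast
    obtain S where "S \<subseteq> T \<inter> ball 0 R" "finite S" "card S = n"
      using infinite_arbitrarily_large[OF inf] by blast
    with bound[of S] n show False by simp
  qed
  show "real (card (T \<inter> ball 0 R)) * vol K \<le> vol (ball (0::'a) (R + D))"
    using bound[OF fin] by simp
qed

text \<open>In a ball of radius \<open>R\<close> there are, by the covering, at least as many translates as the volume
  of \<open>P\<close> goes into that of the ball, and by the packing at most as many as the volume of \<open>K\<close>
  goes into that of a ball whose radius is larger by a constant.\<close>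

lemma packing_density:
  fixes K P :: "'a::euclidean_space set"
  assumes K: "open K" "K \<noteq> {}" "bounded K"
    and disj: "\<And>t t'. t \<in> T \<Longrightarrow> t' \<in> T \<Longrightarrow> t \<noteq> t' \<Longrightarrow> (+) t ` K \<inter> (+) t' ` K = {}"
    and P: "P \<in> lmeasurable" "bounded P" and cover: "\<And>x. \<exists>t\<in>T. x - t \<in> P"
  shows "vol K \<le> vol P"
proof -
  obtain D where D: "D > 0" "K \<subseteq> ball 0 D" "P \<subseteq> ball 0 D"
  proof -
    have "bounded (K \<union> P)" using K P by simp
    then obtain D where "D > 0" "K \<union> P \<subseteq> ball 0 D" using bounded_subset_ballD by blast
    then show thesis using that by blast
  qed
  let ?n = "DIM('a)" and ?w = "vol (ball (0::'a) 1)"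
  have w: "?w > 0" using measure_open_pos[of "ball (0::'a) 1"] by simp
  have ball: "vol (ball (0::'a) R) = R ^ ?n * ?w" if "R \<ge> 0" for R
    using content_ball_conv_unit_ball[OF that, of "0::'a"] by simp
  have mP: "(+) t ` P \<in> lmeasurable" for t using P(1) by (simp add: measurable_translation)
  have bound: "vol K \<le> vol P * (1 + 2 * D / R) ^ ?n" if R: "R > 0" for R
  proof -
    let ?S = "T \<inter> ball 0 (R + D)"
    have fin: "finite ?S" by (rule packing_finite(1)[OF K(1,2) D(2) disj])
    have "ball 0 R \<subseteq> (\<Union>t\<in>?S. (+) t ` P)"
    proof
      fix x :: 'a assume x: "x \<in> ball 0 R"
      obtain t where t: "t \<in> T" "x - t \<in> P" using cover by blast
      have "norm (x - t) < D" using t D by auto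
      then have "norm t < R + D" using x norm_triangle_ineq2[of t x] by (simp add: norm_minus_commute)
      then show "x \<in> (\<Union>t\<in>?S. (+) t ` P)" using t by (intro UN_I[of t]) (auto simp: image_iff intro!: bexI[of _ "x - t"])
    qed
    then have "vol (ball (0::'a) R) \<le> vol (\<Union>t\<in>?S. (+) t ` P)"
      using fin mP by (intro measure_mono_fmeasurable fmeasurable.finite_UN) auto
    also have "\<dots> \<le> (\<Sum>t\<in>?S. vol ((+) t ` P))"
      using fin mP by (intro measure_UNION_le) (auto intro: fmeasurableD)
    also have "\<dots> = real (card ?S) * vol P" by (simp add: measure_translation)
    finally have 1: "R ^ ?n * ?w \<le> real (card ?S) * vol P" unfolding ball[OF less_imp_le[OF R]] .
    have 2: "real (card ?S) * vol K \<le> (R + 2 * D) ^ ?n * ?w"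
      using packing_finite(2)[where T = T and R = "R + D", OF K(1,2) D(2) disj] ball[of "R + 2 * D"] R D(1) by (simp add: algebra_simps)
    have "R ^ ?n * ?w * vol K \<le> (real (card ?S) * vol P) * vol K"
      by (rule mult_right_mono[OF 1]) simp
    also have "\<dots> = vol P * (real (card ?S) * vol K)" by simp
    also have "\<dots> \<le> vol P * ((R + 2 * D) ^ ?n * ?w)" by (rule mult_left_mono[OF 2]) simp
    finally have "R ^ ?n * vol K * ?w \<le> vol P * (R + 2 * D) ^ ?n * ?w" by (simp add: ac_simps)
    then have "R ^ ?n * vol K \<le> vol P * (R + 2 * D) ^ ?n" using w by simp
    moreover have "R + 2 * D = R * (1 + 2 * D / R)" using R by (simp add: field_simps)
    ultimately have "R ^ ?n * vol K \<le> R ^ ?n * (vol P * (1 + 2 * D / R) ^ ?n)"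
      by (simp add: power_mult_distrib ac_simps)
    then show ?thesis using R by simp
  qed
  have "((\<lambda>R. vol P * (1 + 2 * D * inverse R) ^ ?n) \<longlongrightarrow> vol P * (1 + 2 * D * 0) ^ ?n) at_top"
    by (intro tendsto_intros tendsto_inverse_0_at_top filterlim_ident)
  moreover have "\<forall>\<^sub>F R in at_top. vol K \<le> vol P * (1 + 2 * D * inverse R) ^ ?n"
    using eventually_gt_at_top[of 0] by eventually_elim (use bound in \<open>simp add: divide_inverse\<close>)
  ultimately have "vol K \<le> vol P * (1 + 2 * D * 0) ^ ?n"
    by (intro tendsto_lowerbound) auto
  then show ?thesis by simp
qed

text \<open>Two translates of the midpoint set of the interior and its reflection overlap only if the
  corresponding translates of the interior do, since both sets have the same differences.\<close>

lemma translative_tile_centrally_symmetric: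
  fixes P :: "'a::euclidean_space set"
  assumes P: "compact P" "convex P" "interior P \<noteq> {}"
    and disj: "\<And>t t'. t \<in> T \<Longrightarrow> t' \<in> T \<Longrightarrow> t \<noteq> t' \<Longrightarrow> (+) t ` interior P \<inter> (+) t' ` interior P = {}"
    and cover: "\<And>x. \<exists>t\<in>T. x - t \<in> P"
  obtains c where "\<And>x. x \<in> P \<Longrightarrow> 2 *\<^sub>R c - x \<in> P"
proof -
  let ?K = "interior P"
  have K: "open ?K" "convex ?K" "bounded ?K" "?K \<noteq> {}"
    using P by (auto intro: bounded_interior compact_imp_bounded convex_interior)
  have K': "open (uminus ` ?K)" "bounded (uminus ` ?K)" using K by (auto simp: open_negations)
  have cl: "closure ?K = P"
    using P convex_closure_interior[of P] by (simp add: compact_imp_closed)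
  have eq: "vol ?K = vol P"
    using P by (metis cl compact_imp_bounded measure_closure[OF K(3)] negligible_convex_frontier K(2))
  have "vol (midsum ?K (uminus ` ?K)) \<le> vol P"
  proof (rule packing_density[where T = T])
    show "open (midsum ?K (uminus ` ?K))" by (rule open_midsum[OF K(1)])
    show "midsum ?K (uminus ` ?K) \<noteq> {}" using K(4) by (auto simp: midsum_def)
    show "bounded (midsum ?K (uminus ` ?K))" by (rule bounded_midsum[OF K(3) K'(2)])
    show "P \<in> lmeasurable" "bounded P" using P by (auto intro: lmeasurable_compact compact_imp_bounded)
    show "\<exists>t\<in>T. x - t \<in> P" for x by (rule cover)
    fix t t' assume t: "t \<in> T" "t' \<in> T" "t \<noteq> t'"
    show "(+) t ` midsum ?K (uminus ` ?K) \<inter> (+) t' ` midsum ?K (uminus ` ?K) = {}"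
    proof (rule ccontr)
      assume "\<not> ?thesis"
      then obtain q q' where q: "q \<in> midsum ?K (uminus ` ?K)" "q' \<in> midsum ?K (uminus ` ?K)" "t + q = t' + q'" by auto
      obtain x y where x: "x \<in> ?K" "y \<in> ?K" "q = (1/2) *\<^sub>R (x - y)" using q(1) by (auto simp: midsum_iff)
      obtain x' y' where x': "x' \<in> ?K" "y' \<in> ?K" "q' = (1/2) *\<^sub>R (x' - y')" using q(2) by (auto simp: midsum_iff)
      have "(1/2) *\<^sub>R x + (1/2) *\<^sub>R y' \<in> ?K" "(1/2) *\<^sub>R x' + (1/2) *\<^sub>R y \<in> ?K"
        using K(2) x x' by (auto intro!: convexD)
      moreover have "t + ((1/2) *\<^sub>R x + (1/2) *\<^sub>R y') = t' + ((1/2) *\<^sub>R x' + (1/2) *\<^sub>R y)"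
        using q(3) unfolding x(3) x'(3) by (simp add: algebra_simps)
      ultimately show False using disj[OF t] by blast
    qed
  qed
  then obtain c where "\<And>x. x \<in> closure ?K \<Longrightarrow> 2 *\<^sub>R c - x \<in> closure ?K"
    using convex_central_symmetry[OF K] eq by auto
  then show thesis using that unfolding cl by blast
qed

section \<open>Facet normals of a centred polytope\<close>

locale centred_polytope =
  fixes P :: "'a::euclidean_space set"
  assumes polytope: "polytope P" and interior_ne: "interior P \<noteq> {}" and sym: "x \<in> P \<Longrightarrow> - x \<in> P"
begin

text \<open>The origin is an interior point, so the hyperplane of a facet has exactly one equation of the
  form \<open>a \<bullet> x = 1\<close>. The vectors \<open>a\<close> in \<open>N\<close> are the vertices of the polar polytope.\<close>

definition fct :: "'a \<Rightarrow> 'a set" where "fct a = P \<inter> {x. a \<bullet> x = 1}"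

definition N :: "'a set" where "N = {a. (\<forall>x\<in>P. a \<bullet> x \<le> 1) \<and> fct a facet_of P}"

lemma convex: "convex P" and compact: "compact P" and closed: "closed P" and bounded: "bounded P"
  and polyhedron: "polyhedron P"
  using polytope by (auto simp: polytope_imp_convex polytope_imp_compact polytope_imp_closed polytope_imp_bounded polytope_imp_polyhedron)

lemma uminus_image: "uminus ` P = P"
  using sym by (force simp: image_iff)

lemma zero_interior: "0 \<in> interior P"
proof -
  obtain x where x: "x \<in> interior P" using interior_ne by blast
  have "interior P = uminus ` interior P"
    using interior_negations[of P] uminus_image by simp
  then have "- x \<in> interior P" using x by blast
  then have "(1/2) *\<^sub>R x + (1/2) *\<^sub>R (- x) \<in> interior P"
    using x convex_interior[OF convex] by (intro convexD) auto
  then show ?thesis by simp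
qed

lemma zero_in: "0 \<in> P" using zero_interior interior_subset by blast

lemma aff_dim_P: "aff_dim P = int DIM('a)"
  using interior_ne by (simp add: aff_dim_nonempty_interior)

lemma N_le: "a \<in> N \<Longrightarrow> x \<in> P \<Longrightarrow> a \<bullet> x \<le> 1" by (simp add: N_def)

lemma fct_facet: "a \<in> N \<Longrightarrow> fct a facet_of P" by (simp add: N_def)

lemma fct_face: "a \<in> N \<Longrightarrow> fct a face_of P" using fct_facet facet_of_imp_face_of by blast

lemma fct_subset: "fct a \<subseteq> P" by (simp add: fct_def)

lemma fct_ne: "a \<in> N \<Longrightarrow> fct a \<noteq> {}" using fct_facet facet_of_def by blast

lemma N_nonzero: "a \<in> N \<Longrightarrow> a \<noteq> 0" using fct_ne[of a] by (auto simp: fct_def)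

lemma facet_obtain:
  assumes "F facet_of P"
  obtains a where "a \<in> N" "F = fct a"
proof -
  obtain a b where ab: "a \<noteq> 0" "P \<subseteq> {x. a \<bullet> x \<le> b}" "F = P \<inter> {x. a \<bullet> x = b}"
    using facet_of_polyhedron[OF polyhedron assms] by metis
  have "b > 0"
  proof -
    obtain e where e: "e > 0" "cball 0 e \<subseteq> P" using zero_interior mem_interior_cball by blast
    have "(e / norm a) *\<^sub>R a \<in> cball 0 e" using e ab(1) by simp
    then have "a \<bullet> ((e / norm a) *\<^sub>R a) \<le> b" using e ab(2) by blast
    moreover have "a \<bullet> ((e / norm a) *\<^sub>R a) > 0" using e ab(1) by simp
    ultimately show ?thesis by linarith
  qed
  then have F: "F = fct ((1/b) *\<^sub>R a)" and "\<forall>x\<in>P. ((1/b) *\<^sub>R a) \<bullet> x \<le> 1"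
    using ab(2,3) by (auto simp: fct_def field_simps)
  then have "(1/b) *\<^sub>R a \<in> N" using assms by (simp add: N_def)
  then show thesis using F that by blast
qed

lemma affine_hull_fct:
  assumes "a \<in> N"
  shows "affine hull (fct a) = {x. a \<bullet> x = 1}"
proof (rule affine_dim_equal)
  show "affine (affine hull (fct a))" by simp
  show "affine {x. a \<bullet> x = 1}" by (rule affine_hyperplane)
  show "affine hull (fct a) \<noteq> {}" using fct_ne[OF assms] by simp
  show "affine hull (fct a) \<subseteq> {x. a \<bullet> x = 1}"
    by (rule hull_minimal) (auto simp: fct_def affine_hyperplane)
  show "aff_dim (affine hull (fct a)) = aff_dim {x. a \<bullet> x = 1}"
    using fct_facet[OF assms] N_nonzero[OF assms] by (simp add: facet_of_def aff_dim_P)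
qed

lemma hyperplane_eqD:
  assumes "{x. a \<bullet> x = 1} = {x. b \<bullet> x = (1::real)}" "a \<noteq> 0" "b \<noteq> (0::'a)"
  shows "a = b"
proof -
  have "(1 / (a \<bullet> a)) *\<^sub>R a \<in> {x. a \<bullet> x = 1}" using assms(2) by simp
  then have 1: "b \<bullet> a = a \<bullet> a" using assms(1,2) by (auto simp: field_simps)
  have "(1 / (b \<bullet> b)) *\<^sub>R b \<in> {x. a \<bullet> x = 1}" unfolding assms(1) using assms(3) by simp
  then have 2: "a \<bullet> b = b \<bullet> b" using assms(3) by (simp add: field_simps)
  have "(a - b) \<bullet> (a - b) = 0" using 1 2 by (simp add: inner_diff inner_commute)
  then show ?thesis by simp
qed

lemma fct_inj: "a \<in> N \<Longrightarrow> b \<in> N \<Longrightarrow> fct a = fct b \<Longrightarrow> a = b"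
  using affine_hull_fct hyperplane_eqD N_nonzero by metis

lemma inj_on_fct: "inj_on fct N" using fct_inj by (auto simp: inj_on_def)

lemma finite_N: "finite N"
proof -
  have "fct ` N \<subseteq> {F. F facet_of P}" using fct_facet by blast
  then have "finite (fct ` N)" using finite_polytope_facets[OF polytope] finite_subset by blast
  then show ?thesis using finite_imageD inj_on_fct by blast
qed

lemma fct_uminus: "fct (- a) = uminus ` fct a"
  using sym by (force simp: fct_def image_iff)

lemma N_uminus: "a \<in> N \<Longrightarrow> - a \<in> N"
proof -
  assume a: "a \<in> N"
  have lin: "linear (uminus :: 'a \<Rightarrow> 'a)" "inj (uminus :: 'a \<Rightarrow> 'a)" by (auto simp: linear_uminus)
  have "aff_dim (uminus ` fct a) = aff_dim (fct a)" by (rule aff_dim_injective_linear_image[OF lin])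
  moreover have "uminus ` fct a face_of uminus ` P" using face_of_linear_image[OF lin] fct_face[OF a] by blast
  ultimately have "fct (- a) facet_of P"
    using fct_facet[OF a] unfolding facet_of_def fct_uminus uminus_image by simp
  moreover have "\<forall>x\<in>P. - a \<bullet> x \<le> 1" using N_le[OF a] sym by (metis inner_minus_left inner_minus_right)
  ultimately show ?thesis by (simp add: N_def)
qed

lemma frontier_fct:
  assumes "x \<in> P" "x \<notin> interior P"
  obtains a where "a \<in> N" "a \<bullet> x = 1"
proof -
  have "rel_frontier P = frontier P" using interior_ne by (rule rel_frontier_nonempty_interior)
  moreover have "x \<in> frontier P" using assms closure_subset by (auto simp: frontier_def)
  ultimately obtain F where "F facet_of P" "x \<in> F" using rel_frontier_of_polyhedron[OF polyhedron] by auto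
  then show thesis using facet_obtain that by (metis (mono_tags, lifting) IntD2 fct_def mem_Collect_eq)
qed

text \<open>The segment from the origin to a point outside leaves the polytope through a facet, whose
  inequality the point violates.\<close>

lemma mem_P_iff: "x \<in> P \<longleftrightarrow> (\<forall>a\<in>N. a \<bullet> x \<le> 1)"
proof
  assume "x \<in> P" then show "\<forall>a\<in>N. a \<bullet> x \<le> 1" using N_le by blast
next
  assume le: "\<forall>a\<in>N. a \<bullet> x \<le> 1"
  show "x \<in> P"
  proof (rule ccontr)
    assume x: "x \<notin> P"
    have "closed_segment 0 x \<inter> frontier P \<noteq> {}"
      using x zero_in by (intro connected_Int_frontier) auto
    then obtain y where y: "y \<in> closed_segment 0 x" "y \<in> frontier P" by blast
    then obtain s where s: "0 \<le> s" "s \<le> 1" "y = s *\<^sub>R x" by (auto simp: in_segment)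
    have yP: "y \<in> P" "y \<notin> interior P" using y(2) closed by (auto simp: frontier_def)
    then obtain a where a: "a \<in> N" "a \<bullet> y = 1" using frontier_fct by blast
    have "s \<noteq> 1" using yP(1) x s by auto
    have "1 = s * (a \<bullet> x)" using a s by simp
    also have "\<dots> \<le> s * 1" using le a s by (intro mult_left_mono) auto
    finally show False using s \<open>s \<noteq> 1\<close> by simp
  qed
qed

lemma interior_iff: "x \<in> interior P \<longleftrightarrow> (\<forall>a\<in>N. a \<bullet> x < 1)"
proof
  assume x: "x \<in> interior P"
  show "\<forall>a\<in>N. a \<bullet> x < 1"
  proof
    fix a assume a: "a \<in> N"
    obtain e where e: "e > 0" "cball x e \<subseteq> P" using x mem_interior_cball by blast
    have "x + (e / norm a) *\<^sub>R a \<in> cball x e" using e N_nonzero[OF a] by (simp add: dist_norm)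
    then have "a \<bullet> (x + (e / norm a) *\<^sub>R a) \<le> 1" using e N_le[OF a] by blast
    moreover have "(e / norm a) * (a \<bullet> a) > 0" using e N_nonzero[OF a] by simp
    ultimately show "a \<bullet> x < 1" by (simp add: inner_add_right)
  qed
next
  assume x: "\<forall>a\<in>N. a \<bullet> x < 1"
  have "open (\<Inter>a\<in>N. {y. a \<bullet> y < 1})" by (intro open_INT finite_N ballI open_halfspace_lt)
  moreover have "(\<Inter>a\<in>N. {y. a \<bullet> y < 1}) \<subseteq> P" using mem_P_iff by (auto intro: less_imp_le)
  ultimately show "x \<in> interior P" using x by (intro interiorI) auto
qed

lemma N_spans:
  assumes "\<forall>a\<in>N. a \<bullet> x = 0"
  shows "x = 0"
proof (rule ccontr)
  assume "x \<noteq> 0"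
  obtain B where B: "\<forall>y\<in>P. norm y \<le> B" using bounded bounded_iff by blast
  have "((\<bar>B\<bar> + 1) / norm x) *\<^sub>R x \<in> P" using assms by (simp add: mem_P_iff)
  then show False using B \<open>x \<noteq> 0\<close> by fastforce
qed

lemma fct_subset_eq:
  assumes "a \<in> N" "c \<in> N" "fct c \<subseteq> fct a"
  shows "c = a"
proof (rule ccontr)
  assume "c \<noteq> a"
  then have "fct c \<noteq> fct a" using fct_inj assms by blast
  moreover have "fct c face_of fct a" using face_of_subset[OF fct_face[OF assms(2)] assms(3) fct_subset] .
  ultimately have "aff_dim (fct c) < aff_dim (fct a)"
    using face_of_aff_dim_lt[OF _ _] face_of_imp_convex[OF fct_face[OF assms(1)]] by blast
  then show False using fct_facet[OF assms(1)] fct_facet[OF assms(2)] by (simp add: facet_of_def)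
qed

text \<open>A normal strictly between \<open>a\<close> and \<open>b\<close> attains its maximum only where both \<open>a\<close> and \<open>b\<close> do, that
  is, on a set which is too small to be a facet. This is how the cyclic order of the facets in a
  belt is read off from linear relations between their normals.\<close>

lemma corner:
  assumes N: "a \<in> N" "b \<in> N" "c \<in> N" and c: "c = p *\<^sub>R a + q *\<^sub>R b" and pq: "p \<ge> 0" "q \<ge> 0"
    and z: "z \<in> P" "a \<bullet> z = 1" "b \<bullet> z = 1"
  shows "c = a \<or> c = b"
proof -
  have le: "p + q \<le> 1" using N_le[OF N(3) z(1)] z by (simp add: c inner_add_left)
  have *: "a \<bullet> y \<le> 1" "b \<bullet> y \<le> 1" "p * (a \<bullet> y) + q * (b \<bullet> y) = 1" if "y \<in> fct c" for y
    using that N N_le fct_subset by (auto simp: c fct_def inner_add_left)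
  obtain y where y: "y \<in> fct c" using fct_ne[OF N(3)] by blast
  have "p * (a \<bullet> y) \<le> p * 1" "q * (b \<bullet> y) \<le> q * 1" using *[OF y] pq by (intro mult_left_mono; simp)+
  then have pq1: "p + q = 1" using le *[OF y] by linarith
  show ?thesis
  proof (cases "p = 0")
    case True then show ?thesis using pq1 c by simp
  next
    case False
    have "fct c \<subseteq> fct a"
    proof
      fix y assume y: "y \<in> fct c"
      have "q * (b \<bullet> y) \<le> q * 1" using *[OF y] pq by (intro mult_left_mono) auto
      then have "p * (a \<bullet> y) \<ge> p * 1" using *[OF y] pq1 by linarith
      then have "a \<bullet> y \<ge> 1" using False pq by simp
      then show "y \<in> fct a" using *[OF y] y by (simp add: fct_def)
    qed
    then show ?thesis using fct_subset_eq N by blast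
  qed
qed

lemma rel_interior_fctI:
  assumes a: "a \<in> N" and x: "a \<bullet> x = 1" "\<And>b. b \<in> N \<Longrightarrow> b \<noteq> a \<Longrightarrow> b \<bullet> x < 1"
  shows "x \<in> rel_interior (fct a)"
proof -
  let ?U = "\<Inter>b\<in>N - {a}. {y. b \<bullet> y < 1}"
  have "open ?U" using finite_N by (intro open_INT ballI open_halfspace_lt) auto
  moreover have "y \<in> fct a" if y: "a \<bullet> y = 1" "y \<in> ?U" for y
  proof -
    have "b \<bullet> y \<le> 1" if "b \<in> N" for b
      using y that by (cases "b = a") (auto intro: less_imp_le)
    then show ?thesis using y(1) by (simp add: fct_def mem_P_iff)
  qed
  moreover have "x \<in> ?U" using x(2) by blast
  ultimately show ?thesis
    unfolding mem_rel_interior affine_hull_fct[OF a] using x(1) by (intro exI[of _ ?U]) blast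
qed

end

section \<open>Tilings by translates of a centred polytope\<close>

lemma mem_translation_iff: "y \<in> (+) t ` S \<longleftrightarrow> y - t \<in> S" for y t :: "'a::ab_group_add"
proof
  assume "y - t \<in> S"
  then have "t + (y - t) \<in> (+) t ` S" by blast
  then show "y \<in> (+) t ` S" by simp
qed auto

lemma bounded_translation_into_self:
  fixes P :: "'a::real_normed_vector set"
  assumes "bounded P" "P \<noteq> {}" and step: "\<And>x. x \<in> P \<Longrightarrow> x + v \<in> P"
  shows "v = 0"
proof (rule ccontr)
  assume "v \<noteq> 0"
  obtain x where x: "x \<in> P" using assms(2) by blast
  have iter: "x + real n *\<^sub>R v \<in> P" for n
  proof (induction n)
    case (Suc n) then show ?case using step[OF Suc] by (simp add: scaleR_left_distrib ac_simps)
  qed (use x in simp)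
  obtain B where B: "\<And>x. x \<in> P \<Longrightarrow> norm x \<le> B" using assms(1) bounded_iff by blast
  obtain n :: nat where n: "B + norm x < real n * norm v" using reals_Archimedean3[of "norm v"] \<open>v \<noteq> 0\<close> by auto
  have "norm (real n *\<^sub>R v) \<le> norm (x + real n *\<^sub>R v) + norm x"
    using norm_triangle_ineq4[of "x + real n *\<^sub>R v" x] by simp
  also have "\<dots> \<le> B + norm x" using B[OF iter] by simp
  finally show False using n by simp
qed

lemma open_avoids_hyperplanes:
  fixes U :: "'a::euclidean_space set"
  assumes "open U" "U \<noteq> {}" and H: "countable H" "\<And>n b. (n, b) \<in> H \<Longrightarrow> n \<noteq> 0"
  obtains p where "p \<in> U" "\<And>n b. (n, b) \<in> H \<Longrightarrow> n \<bullet> p \<noteq> b"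
proof -
  have "negligible (\<Union>h\<in>H. {x. fst h \<bullet> x = snd h})"
    using H by (intro negligible_countable_Union) (auto intro!: negligible_hyperplane)
  then have "\<not> U \<subseteq> (\<Union>h\<in>H. {x. fst h \<bullet> x = snd h})"
    using open_not_negligible[OF assms(1,2)] negligible_subset by blast
  then show thesis using that by force
qed

locale centred_tiling = centred_polytope P for P :: "'a::euclidean_space set" +
  fixes T :: "'a set"
  assumes zero_T: "0 \<in> T"
    and cover: "\<exists>t\<in>T. x - t \<in> P"
    and disj: "t \<in> T \<Longrightarrow> s \<in> T \<Longrightarrow> t \<noteq> s \<Longrightarrow> x - t \<in> interior P \<Longrightarrow> x - s \<notin> interior P"
    and face: "t \<in> T \<Longrightarrow> s \<in> T \<Longrightarrow> t \<noteq> s \<Longrightarrow> (P \<inter> (+) (s - t) ` P) face_of P"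
begin

lemma finite_T: "finite (T \<inter> ball 0 R)"
proof -
  have b: "bounded (interior P)" using bounded by (rule bounded_interior)
  then obtain D where "interior P \<subseteq> ball 0 D" using bounded_subset_ballD by blast
  then show ?thesis
  proof (rule packing_finite(1)[OF open_interior interior_ne])
    fix t s assume ts: "t \<in> T" "s \<in> T" "t \<noteq> s"
    show "(+) t ` interior P \<inter> (+) s ` interior P = {}"
    proof (rule ccontr)
      assume "\<not> ?thesis"
      then obtain u v where "u \<in> interior P" "v \<in> interior P" "t + u = s + v" by auto
      then have "(t + u) - t \<in> interior P" "(t + u) - s \<in> interior P" by (metis add_diff_cancel_left')+
      then show False using disj[OF ts] by blast
    qed
  qed
qed

lemma countable_T: "countable T"
proof -
  have "T = (\<Union>n::nat. T \<inter> ball 0 (real n))"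
    using reals_Archimedean2 by (force simp: dist_norm)
  moreover have "countable (\<Union>n::nat. T \<inter> ball 0 (real n))"
    using finite_T by (intro countable_UN) (auto intro: countable_finite)
  ultimately show ?thesis by simp
qed

text \<open>Interior points accumulate at every point of a convex tile, so an overlap with an interior
  forces an overlap of interiors.\<close>

lemma interior_unique:
  assumes "t \<in> T" "s \<in> T" "x - t \<in> P" "x - s \<in> interior P"
  shows "t = s"
proof (rule ccontr)
  assume ne: "t \<noteq> s"
  have "x - t \<in> closure (interior P)"
    using convex_closure_interior[OF convex interior_ne] closed assms(3) by (simp add: closure_closed)
  moreover have "open ((+) (s - t) ` interior P)" by (simp add: open_translation)
  moreover have "x - t \<in> (+) (s - t) ` interior P" using assms(4) by (force simp: image_iff algebra_simps)
  ultimately have "interior P \<inter> (+) (s - t) ` interior P \<noteq> {}"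
    using open_Int_closure_eq_empty by blast
  then obtain y where "y \<in> interior P" "y - (s - t) \<in> interior P" by force
  then show False using disj[OF assms(1,2) ne, of "y + t"] by (simp add: algebra_simps)
qed

lemma locally_finite:
  obtains e where "e > 0" "\<And>t y. t \<in> T \<Longrightarrow> y \<in> ball z e \<Longrightarrow> y - t \<in> P \<Longrightarrow> z - t \<in> P"
proof -
  obtain D where "P \<subseteq> ball 0 D"
    using bounded_subset_ballD[OF bounded, of 0] by blast
  then have D: "norm x < D" if "x \<in> P" for x using that by auto
  define F where "F = {t \<in> T \<inter> ball 0 (norm z + 1 + D). z - t \<notin> P}"
  have "finite F" unfolding F_def by (rule finite_subset[OF _ finite_T[of "norm z + 1 + D"]]) blast
  then have "closed (\<Union>t\<in>F. (+) t ` P)"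
    using closed by (intro closed_UN) (auto simp: closed_translation)
  moreover have "z \<notin> (\<Union>t\<in>F. (+) t ` P)" by (auto simp: F_def)
  ultimately obtain e where e: "e > 0" "ball z e \<subseteq> - (\<Union>t\<in>F. (+) t ` P)"
    by (metis Compl_iff open_Compl open_contains_ball)
  show thesis
  proof (rule that[of "min e 1"])
    show "min e 1 > 0" using e by simp
    fix t y assume t: "t \<in> T" "y \<in> ball z (min e 1)" "y - t \<in> P"
    show "z - t \<in> P"
    proof (rule ccontr)
      assume "z - t \<notin> P"
      have "norm (y - t) < D" using D t by blast
      moreover have "norm (y - z) < 1" using t(2) by (simp add: dist_norm norm_minus_commute)
      moreover have "norm t \<le> norm (y - t) + norm (y - z) + norm z"
        using norm_triangle_ineq4[of "y - z" "y - t"] norm_triangle_ineq[of z "t - z"] by (simp add: algebra_simps)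
      ultimately have "t \<in> F" using t \<open>z - t \<notin> P\<close> by (simp add: F_def)
      moreover have "y \<in> (+) t ` P" using t(3) mem_translation_iff by blast
      moreover have "y \<in> ball z e" using t(2) by simp
      ultimately show False using e(2) by blast
    qed
  qed
qed

lemma closed_tiles:
  assumes "S \<subseteq> T"
  shows "closed {y. \<exists>t\<in>S. y - t \<in> P}"
proof -
  have "z \<in> {y. \<exists>t\<in>S. y - t \<in> P}" if z: "z \<in> closure {y. \<exists>t\<in>S. y - t \<in> P}" for z
  proof -
    obtain e where e: "e > 0" "\<And>t y. t \<in> T \<Longrightarrow> y \<in> ball z e \<Longrightarrow> y - t \<in> P \<Longrightarrow> z - t \<in> P"
      using locally_finite by blast
    obtain y t where "t \<in> S" "y - t \<in> P" "dist y z < e"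
      using z e(1) unfolding closure_approachable by blast
    then show ?thesis using e(2)[of t y] assms by (auto simp: dist_commute)
  qed
  then show ?thesis using closure_subset_eq by blast
qed

text \<open>The product of two reflections is a translation.\<close>

lemma reflection_unique:
  assumes a: "a \<in> N" and w: "\<And>y. y \<in> fct a \<Longrightarrow> w - y \<in> fct a" and w': "\<And>y. y \<in> fct a \<Longrightarrow> w' - y \<in> fct a"
  shows "w = w'"
proof -
  have "w' - w = 0"
  proof (rule bounded_translation_into_self)
    show "bounded (fct a)" using bounded fct_subset bounded_subset by blast
    show "fct a \<noteq> {}" by (rule fct_ne[OF a])
    fix y assume "y \<in> fct a"
    then have "w' - (w - y) \<in> fct a" using w w' by blast
    then show "y + (w' - w) \<in> fct a" by (simp add: algebra_simps)
  qed
  then show ?thesis by simp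
qed

text \<open>The common part of two tiles is a proper face, so it is the facet as soon as it contains a
  relative interior point of it. Reflection in the midpoint of the two tiles exchanges them and
  preserves their common part.\<close>

lemma neighbour_face:
  assumes t: "t \<in> T" "s \<in> T" "t \<noteq> s" and a: "a \<in> N"
    and x: "x - t \<in> rel_interior (fct a)" "x - s \<in> P"
  shows "P \<inter> (+) (s - t) ` P = fct a" and "\<And>y. y \<in> fct a \<Longrightarrow> s - t - y \<in> fct a"
proof -
  define E where "E = P \<inter> (+) (s - t) ` P"
  have E: "E face_of P" unfolding E_def by (rule face[OF t])
  have xE: "x - t \<in> E"
    using x rel_interior_subset fct_subset by (fastforce simp: E_def mem_translation_iff)
  then have sub: "fct a \<subseteq> E"
    using subset_of_face_of[OF E fct_subset] x(1) by blast
  have "E \<noteq> P"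
  proof
    assume "E = P"
    then have "0 \<in> (+) (s - t) ` P" using zero_in E_def by blast
    then have "t - s \<in> P" by (simp add: mem_translation_iff)
    then show False using interior_unique[OF t(2) t(1), of t] zero_interior t(3) by simp
  qed
  have lt: "aff_dim E < aff_dim P" by (rule face_of_aff_dim_lt[OF convex E \<open>E \<noteq> P\<close>])
  have "fct a face_of E" by (rule face_of_subset[OF fct_face[OF a] sub face_of_imp_subset[OF E]])
  then have "fct a = E"
    using face_of_aff_dim_lt[OF face_of_imp_convex[OF E], of "fct a"] lt fct_facet[OF a]
    unfolding facet_of_def by linarith
  then show eq: "P \<inter> (+) (s - t) ` P = fct a" by (simp add: E_def)
  fix y assume "y \<in> fct a"
  then have "y \<in> P" "y - (s - t) \<in> P" using eq by (auto simp: mem_translation_iff[symmetric])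
  then have "s - t - y \<in> P" "- y \<in> P" using sym by fastforce+
  then have "s - t - y \<in> P \<inter> (+) (s - t) ` P" by (simp add: mem_translation_iff)
  then show "s - t - y \<in> fct a" using eq by blast
qed

lemma neighbour_exists:
  assumes t: "t \<in> T" and a: "a \<in> N"
  obtains s where "s \<in> T" "t \<noteq> s" "P \<inter> (+) (s - t) ` P = fct a" "\<And>y. y \<in> fct a \<Longrightarrow> s - t - y \<in> fct a"
proof -
  have "rel_interior (fct a) \<noteq> {}"
    using fct_ne[OF a] rel_interior_eq_empty face_of_imp_convex[OF fct_face[OF a]] by blast
  then obtain x where x: "x \<in> rel_interior (fct a)" by blast
  then have ax: "a \<bullet> x = 1" using rel_interior_subset by (fastforce simp: fct_def)
  obtain e where e: "e > 0" "\<And>s y. s \<in> T \<Longrightarrow> y \<in> ball (x + t) e \<Longrightarrow> y - s \<in> P \<Longrightarrow> x + t - s \<in> P"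
    using locally_finite by blast
  define y where "y = x + t + (e / (2 * norm a)) *\<^sub>R a"
  have y: "y \<in> ball (x + t) e" using e N_nonzero[OF a] by (simp add: y_def dist_norm)
  obtain s where s: "s \<in> T" "y - s \<in> P" using cover by blast
  have "a \<bullet> (y - t) > 1" using ax e N_nonzero[OF a] by (simp add: y_def inner_add_right inner_diff_right algebra_simps)
  then have ts: "t \<noteq> s" using N_le[OF a s(2)] by auto
  have "x + t - s \<in> P" using e(2)[OF s(1) y s(2)] .
  moreover have "x + t - t \<in> rel_interior (fct a)" using x by simp
  ultimately show thesis
    using that[OF s(1) ts] neighbour_face[OF t s(1) ts a] by blast
qed

text \<open>Twice the centre of the facet. It depends on the facet only, so the neighbours of all tiles
  across their translates of this facet are obtained by the same translation.\<close>

definition shift :: "'a \<Rightarrow> 'a" where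
  "shift a = (SOME w. \<forall>y\<in>fct a. w - y \<in> fct a)"

lemma shift_reflect:
  assumes "a \<in> N" "y \<in> fct a"
  shows "shift a - y \<in> fct a"
proof -
  obtain s where "\<And>y. y \<in> fct a \<Longrightarrow> s - 0 - y \<in> fct a"
    using neighbour_exists[OF zero_T assms(1)] by metis
  then have "\<exists>w. \<forall>y\<in>fct a. w - y \<in> fct a" by blast
  from someI_ex[OF this] show ?thesis using assms(2) unfolding shift_def by blast
qed

lemma shiftI:
  assumes "a \<in> N" "\<And>y. y \<in> fct a \<Longrightarrow> w - y \<in> fct a"
  shows "w = shift a"
  using reflection_unique[OF assms(1)] assms(2) shift_reflect[OF assms(1)] by blast

lemma shift_in:
  assumes "t \<in> T" "a \<in> N"
  shows "t + shift a \<in> T" "P \<inter> (+) (shift a) ` P = fct a"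
proof -
  obtain s where s: "s \<in> T" "t \<noteq> s" "P \<inter> (+) (s - t) ` P = fct a" "\<And>y. y \<in> fct a \<Longrightarrow> s - t - y \<in> fct a"
    using neighbour_exists[OF assms] by metis
  have "s - t = shift a" using s(4) by (rule shiftI[OF assms(2)])
  then show "t + shift a \<in> T" "P \<inter> (+) (shift a) ` P = fct a" using s by (auto simp: algebra_simps)
qed

lemma shift_in_T: "a \<in> N \<Longrightarrow> shift a \<in> T"
  using shift_in(1)[OF zero_T] by simp

lemma neighbour_shift:
  assumes "t \<in> T" "s \<in> T" "t \<noteq> s" "a \<in> N" "x - t \<in> rel_interior (fct a)" "x - s \<in> P"
  shows "s = t + shift a"
  using shiftI[OF assms(4) neighbour_face(2)[OF assms]] by (simp add: algebra_simps)

lemma inner_shift: "a \<in> N \<Longrightarrow> a \<bullet> shift a = 2"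
proof -
  assume a: "a \<in> N"
  obtain y where y: "y \<in> fct a" using fct_ne[OF a] by blast
  have "a \<bullet> y = 1" "a \<bullet> (shift a - y) = 1" using y shift_reflect[OF a y] by (auto simp: fct_def)
  then show ?thesis by (simp add: inner_diff_right)
qed

lemma shift_uminus: "a \<in> N \<Longrightarrow> shift (- a) = - shift a"
proof (rule shiftI[symmetric, OF N_uminus])
  fix y assume a: "a \<in> N" and "y \<in> fct (- a)"
  then have "- y \<in> fct a" unfolding fct_uminus by force
  then have "shift a - (- y) \<in> fct a" by (rule shift_reflect[OF a])
  then show "- shift a - y \<in> fct (- a)" unfolding fct_uminus by (force simp: image_iff)
qed

lemma shift_inj:
  assumes "a \<in> N" "b \<in> N" "shift a = shift b"
  shows "a = b"
  using assms shift_in(2)[OF zero_T] fct_inj by metis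

text \<open>A segment joining interior points of tiles of the two families can be chosen to miss all faces
  of codimension two: these lie in countably many hyperplanes through the fixed endpoint \<open>q\<close>.
  The segment is covered by the two families, so it contains a point of both, and this point is
  in the relative interior of a common facet.\<close>

lemma separated_families:
  assumes S: "S1 \<subseteq> T" "S2 \<subseteq> T" "S1 \<inter> S2 = {}" and U: "open U" "convex U" "\<And>y. y \<in> U \<Longrightarrow> \<exists>t\<in>S1 \<union> S2. y - t \<in> P"
    and p: "p \<in> U" "t1 \<in> S1" "p - t1 \<in> interior P" and q: "q \<in> U" "t2 \<in> S2" "q - t2 \<in> interior P"
  obtains t a where "t \<in> S1" "a \<in> N" "t + shift a \<in> S2"
proof -
  \<comment> \<open>for a flat \<open>a \<bullet> (x - t) = b \<bullet> (x - t) = 1\<close>, the equation of a hyperplane that contains it and \<open>q\<close>\<close>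
  define nn where "nn t a b = (b \<bullet> (q - t) - 1) *\<^sub>R a + (1 - a \<bullet> (q - t)) *\<^sub>R b" for t a b
  define off where "off t a b = b \<bullet> (q - t) - a \<bullet> (q - t) + nn t a b \<bullet> t" for t a b
  define H where "H = {h \<in> (\<lambda>(t, a, b). (nn t a b, off t a b)) ` (T \<times> N \<times> N). fst h \<noteq> 0}
      \<union> (\<lambda>(t, a). (a, 1 + a \<bullet> t)) ` (T \<times> N)"
  have cH: "countable H"
    unfolding H_def using countable_T countable_finite[OF finite_N]
    by (intro countable_Un countable_image countable_Collect countable_SIGMA) auto
  have nz: "n \<noteq> 0" if "(n, b) \<in> H" for n b using that N_nonzero unfolding H_def by auto
  have "open (U \<inter> (+) t1 ` interior P)" using U(1) by (intro open_Int open_translation) auto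
  moreover have "p \<in> (+) t1 ` interior P" using p(3) by (force simp: image_iff)
  ultimately obtain p' where "p' \<in> U \<inter> (+) t1 ` interior P" and p'H: "\<And>n b. (n, b) \<in> H \<Longrightarrow> n \<bullet> p' \<noteq> b"
  proof -
    assume *: "open (U \<inter> (+) t1 ` interior P)" "p \<in> (+) t1 ` interior P"
    show thesis
      by (rule open_avoids_hyperplanes[OF *(1) _ cH]) (use nz that *(2) p(1) in blast)+
  qed
  then have p': "p' \<in> U" "p' \<in> (+) t1 ` interior P" by auto
  have p'2: "p' - t1 \<in> interior P" using p'(2) by auto
  let ?s = "closed_segment p' q"
  define C where "C S = {y. \<exists>t\<in>S. y - t \<in> P}" for S
  have sU: "?s \<subseteq> U" using U(2) p'(1) q(1) by (simp add: closed_segment_subset)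
  have "closed (C S1)" "closed (C S2)" unfolding C_def using closed_tiles S by auto
  moreover have "?s \<subseteq> C S1 \<union> C S2" using sU U(3) unfolding C_def by blast
  moreover have "p' \<in> C S1" "q \<in> C S2"
    using p'2 p(2) q(2,3) interior_subset unfolding C_def by blast+
  ultimately have "C S1 \<inter> C S2 \<inter> ?s \<noteq> {}"
    using connected_closedD[OF connected_segment(1)[of p' q], of "C S1" "C S2"] ends_in_segment[of p' q] by blast
  then obtain z t s where z: "z \<in> ?s" "t \<in> S1" "z - t \<in> P" "s \<in> S2" "z - s \<in> P"
    unfolding C_def by blast
  have ts: "t \<in> T" "s \<in> T" "t \<noteq> s" using z S by auto
  have zint: "z - t \<notin> interior P" using interior_unique[OF ts(2,1) z(5)] ts(3) by blast
  then obtain a where a: "a \<in> N" "a \<bullet> (z - t) = 1" using frontier_fct z(3) by blast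
  have zq: "z \<noteq> q"
  proof
    assume "z = q"
    then have "t = t2" using interior_unique[OF ts(1) _ z(3), of t2] q S by blast
    then show False using z(2) q(2) S(3) by blast
  qed
  then obtain \<theta> where th: "z = (1 - \<theta>) *\<^sub>R p' + \<theta> *\<^sub>R q" "0 \<le> \<theta>" "\<theta> < 1"
    using z(1) by (auto simp: in_segment) (metis add_cancel_left_left diff_self linorder_not_less order_antisym scaleR_one scaleR_zero_left)
  have on: "n \<bullet> p' = b" if "n \<bullet> z = b" "n \<bullet> q = b" for n b
  proof -
    have "(1 - \<theta>) * (n \<bullet> p') = (1 - \<theta>) * b" using that unfolding th(1) by (simp add: inner_add_right algebra_simps)
    then show ?thesis using th(3) by simp
  qed
  have "b \<bullet> (z - t) < 1" if b: "b \<in> N" "b \<noteq> a" for b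
  proof (rule ccontr)
    assume "\<not> b \<bullet> (z - t) < 1"
    then have bz: "b \<bullet> (z - t) = 1" using N_le[OF b(1) z(3)] by simp
    have nz: "nn t a b \<bullet> z = off t a b" "nn t a b \<bullet> q = off t a b"
      using a(2) bz by (simp_all add: nn_def off_def inner_add_left inner_diff_right algebra_simps)
    have "nn t a b \<noteq> 0"
    proof
      assume 0: "nn t a b = 0"
      then have "nn t a b \<bullet> (z - t) = 0" by simp
      then have e: "b \<bullet> (q - t) = a \<bullet> (q - t)" using a(2) bz by (simp add: nn_def inner_add_left)
      have "(a \<bullet> (q - t) - 1) *\<^sub>R a + (1 - a \<bullet> (q - t)) *\<^sub>R b = 0" using 0 unfolding nn_def e .
      then have "(a \<bullet> (q - t) - 1) *\<^sub>R (a - b) = 0" by (simp add: algebra_simps)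
      then have "a \<bullet> (q - t) = 1" using b(2) by simp
      then have "a \<bullet> q = 1 + a \<bullet> t" "a \<bullet> z = 1 + a \<bullet> t" using a(2) by (simp_all add: inner_diff_right)
      then have "a \<bullet> p' = 1 + a \<bullet> t" using on by blast
      moreover have "(a, 1 + a \<bullet> t) \<in> H" unfolding H_def using a(1) ts(1) by force
      ultimately show False using p'H by blast
    qed
    then have "(nn t a b, off t a b) \<in> H" unfolding H_def using a(1) b(1) ts(1) by force
    then show False using on[OF nz] p'H by blast
  qed
  then have "z - t \<in> rel_interior (fct a)" by (intro rel_interior_fctI a) auto
  then have "s = t + shift a" using neighbour_shift[OF ts a(1)] z(5) by blast
  then show thesis using that z a by blast
qed

text \<open>Any two tiles are joined by a chain of tiles, each adjacent to the next across a facet.\<close>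

lemma T_induct:
  assumes base: "t0 \<in> T" "Q t0" and step: "\<And>t a. t \<in> T \<Longrightarrow> a \<in> N \<Longrightarrow> Q t \<Longrightarrow> Q (t + shift a)" and t: "t \<in> T"
  shows "Q t"
proof (rule ccontr)
  assume "\<not> Q t"
  obtain s a where "s \<in> {t \<in> T. Q t}" "a \<in> N" "s + shift a \<in> {t \<in> T. \<not> Q t}"
  proof (rule separated_families[of "{t \<in> T. Q t}" "{t \<in> T. \<not> Q t}" UNIV t0 t0 t t])
    show "\<exists>t\<in>{t \<in> T. Q t} \<union> {t \<in> T. \<not> Q t}. y - t \<in> P" for y using cover by blast
  qed (use base t \<open>\<not> Q t\<close> zero_interior in auto)
  then show False using step by blast
qed

text \<open>All tiles have the same neighbours, so the difference of two tiles is a period of the tiling.\<close>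

lemma T_translate:
  assumes "t0 \<in> T" "t0 + w \<in> T" "t \<in> T"
  shows "t + w \<in> T"
proof (rule T_induct[where Q = "\<lambda>t. t + w \<in> T", OF assms(1,2) _ assms(3)])
  fix t a assume "t \<in> T" "a \<in> N" "t + w \<in> T"
  then show "t + shift a + w \<in> T" using shift_in(1)[of "t + w" a] by (simp add: ac_simps)
qed

lemma T_add: "t \<in> T \<Longrightarrow> s \<in> T \<Longrightarrow> t + s \<in> T"
  using T_translate[OF zero_T, of s t] by simp

lemma T_uminus: "t \<in> T \<Longrightarrow> - t \<in> T"
  using T_translate[of t "- t" 0] zero_T by simp

lemma T_diff: "t \<in> T \<Longrightarrow> s \<in> T \<Longrightarrow> t - s \<in> T"
  using T_add[of t "- s"] T_uminus by simp

text \<open>The tiles lie within bounded distance of any subspace that contains all shifts.\<close>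

lemma shifts_span:
  assumes W: "subspace W" "\<And>a. a \<in> N \<Longrightarrow> shift a \<in> W"
  shows "W = UNIV"
proof -
  have TW: "t \<in> W" if "t \<in> T" for t
    by (rule T_induct[OF zero_T _ _ that]) (use W in \<open>auto simp: subspace_0 subspace_add\<close>)
  show ?thesis
  proof (rule ccontr)
    assume "W \<noteq> UNIV"
    then obtain n where n: "n \<noteq> 0" "\<And>x. x \<in> W \<Longrightarrow> n \<bullet> x = 0"
      using orthogonal_to_subspace_exists_gen[of W UNIV] W(1) span_eq_iff[of W]
      by (metis orthogonal_def span_UNIV subset_UNIV psubsetI)
    obtain B where B: "\<And>x. x \<in> P \<Longrightarrow> norm x \<le> B" using bounded bounded_iff by blast
    let ?x = "((\<bar>B\<bar> + 1) / norm n) *\<^sub>R n"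
    obtain t where t: "t \<in> T" "?x - t \<in> P" using cover by blast
    have "n \<bullet> (?x - t) = n \<bullet> ?x" using n(2) TW t by (simp add: inner_diff_right)
    also have "\<dots> = (\<bar>B\<bar> + 1) * norm n" using n(1) by (simp add: dot_square_norm power2_eq_square)
    finally have "(\<bar>B\<bar> + 1) * norm n \<le> norm n * norm (?x - t)" using norm_cauchy_schwarz[of n "?x - t"] by simp
    then have "\<bar>B\<bar> + 1 \<le> norm (?x - t)" using n(1) by (simp add: mult.commute)
    then show False using B[OF t(2)] by linarith
  qed
qed

end

section \<open>Ridges and belts\<close>

lemma mem_span_pair: "x \<in> span {a, b} \<longleftrightarrow> (\<exists>p q. x = p *\<^sub>R a + q *\<^sub>R b)"
proof
  assume "x \<in> span {a, b}"
  then obtain p where "x - p *\<^sub>R a \<in> span {b}" by (auto simp: span_insert)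
  then obtain q where "x - p *\<^sub>R a = q *\<^sub>R b" by (auto simp: span_singleton)
  then show "\<exists>p q. x = p *\<^sub>R a + q *\<^sub>R b" by (metis add.commute diff_add_cancel)
next
  assume "\<exists>p q. x = p *\<^sub>R a + q *\<^sub>R b"
  then obtain p q where "x = p *\<^sub>R a + q *\<^sub>R b" by blast
  moreover have "p *\<^sub>R a \<in> span {a, b}" "q *\<^sub>R b \<in> span {a, b}" by (intro span_scale span_base; simp)+
  ultimately show "x \<in> span {a, b}" by (simp add: span_add)
qed

lemma mem_span_pair_orthogonal:
  fixes a b m :: "'a::euclidean_space"
  assumes "\<And>y. a \<bullet> y = 0 \<Longrightarrow> b \<bullet> y = 0 \<Longrightarrow> m \<bullet> y = 0"
  shows "m \<in> span {a, b}"
proof -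
  obtain u v where uv: "u \<in> span {a, b}" "\<And>w. w \<in> span {a, b} \<Longrightarrow> orthogonal v w" "m = u + v"
    using orthogonal_subspace_decomp_exists by blast
  have "a \<bullet> v = 0" "b \<bullet> v = 0" using uv(2) by (auto simp: orthogonal_def inner_commute intro: span_base)
  then have "m \<bullet> v = 0" by (rule assms)
  moreover have "u \<bullet> v = 0" using uv(1,2) by (auto simp: orthogonal_def inner_commute)
  ultimately have "v = 0" using uv(3) by (simp add: inner_add_left)
  then show ?thesis using uv by simp
qed

lemma solve_pair:
  fixes a b :: "'a::euclidean_space"
  assumes a: "a \<noteq> 0" and b: "\<And>t. b \<noteq> t *\<^sub>R a"
  obtains y where "a \<bullet> y = A" "b \<bullet> y = B"
proof -
  define v where "v = b - ((a \<bullet> b) / (a \<bullet> a)) *\<^sub>R a"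
  have "v \<noteq> 0" using b by (simp add: v_def)
  then have vv: "v \<bullet> v \<noteq> 0" by simp
  have av: "a \<bullet> v = 0" using a by (simp add: v_def inner_diff_right)
  have bv: "b \<bullet> v = v \<bullet> v"
  proof -
    have "b = v + ((a \<bullet> b) / (a \<bullet> a)) *\<^sub>R a" by (simp add: v_def)
    then have "b \<bullet> v = v \<bullet> v + ((a \<bullet> b) / (a \<bullet> a)) * (a \<bullet> v)" by (metis inner_add_left inner_scaleR_left)
    then show ?thesis using av by simp
  qed
  define y where "y = (A / (a \<bullet> a)) *\<^sub>R a + ((B - A * (a \<bullet> b) / (a \<bullet> a)) / (v \<bullet> v)) *\<^sub>R v"
  have "a \<bullet> y = A" using a av by (simp add: y_def inner_add_right)
  moreover have "b \<bullet> y = B" using a bv vv by (simp add: y_def inner_add_right inner_commute[of b a])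
  ultimately show thesis using that by blast
qed

context centred_polytope
begin

definition active :: "'a \<Rightarrow> 'a set" where "active z = {a \<in> N. a \<bullet> z = 1}"

lemma active_uminus: "active (- z) = uminus ` active z"
  using N_uminus by (force simp: active_def image_iff)

lemma fct_iff: "x \<in> fct a \<longleftrightarrow> x \<in> P \<and> a \<bullet> x = 1" by (simp add: fct_def)

lemma active_determines_nearby:
  assumes z: "z \<in> P"
  obtains e where "e > 0" "\<And>y. y \<in> ball z e \<Longrightarrow> (\<And>b. b \<in> active z \<Longrightarrow> b \<bullet> y \<le> 1) \<Longrightarrow> y \<in> P"
    "\<And>y. y \<in> ball z e \<Longrightarrow> (\<And>b. b \<in> active z \<Longrightarrow> b \<bullet> y < 1) \<Longrightarrow> y \<in> interior P"
proof -
  let ?U = "\<Inter>b\<in>{b \<in> N. b \<bullet> z < 1}. {y. b \<bullet> y < 1}"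
  have "open ?U" using finite_N by (intro open_INT ballI open_halfspace_lt) auto
  moreover have "z \<in> ?U" by auto
  ultimately obtain e where e: "e > 0" "ball z e \<subseteq> ?U" using open_contains_ball by blast
  have inact: "b \<bullet> y < 1" if "b \<in> N" "b \<notin> active z" "y \<in> ball z e" for b y
  proof -
    have "b \<bullet> z < 1" using N_le[OF that(1) z] that by (simp add: active_def)
    then show ?thesis using e(2) that by blast
  qed
  show thesis
  proof (rule that[OF e(1)])
    fix y assume y: "y \<in> ball z e"
    show "y \<in> P" if "\<And>b. b \<in> active z \<Longrightarrow> b \<bullet> y \<le> 1"
      unfolding mem_P_iff using that inact[OF _ _ y] less_imp_le by blast
    show "y \<in> interior P" if "\<And>b. b \<in> active z \<Longrightarrow> b \<bullet> y < 1"
      unfolding interior_iff using that inact[OF _ _ y] by blast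
  qed
qed

lemma move_along:
  assumes z: "z \<in> P"
  obtains e where "e > 0" "\<forall>b\<in>active z. b \<bullet> y \<le> 0 \<Longrightarrow> z + e *\<^sub>R y \<in> P"
    "\<And>d. 0 < d \<Longrightarrow> d \<le> e \<Longrightarrow> \<forall>b\<in>active z. b \<bullet> y < 0 \<Longrightarrow> z + d *\<^sub>R y \<in> interior P"
proof -
  obtain e where e: "e > 0" "\<And>x. x \<in> ball z e \<Longrightarrow> (\<And>b. b \<in> active z \<Longrightarrow> b \<bullet> x \<le> 1) \<Longrightarrow> x \<in> P"
    "\<And>x. x \<in> ball z e \<Longrightarrow> (\<And>b. b \<in> active z \<Longrightarrow> b \<bullet> x < 1) \<Longrightarrow> x \<in> interior P"
    using active_determines_nearby[OF z] by metis
  define \<delta> where "\<delta> = e / (norm y + 1)"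
  have pos: "norm y + 1 > 0" using norm_ge_zero[of y] by linarith
  have d: "\<delta> > 0" using e(1) pos by (simp add: \<delta>_def)
  have "\<delta> * (norm y + 1) = e" using pos by (simp add: \<delta>_def)
  then have "\<delta> * norm y < e" using d by (simp add: distrib_left)
  then have ball: "z + d *\<^sub>R y \<in> ball z e" if "0 < d" "d \<le> \<delta>" for d
    using that mult_right_mono[OF that(2) norm_ge_zero[of y]] by (simp add: dist_norm)
  have act: "b \<bullet> z = 1" if "b \<in> active z" for b using that by (simp add: active_def)
  show thesis
  proof (rule that[OF d])
    show "z + \<delta> *\<^sub>R y \<in> P" if "\<forall>b\<in>active z. b \<bullet> y \<le> 0"
      using that act d by (intro e(2) ball) (auto simp: inner_add_right mult_nonneg_nonpos)
    show "z + d *\<^sub>R y \<in> interior P" if "0 < d" "d \<le> \<delta>" "\<forall>b\<in>active z. b \<bullet> y < 0" for d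
      using that act by (intro e(3) ball) (auto simp: inner_add_right mult_pos_neg)
  qed
qed

lemma not_multiple:
  assumes "a \<in> N" "b \<in> N" "a \<noteq> b" "a \<bullet> z = 1" "b \<bullet> z = 1"
  shows "b \<noteq> t *\<^sub>R a"
proof
  assume b: "b = t *\<^sub>R a"
  then have "t = 1" using assms(4,5) by simp
  then show False using b assms(3) by simp
qed

text \<open>Among three coplanar normals that are active at one point, one lies between the two others,
  which \<open>corner\<close> excludes.\<close>

lemma active_pair:
  assumes N: "a \<in> N" "b \<in> N" "a \<noteq> b" and z: "z \<in> P" "a \<bullet> z = 1" "b \<bullet> z = 1"
    and span: "active z \<subseteq> span {a, b}"
  shows "active z = {a, b}"
proof -
  have "c = a \<or> c = b" if c: "c \<in> N" "c \<bullet> z = 1" for c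
  proof -
    have "c \<in> active z" using c by (simp add: active_def)
    then obtain p q where pq: "c = p *\<^sub>R a + q *\<^sub>R b" using span mem_span_pair by blast
    have sum: "p + q = 1" using c(2) z by (simp add: pq inner_add_left)
    consider "p < 0" | "q < 0" | "p \<ge> 0" "q \<ge> 0" by linarith
    then show ?thesis
    proof cases
      case 1
      then have "q > 0" using sum by simp
      then have "b = (1 / q) *\<^sub>R c + (- p / q) *\<^sub>R a" by (simp add: pq algebra_simps)
      then have "b = c \<or> b = a"
        by (rule corner[OF c(1) N(1,2)]) (use 1 \<open>q > 0\<close> z c in \<open>auto simp: divide_nonpos_pos\<close>)
      then show ?thesis using N(3) by blast
    next
      case 2
      then have "p > 0" using sum by simp
      then have "a = (1 / p) *\<^sub>R c + (- q / p) *\<^sub>R b" by (simp add: pq algebra_simps)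
      then have "a = c \<or> a = b"
        by (rule corner[OF c(1) N(2,1)]) (use 2 \<open>p > 0\<close> z c in \<open>auto simp: divide_nonpos_pos\<close>)
      then show ?thesis using N(3) by blast
    next
      case 3
      then show ?thesis using corner[OF N(1,2) c(1) pq] z by blast
    qed
  qed
  then show ?thesis using N z by (auto simp: active_def)
qed

end

context centred_tiling
begin

text \<open>Near \<open>z\<close> the facet \<open>a\<close> is the half of its hyperplane where \<open>b \<bullet> x \<le> 1\<close>. By the symmetry of
  the facet it is near \<open>shift a - z\<close> a half-hyperplane bounded by a parallel ridge on the
  other side, so the second facet at this ridge has a normal \<open>c\<close> in the plane of \<open>a\<close> and \<open>b\<close>
  with negative coefficient of \<open>b\<close>.\<close>

lemma opposite_ridge:
  assumes N: "a \<in> N" "b \<in> N" "a \<noteq> b" and z: "z \<in> P" and act: "active z = {a, b}"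
  obtains c \<alpha> \<beta> where "c \<in> N" "c = \<alpha> *\<^sub>R a + \<beta> *\<^sub>R b" "\<beta> < 0" "active (shift a - z) = {a, c}"
proof -
  have az: "a \<bullet> z = 1" "b \<bullet> z = 1" using act by (auto simp: active_def)
  have nm: "b \<noteq> t *\<^sub>R a" for t by (rule not_multiple[OF N az])
  define z' where "z' = shift a - z"
  have z': "z' \<in> fct a" unfolding z'_def by (rule shift_reflect[OF N(1)]) (simp add: fct_iff z az)
  then have z'P: "z' \<in> P" "a \<bullet> z' = 1" by (auto simp: fct_iff)
  have refl: "shift a - y \<in> P" if "y \<in> P" "a \<bullet> y = 1" for y
    using shift_reflect[OF N(1), of y] that by (simp add: fct_iff)
  have coeff: "\<exists>\<alpha> \<beta>. m = \<alpha> *\<^sub>R a + \<beta> *\<^sub>R b \<and> \<beta> < 0" if m: "m \<in> N" "m \<bullet> z' = 1" "m \<noteq> a" for m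
  proof -
    have ge: "m \<bullet> y \<ge> 0" if y: "a \<bullet> y = 0" "b \<bullet> y \<le> 0" for y
    proof -
      obtain e where e: "e > 0" "z + e *\<^sub>R y \<in> P"
        by (rule move_along[OF z, of y]) (rule that; use act y in auto)
      then have "shift a - (z + e *\<^sub>R y) \<in> P" using az y by (intro refl) (simp_all add: inner_add_right)
      from N_le[OF m(1) this] have "m \<bullet> (z' - e *\<^sub>R y) \<le> 1" by (simp add: z'_def diff_diff_add)
      then have "e * (m \<bullet> y) \<ge> 0" using m(2) by (simp add: inner_diff_right)
      then show ?thesis using e(1) by (simp add: zero_le_mult_iff)
    qed
    have "m \<in> span {a, b}"
    proof (rule mem_span_pair_orthogonal)
      fix y assume "a \<bullet> y = 0" "b \<bullet> y = 0"
      then show "m \<bullet> y = 0" using ge[of y] ge[of "- y"] by simp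
    qed
    then obtain \<alpha> \<beta> where ab: "m = \<alpha> *\<^sub>R a + \<beta> *\<^sub>R b" unfolding mem_span_pair by blast
    obtain y where y: "a \<bullet> y = 0" "b \<bullet> y = -1" using solve_pair[OF N_nonzero[OF N(1)] nm] by blast
    have "\<beta> \<le> 0" using ge[of y] y by (simp add: ab inner_add_left)
    moreover have "\<beta> \<noteq> 0"
    proof
      assume "\<beta> = 0"
      then have "\<alpha> = 1" using m(2) z'P(2) by (simp add: ab)
      then show False using m(3) ab \<open>\<beta> = 0\<close> by simp
    qed
    ultimately have "\<beta> < 0" by simp
    with ab show ?thesis by blast
  qed
  have "\<exists>m\<in>N. m \<bullet> z' = 1 \<and> m \<noteq> a"
  proof (rule ccontr)
    assume no: "\<not> ?thesis"
    then have act': "active z' = {a}" unfolding active_def using z'P(2) N(1) by blast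
    obtain y where y: "a \<bullet> y = 0" "b \<bullet> y = -1" using solve_pair[OF N_nonzero[OF N(1)] nm] by blast
    obtain e where e: "e > 0" "z' + e *\<^sub>R y \<in> P"
      by (rule move_along[OF z'P(1), of y]) (rule that; use act' y in auto)
    have "shift a - (z' + e *\<^sub>R y) \<in> P" using e z'P y by (intro refl) (simp_all add: inner_add_right)
    from N_le[OF N(2) this] have "b \<bullet> (z - e *\<^sub>R y) \<le> 1" by (simp add: z'_def diff_diff_add[symmetric])
    then show False using az y e by (simp add: inner_diff_right)
  qed
  then obtain c where c: "c \<in> N" "c \<bullet> z' = 1" "c \<noteq> a" by blast
  obtain \<alpha> \<beta> where ab: "c = \<alpha> *\<^sub>R a + \<beta> *\<^sub>R b" "\<beta> < 0" using coeff[OF c] by blast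
  have "b = (1 / \<beta>) *\<^sub>R c + (- \<alpha> / \<beta>) *\<^sub>R a" using ab by (simp add: algebra_simps)
  then have "b \<in> span {a, c}" unfolding mem_span_pair by (metis add.commute)
  then have "span {a, b} \<subseteq> span {a, c}" by (intro span_minimal) (auto intro: span_base)
  moreover have "active z' \<subseteq> span {a, b}"
  proof
    fix m assume "m \<in> active z'"
    then show "m \<in> span {a, b}" using coeff[of m] unfolding active_def mem_span_pair
      by (cases "m = a") (auto intro: exI[of _ 1] exI[of _ 0])
  qed
  ultimately have "active z' = {a, c}"
    using active_pair[OF N(1) c(1) c(3)[symmetric] z'P c(2)] by blast
  then show thesis using that[OF c(1) ab] by (simp add: z'_def)
qed

text \<open>The belt through the ridge of \<open>a\<close> and \<open>b\<close> (at a point \<open>z\<close> of its relative interior). Let \<open>c\<close>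
  and \<open>e\<close> be the second facets at the ridges of \<open>a\<close> and \<open>b\<close> opposite to it. If \<open>c = - b\<close>,
  then \<open>z - shift a\<close> is again in the facet \<open>b\<close>, which is the first alternative. Otherwise the
  corners of the tiles at \<open>shift a\<close> and \<open>shift b\<close> next to \<open>z\<close> are given by \<open>a, c\<close> and by
  \<open>b, e\<close>, and they would overlap if \<open>- c\<close> did not lie between \<open>b\<close> and \<open>e\<close>. By \<open>corner\<close> this
  means \<open>e = - c\<close>, and the consecutive normals \<open>c, a, b, - c, - a, - b\<close> leave no room
  for any other.\<close>

lemma ridge_dichotomy:
  assumes N: "a \<in> N" "b \<in> N" "a \<noteq> b" and z: "z \<in> P" and act: "active z = {a, b}"
  shows "(b \<bullet> shift a = 0 \<and> active (z - shift a) = {- a, b}) \<or> card {m \<in> N. m \<in> span {a, b}} = 6"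
proof -
  have az: "a \<bullet> z = 1" "b \<bullet> z = 1" using act by (auto simp: active_def)
  have nm: "b \<noteq> t *\<^sub>R a" for t by (rule not_multiple[OF N az])
  have indep: "p = 0 \<and> q = 0" if "p *\<^sub>R a + q *\<^sub>R b = 0" for p q
  proof -
    have "q = 0"
    proof (rule ccontr)
      assume "q \<noteq> 0"
      have "b = (1 / q) *\<^sub>R (p *\<^sub>R a + q *\<^sub>R b) + (- p / q) *\<^sub>R a" using \<open>q \<noteq> 0\<close> by (simp add: algebra_simps)
      then show False using nm that by (metis add_0 scaleR_zero_right)
    qed
    then show ?thesis using that N_nonzero[OF N(1)] by simp
  qed
  have indep2: "p = p' \<and> q = q'" if "p *\<^sub>R a + q *\<^sub>R b = p' *\<^sub>R a + q' *\<^sub>R b" for p q p' q'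
  proof -
    have "(p - p') *\<^sub>R a + (q - q') *\<^sub>R b = 0" using that by (simp add: algebra_simps)
    then show ?thesis using indep by fastforce
  qed
  obtain c \<alpha> \<beta> where c: "c \<in> N" "c = \<alpha> *\<^sub>R a + \<beta> *\<^sub>R b" "\<beta> < 0" "active (shift a - z) = {a, c}"
    using opposite_ridge[OF N z act] by blast
  obtain e \<delta> \<gamma> where e: "e \<in> N" "e = \<delta> *\<^sub>R b + \<gamma> *\<^sub>R a" "\<gamma> < 0" "active (shift b - z) = {b, e}"
    using opposite_ridge[OF N(2,1) N(3)[symmetric] z] act by (metis insert_commute)
  let ?za = "shift a - z" and ?zb = "shift b - z"
  have zaP: "?za \<in> P" and zbP: "?zb \<in> P"
    using shift_reflect[OF N(1), of z] shift_reflect[OF N(2), of z] z az by (auto simp: fct_iff)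
  have cza: "a \<bullet> ?za = 1" "c \<bullet> ?za = 1" "b \<bullet> ?zb = 1" "e \<bullet> ?zb = 1" using c(4) e(4) by (auto simp: active_def)
  have mz: "(- z) \<in> P" "- ?za \<in> P" "- ?zb \<in> P" using z zaP zbP sym by blast+
  show ?thesis
  proof (cases "\<alpha> \<le> 0")
    case True
    have "- c = a \<or> - c = b"
      by (rule corner[OF N(1,2) N_uminus[OF c(1)], of "- \<alpha>" "- \<beta>" z]) (use c True z az in auto)
    moreover have "- c \<noteq> a"
    proof
      assume "- c = a"
      then have "c = (-1) *\<^sub>R a + 0 *\<^sub>R b" by auto
      then show False using indep2[of \<alpha> \<beta> "-1" 0] c(2,3) by simp
    qed
    ultimately have cb: "c = - b" by auto
    then have "b \<bullet> shift a = 0" using cza az by (simp add: inner_diff_right)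
    moreover have "active (- ?za) = {- a, b}" unfolding active_uminus c(4) using cb by auto
    ultimately show ?thesis by simp
  next
    case False
    then have al: "\<alpha> > 0" by simp
    have de: "\<delta> > 0"
    proof (rule ccontr)
      assume "\<not> \<delta> > 0"
      have "- e = a \<or> - e = b"
        by (rule corner[OF N(1,2) N_uminus[OF e(1)], of "- \<gamma>" "- \<delta>" z]) (use e \<open>\<not> \<delta> > 0\<close> z az in auto)
      moreover have "- e \<noteq> b"
      proof
        assume "- e = b"
        then have "e = 0 *\<^sub>R a + (-1) *\<^sub>R b" by auto
        then show False using indep2[of \<gamma> \<delta> 0 "-1"] e(2,3) by (simp add: add.commute)
      qed
      ultimately have ea: "e = - a" by auto
      have "- c = b \<or> - c = e"
        by (rule corner[OF N(2) e(1) N_uminus[OF c(1)], of "- \<beta>" \<alpha> ?zb])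
          (use c al zbP cza ea in auto)
      then have "- c = b \<or> c = a" using ea by auto
      then show False
      proof
        assume "- c = b"
        then have "c = 0 *\<^sub>R a + (-1) *\<^sub>R b" by auto
        then show False using indep2[of \<alpha> \<beta> 0 "-1"] c(2) al by simp
      next
        assume "c = a"
        then have "(\<alpha> - 1) *\<^sub>R a + \<beta> *\<^sub>R b = 0" using c(2) by (simp add: algebra_simps)
        then show False using indep c(3) by blast
      qed
    qed
    \<comment> \<open>otherwise some direction \<open>y\<close> at \<open>z\<close> points into the interiors of both neighbours\<close>
    have order: "\<alpha> * \<delta> \<le> \<beta> * \<gamma>"
    proof (rule ccontr)
      assume "\<not> ?thesis"
      then have lt: "(- \<beta>) * (- \<gamma>) < \<alpha> * \<delta>" by simp
      have "- \<beta> / \<alpha> < \<delta> / - \<gamma>" using lt al e(3) by (simp add: field_simps)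
      then obtain r where r: "- \<beta> / \<alpha> < r" "r < \<delta> / - \<gamma>" using dense by blast
      have rp: "r > 0" using r(1) al c(3) by (meson divide_neg_pos divide_pos_pos less_trans neg_0_less_iff_less)
      obtain y where y: "a \<bullet> y = r" "b \<bullet> y = 1" using solve_pair[OF N_nonzero[OF N(1)] nm] by blast
      have cy: "c \<bullet> y > 0" using r(1) al y c(2) by (simp add: inner_add_left field_simps)
      have ey: "e \<bullet> y > 0" using r(2) e(2,3) y by (simp add: inner_add_left field_simps)
      obtain e1 where e1: "e1 > 0" "\<And>d. 0 < d \<Longrightarrow> d \<le> e1 \<Longrightarrow> - ?za + d *\<^sub>R y \<in> interior P"
        by (rule move_along[OF mz(2), of y]) (rule that; use active_uminus[of ?za] c(4) y rp cy in auto)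
      obtain e2 where e2: "e2 > 0" "\<And>d. 0 < d \<Longrightarrow> d \<le> e2 \<Longrightarrow> - ?zb + d *\<^sub>R y \<in> interior P"
        by (rule move_along[OF mz(3), of y]) (rule that; use active_uminus[of ?zb] e(4) y ey in auto)
      let ?d = "min e1 e2"
      have "(z + ?d *\<^sub>R y) - shift a \<in> interior P" "(z + ?d *\<^sub>R y) - shift b \<in> interior P"
        using e1(1) e1(2)[of ?d] e2(1) e2(2)[of ?d] by (simp_all add: algebra_simps)
      moreover have "shift a \<noteq> shift b" using shift_inj N by blast
      ultimately show False using disj[OF shift_in_T[OF N(1)] shift_in_T[OF N(2)]] by blast
    qed
    have ec: "e = - c"
    proof -
      have "- c = (- \<beta> + \<alpha> * \<delta> / \<gamma>) *\<^sub>R b + (\<alpha> / - \<gamma>) *\<^sub>R e"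
        using e(3) by (simp add: c(2) e(2) algebra_simps)
      moreover have "- \<beta> + \<alpha> * \<delta> / \<gamma> \<ge> 0" using order e(3) by (simp add: field_simps)
      ultimately have "- c = b \<or> - c = e"
        by (rule corner[OF N(2) e(1) N_uminus[OF c(1)], of _ _ ?zb]) (use al e(3) zbP cza in \<open>auto simp: divide_pos_neg less_imp_le divide_nonneg_neg\<close>)
      moreover have "- c \<noteq> b"
      proof
        assume "- c = b"
        then have "c = 0 *\<^sub>R a + (-1) *\<^sub>R b" by auto
        then show False using indep2[of \<alpha> \<beta> 0 "-1"] c(2) al by simp
      qed
      ultimately show ?thesis by auto
    qed
    have mixed: "m = a \<or> m = c \<or> m = - b" if m: "m \<in> N" "m = u *\<^sub>R a + w *\<^sub>R b" "u > 0" "w < 0" for m u w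
    proof (cases "u * \<beta> \<le> w * \<alpha>")
      case True
      have "m = (u - w * \<alpha> / \<beta>) *\<^sub>R a + (w / \<beta>) *\<^sub>R c"
        using c(3) by (simp add: m(2) c(2) algebra_simps)
      then have "m = a \<or> m = c"
        by (rule corner[OF N(1) c(1) m(1), of _ _ ?za]) (use True c(3) m zaP cza in \<open>auto simp: field_simps divide_neg_neg less_imp_le\<close>)
      then show ?thesis by blast
    next
      case False
      have "m = (u / \<alpha>) *\<^sub>R c + (u * \<beta> / \<alpha> - w) *\<^sub>R (- b)"
        using al by (simp add: m(2) c(2) algebra_simps)
      then have "m = c \<or> m = - b"
        by (rule corner[OF c(1) N_uminus[OF N(2)] m(1), of _ _ "- ?zb"]) (use False al m mz cza ec in \<open>auto simp: field_simps inner_diff_right\<close>)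
      then show ?thesis by blast
    qed
    have "{m \<in> N. m \<in> span {a, b}} = {a, - a, b, - b, c, - c}"
    proof (intro equalityI subsetI)
      fix m assume "m \<in> {m \<in> N. m \<in> span {a, b}}"
      then obtain u w where m: "m \<in> N" "m = u *\<^sub>R a + w *\<^sub>R b" unfolding mem_span_pair by blast
      have m': "- m \<in> N" "- m = (- u) *\<^sub>R a + (- w) *\<^sub>R b" using N_uminus[OF m(1)] m(2) by simp_all
      consider "u \<ge> 0" "w \<ge> 0" | "u \<le> 0" "w \<le> 0" | "u > 0" "w < 0" | "u < 0" "w > 0" by linarith
      then show "m \<in> {a, - a, b, - b, c, - c}"
      proof cases
        case 1 then show ?thesis using corner[OF N(1,2) m(1) m(2) _ _ z az] by blast
      next
        case 2 then have "- m = a \<or> - m = b" using corner[OF N(1,2) m' _ _ z az] by simp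
        then show ?thesis by auto
      next
        case 3 then show ?thesis using mixed[OF m] by blast
      next
        case 4 then have "- m = a \<or> - m = c \<or> - m = - b" using mixed[OF m'] by simp
        then show ?thesis by auto
      qed
    next
      fix m assume "m \<in> {a, - a, b, - b, c, - c}"
      moreover have "a \<in> span {a, b}" "b \<in> span {a, b}" by (auto intro: span_base)
      moreover have "c \<in> span {a, b}" unfolding mem_span_pair using c(2) by blast
      ultimately show "m \<in> {m \<in> N. m \<in> span {a, b}}" using N(1,2) c(1) N_uminus span_neg by blast
    qed
    moreover have "card {a, - a, b, - b, c, - c} = 6"
    proof -
      have n1: "p *\<^sub>R a + q *\<^sub>R b \<noteq> p' *\<^sub>R a + q' *\<^sub>R b" if "p \<noteq> p' \<or> q \<noteq> q'" for p q p' q'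
        using indep2 that by blast
      have "a = 1 *\<^sub>R a + 0 *\<^sub>R b" "- a = (-1) *\<^sub>R a + 0 *\<^sub>R b" "b = 0 *\<^sub>R a + 1 *\<^sub>R b" "- b = 0 *\<^sub>R a + (-1) *\<^sub>R b"
        "c = \<alpha> *\<^sub>R a + \<beta> *\<^sub>R b" "- c = (- \<alpha>) *\<^sub>R a + (- \<beta>) *\<^sub>R b" using c(2) by auto
      note r = this
      have "a \<noteq> - a" by (subst r(2), subst (1) r(1), rule n1) simp
      moreover have "a \<noteq> b" by (fact N(3))
      moreover have "a \<noteq> - b" by (subst r(4), subst (1) r(1), rule n1) simp
      moreover have "a \<noteq> c" by (subst r(5), subst (1) r(1), rule n1) (use c(3) in simp)
      moreover have "a \<noteq> - c" by (subst r(6), subst (1) r(1), rule n1) (use c(3) in simp)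
      moreover have "b \<noteq> - b" by (subst r(4), subst (1) r(3), rule n1) simp
      moreover have "b \<noteq> c" by (subst r(5), subst (1) r(3), rule n1) (use al in simp)
      moreover have "b \<noteq> - c" by (subst r(6), subst (1) r(3), rule n1) (use al in simp)
      moreover have "c \<noteq> - c" by (subst r(6), subst (1) r(5), rule n1) (use al in simp)
      ultimately have "distinct [a, - a, b, - b, c, - c]" by auto
      then show ?thesis using distinct_card[of "[a, - a, b, - b, c, - c]"] by simp
    qed
    ultimately show ?thesis by simp
  qed
qed

end

section \<open>Walls of one colour\<close>

text \<open>The condition on \<open>active z\<close> says that \<open>z\<close> is a relative interior point of a ridge of \<open>a\<close> and
  \<open>b\<close>; the cardinality is the number of facets in the belt of this ridge.\<close>

locale coloured_tiling = centred_tiling P T for P T :: "'a::euclidean_space set" +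
  fixes A B :: "'a set"
  assumes AB: "A \<union> B = N" "A \<inter> B = {}"
    and A_uminus: "a \<in> A \<Longrightarrow> - a \<in> A" and B_uminus: "b \<in> B \<Longrightarrow> - b \<in> B"
    and no_six: "a \<in> A \<Longrightarrow> b \<in> B \<Longrightarrow> z \<in> P \<Longrightarrow> active z = {a, b} \<Longrightarrow> card {m \<in> N. m \<in> span {a, b}} \<noteq> 6"
begin

lemma AN: "a \<in> A \<Longrightarrow> a \<in> N" and BN: "b \<in> B \<Longrightarrow> b \<in> N" and AB_neq: "a \<in> A \<Longrightarrow> b \<in> B \<Longrightarrow> a \<noteq> b"
  using AB by auto

definition wall :: "'a set" where "wall = {y. \<exists>t\<in>T. \<exists>b\<in>B. y - t \<in> fct b}"

lemma facets_locally_finite: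
  obtains e where "e > 0" "\<And>t a y. t \<in> T \<Longrightarrow> a \<in> N \<Longrightarrow> y \<in> ball z e \<Longrightarrow> y - t \<in> fct a \<Longrightarrow> z - t \<in> fct a"
    "\<And>t y. t \<in> T \<Longrightarrow> y \<in> ball z e \<Longrightarrow> y - t \<in> P \<Longrightarrow> z - t \<in> P"
proof -
  obtain e where e: "e > 0" "\<And>t y. t \<in> T \<Longrightarrow> y \<in> ball z e \<Longrightarrow> y - t \<in> P \<Longrightarrow> z - t \<in> P"
    using locally_finite by blast
  obtain D where "P \<subseteq> ball 0 D" using bounded_subset_ballD[OF bounded, of 0] by blast
  then have D: "norm x < D" if "x \<in> P" for x using that by auto
  define F where "F = {t \<in> T. z - t \<in> P}"
  have "F \<subseteq> T \<inter> ball 0 (norm z + D)"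
  proof
    fix t assume "t \<in> F"
    then have "t \<in> T" "norm (z - t) < D" using D by (auto simp: F_def)
    then show "t \<in> T \<inter> ball 0 (norm z + D)" using norm_triangle_ineq4[of z "z - t"] by simp
  qed
  then have fF: "finite F" using finite_T finite_subset by blast
  define U where "U = (\<Inter>t\<in>F. \<Inter>a\<in>{a \<in> N. a \<bullet> (z - t) < 1}. {y. a \<bullet> y < 1 + a \<bullet> t})"
  have "open U" unfolding U_def
    using fF finite_N by (intro open_INT ballI open_halfspace_lt) auto
  moreover have "z \<in> U" by (auto simp: U_def inner_diff_right)
  ultimately obtain e' where e': "e' > 0" "ball z e' \<subseteq> U" using open_contains_ball by blast
  show thesis
  proof (rule that[of "min e e'"])
    show "min e e' > 0" using e e' by simp
    show "z - t \<in> P" if "t \<in> T" "y \<in> ball z (min e e')" "y - t \<in> P" for t y using e that by auto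
    fix t a y assume t: "t \<in> T" "a \<in> N" "y \<in> ball z (min e e')" "y - t \<in> fct a"
    have "y - t \<in> P" "a \<bullet> (y - t) = 1" using t(4) by (auto simp: fct_iff)
    then have zP: "z - t \<in> P" using e(2)[OF t(1), of y] t(3) by simp
    have "y \<in> U" using e' t(3) by auto
    then have "\<not> a \<bullet> (z - t) < 1"
      using \<open>a \<bullet> (y - t) = 1\<close> zP t(1,2) unfolding U_def F_def by (force simp: inner_diff_right)
    then show "z - t \<in> fct a" using N_le[OF t(2) zP] zP by (simp add: fct_iff)
  qed
qed

lemma closed_wall: "closed wall"
proof -
  have "z \<in> wall" if z: "z \<in> closure wall" for z
  proof -
    obtain e where e: "e > 0" "\<And>t a y. t \<in> T \<Longrightarrow> a \<in> N \<Longrightarrow> y \<in> ball z e \<Longrightarrow> y - t \<in> fct a \<Longrightarrow> z - t \<in> fct a"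
      by (rule facets_locally_finite[of z]) (rule that; blast)
    obtain y where "y \<in> wall" "dist y z < e" using z e(1) unfolding closure_approachable by blast
    then obtain t b where "t \<in> T" "b \<in> B" "y - t \<in> fct b" "y \<in> ball z e"
      unfolding wall_def by (auto simp: dist_commute)
    then show ?thesis using e(2)[of t b y] BN unfolding wall_def by blast
  qed
  then show ?thesis using closure_subset_eq by blast
qed

text \<open>The point is on no face of codimension three or more of any tile: the facets of a tile through
  it have normals in a plane.\<close>

definition generic :: "'a \<Rightarrow> bool" where
  "generic z \<longleftrightarrow> (\<forall>t\<in>T. z - t \<in> P \<longrightarrow>
     (\<forall>a\<in>active (z - t). \<forall>b\<in>active (z - t). a \<noteq> b \<longrightarrow> active (z - t) \<subseteq> span {a, b}))"

text \<open>Since \<open>b \<bullet> shift a = 0\<close>, the facets \<open>b\<close> of the tile and of its neighbour across \<open>a\<close> lie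
  in the same hyperplane, on the two sides of the ridge, and together they contain a
  neighbourhood of \<open>z\<close> in this hyperplane.\<close>

lemma mixed_ridge_wall:
  assumes a: "a \<in> A" and b: "b \<in> B" and t: "t \<in> T" and z: "z - t \<in> P" and act: "active (z - t) = {a, b}"
  obtains e where "e > 0" "\<And>y. y \<in> ball z e \<Longrightarrow> b \<bullet> (y - t) = 1 \<Longrightarrow> y \<in> wall"
proof -
  have orth: "b \<bullet> shift a = 0" and act': "active (z - t - shift a) = {- a, b}"
    using ridge_dichotomy[OF AN[OF a] BN[OF b] AB_neq[OF a b] z act] no_six[OF a b z act] by auto
  have z'P: "z - t - shift a \<in> P"
  proof -
    have "z - t \<in> fct a" using z act by (auto simp: fct_iff active_def)
    then have "- (shift a - (z - t)) \<in> P" using shift_reflect[OF AN[OF a]] sym fct_subset by blast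
    then show ?thesis by (simp add: algebra_simps)
  qed
  obtain e1 where e1: "e1 > 0" "\<And>y. y \<in> ball (z - t) e1 \<Longrightarrow> (\<And>c. c \<in> active (z - t) \<Longrightarrow> c \<bullet> y \<le> 1) \<Longrightarrow> y \<in> P"
    using active_determines_nearby[OF z] by metis
  obtain e2 where e2: "e2 > 0" "\<And>y. y \<in> ball (z - t - shift a) e2 \<Longrightarrow> (\<And>c. c \<in> active (z - t - shift a) \<Longrightarrow> c \<bullet> y \<le> 1) \<Longrightarrow> y \<in> P"
    using active_determines_nearby[OF z'P] by metis
  show thesis
  proof (rule that[of "min e1 e2"])
    show "min e1 e2 > 0" using e1 e2 by simp
    fix y assume y: "y \<in> ball z (min e1 e2)" "b \<bullet> (y - t) = 1"
    have y1: "y - t \<in> ball (z - t) e1" and y2: "y - t - shift a \<in> ball (z - t - shift a) e2"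
      using y(1) by (auto simp: dist_norm)
    show "y \<in> wall"
    proof (cases "a \<bullet> (y - t) \<le> 1")
      case True
      then have "y - t \<in> P" using y(2) by (intro e1(2)[OF y1]) (auto simp: act)
      then have "y - t \<in> fct b" using y(2) by (simp add: fct_iff)
      then show ?thesis unfolding wall_def using t b by blast
    next
      case False
      have eq: "b \<bullet> (y - t - shift a) = 1" using y(2) orth by (simp add: inner_diff_right)
      have "(- a) \<bullet> (y - t - shift a) \<le> 1" using False inner_shift[OF AN[OF a]] by (simp add: inner_diff_right)
      then have "y - t - shift a \<in> P" using eq by (intro e2(2)[OF y2]) (auto simp: act')
      then have "y - (t + shift a) \<in> fct b" using eq by (simp add: fct_iff diff_diff_add)
      then show ?thesis unfolding wall_def using shift_in(1)[OF t AN[OF a]] b by blast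
    qed
  qed
qed

lemma near_interior:
  assumes "z - t \<in> P" "e > 0"
  obtains p where "p \<in> ball z e" "p - t \<in> interior P"
proof -
  have "z - t \<in> closure (interior P)"
    using convex_closure_interior[OF convex interior_ne] closed assms(1) by (simp add: closure_closed)
  then obtain y where "y \<in> interior P" "dist y (z - t) < e" using assms(2) closure_approachable by blast
  then have "y + t \<in> ball z e" "y + t - t \<in> interior P" by (auto simp: dist_norm algebra_simps norm_minus_commute)
  then show thesis using that by blast
qed

text \<open>The tiles at \<open>z\<close> that have a facet of colour \<open>A\<close> through \<open>z\<close> and those that do not fill a ball
  around \<open>z\<close>. If both kinds occurred, a tile of the first kind would be adjacent to one of the
  second across a facet through \<open>z\<close>, whose colour contradicts either the definition of the
  second kind or the assumption that no tile at \<open>z\<close> has both colours there.\<close>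

lemma wall_monochromatic:
  assumes z: "z \<in> wall"
    and unmixed: "\<And>t a b. t \<in> T \<Longrightarrow> z - t \<in> P \<Longrightarrow> a \<in> A \<Longrightarrow> b \<in> B \<Longrightarrow> a \<in> active (z - t) \<Longrightarrow> b \<in> active (z - t) \<Longrightarrow> False"
    and t: "t \<in> T" "z - t \<in> P" "a \<in> active (z - t)"
  shows "a \<in> B"
proof (rule ccontr)
  assume "a \<notin> B"
  then have aA: "a \<in> A" using t(3) AB by (auto simp: active_def)
  define S1 where "S1 = {t \<in> T. z - t \<in> P \<and> active (z - t) \<inter> A \<noteq> {}}"
  define S2 where "S2 = {t \<in> T. z - t \<in> P \<and> active (z - t) \<inter> A = {}}"
  obtain t0 b where t0: "t0 \<in> T" "b \<in> B" "z - t0 \<in> fct b" using z unfolding wall_def by blast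
  have b: "b \<in> active (z - t0)" "z - t0 \<in> P" using t0 BN by (auto simp: fct_iff active_def)
  have "t0 \<in> S2" unfolding S2_def using unmixed[OF t0(1) b(2)] b t0 by blast
  have "t \<in> S1" unfolding S1_def using t aA by blast
  obtain e where e: "e > 0" "\<And>t y. t \<in> T \<Longrightarrow> y \<in> ball z e \<Longrightarrow> y - t \<in> P \<Longrightarrow> z - t \<in> P"
    using locally_finite by blast
  obtain p where p: "p \<in> ball z e" "p - t \<in> interior P" using near_interior[OF t(2) e(1)] by blast
  obtain q where q: "q \<in> ball z e" "q - t0 \<in> interior P" using near_interior[OF b(2) e(1)] by blast
  obtain s c where s: "s \<in> S1" "c \<in> N" "s + shift c \<in> S2"
  proof (rule separated_families[of S1 S2 "ball z e" p t q t0])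
    show "\<exists>t\<in>S1 \<union> S2. y - t \<in> P" if "y \<in> ball z e" for y
    proof -
      obtain s where s: "s \<in> T" "y - s \<in> P" using cover by blast
      then have "z - s \<in> P" using e(2) that by blast
      then show ?thesis using s unfolding S1_def S2_def by blast
    qed
  qed (use p q \<open>t \<in> S1\<close> \<open>t0 \<in> S2\<close> in \<open>auto simp: S1_def S2_def\<close>)
  have sT: "s \<in> T" "z - s \<in> P" and "z - (s + shift c) \<in> P" using s by (auto simp: S1_def S2_def)
  then have "z - s \<in> (+) (shift c) ` P" by (simp add: mem_translation_iff diff_diff_add)
  then have "z - s \<in> fct c" using shift_in(2)[OF sT(1) s(2)] sT(2) by blast
  then have c: "c \<bullet> (z - s) = 1" by (simp add: fct_iff)
  show False
  proof (cases "c \<in> A")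
    case True
    have "(- c) \<bullet> (z - (s + shift c)) = 1" using c inner_shift[OF s(2)] by (simp add: inner_diff_right inner_add_right)
    then have "- c \<in> active (z - (s + shift c))" using N_uminus[OF s(2)] by (simp add: active_def)
    then show False using s(3) A_uminus[OF True] unfolding S2_def by blast
  next
    case False
    then have "c \<in> B" "c \<in> active (z - s)" using s(2) c AB by (auto simp: active_def)
    moreover obtain a' where "a' \<in> A" "a' \<in> active (z - s)" using s(1) unfolding S1_def by blast
    ultimately show False using unmixed[OF sT] by blast
  qed
qed

text \<open>Where two colours meet at \<open>z\<close>, the wall contains a piece of hyperplane around \<open>z\<close> that
  separates \<open>x\<close> from \<open>y\<close> and from every point close to \<open>y\<close>. Where all facets at \<open>z\<close> belong to
  the wall, a segment close to the given one that avoids the wall stays in one tile while it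
  passes \<open>z\<close>; in the limit this tile contains a piece of the given segment around \<open>z\<close>. As \<open>z\<close> is
  on its boundary, this piece lies in a facet, and \<open>x\<close> lies in the hyperplane of this facet.\<close>

lemma wall_crossing:
  assumes z: "z \<in> wall" "generic z" and \<theta>: "z = (1 - \<theta>) *\<^sub>R x + \<theta> *\<^sub>R y" "0 < \<theta>" "\<theta> < 1"
    and x: "\<And>t a. t \<in> T \<Longrightarrow> a \<in> N \<Longrightarrow> a \<bullet> (x - t) \<noteq> 1"
  obtains e where "e > 0" "\<And>y'. y' \<in> ball y e \<Longrightarrow> closed_segment x y' \<inter> wall \<noteq> {}"
proof (cases "\<exists>t\<in>T. \<exists>a\<in>A. \<exists>b\<in>B. z - t \<in> P \<and> a \<in> active (z - t) \<and> b \<in> active (z - t)")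
  case True
  then obtain t a b where tab: "t \<in> T" "a \<in> A" "b \<in> B" "z - t \<in> P" "a \<in> active (z - t)" "b \<in> active (z - t)" by blast
  have "active (z - t) = {a, b}"
    by (rule active_pair[OF AN[OF tab(2)] BN[OF tab(3)] AB_neq[OF tab(2,3)] tab(4)])
      (use z(2) tab AB_neq[OF tab(2,3)] in \<open>auto simp: generic_def active_def\<close>)
  then obtain e where e: "e > 0" "\<And>y. y \<in> ball z e \<Longrightarrow> b \<bullet> (y - t) = 1 \<Longrightarrow> y \<in> wall"
    using mixed_ridge_wall[OF tab(2,3,1,4)] by blast
  define \<phi> where "\<phi> w = b \<bullet> (w - t) - 1" for w
  have \<phi>x: "\<phi> x \<noteq> 0" using x[OF tab(1) BN[OF tab(3)]] by (simp add: \<phi>_def)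
  have \<phi>z: "\<phi> z = 0" using tab(6) by (simp add: \<phi>_def active_def)
  have aff: "\<phi> ((1 - s) *\<^sub>R x + s *\<^sub>R w) = (1 - s) * \<phi> x + s * \<phi> w" for s w
    by (simp add: \<phi>_def inner_add_right inner_diff_right algebra_simps)
  have \<phi>y: "\<theta> * \<phi> y = - (1 - \<theta>) * \<phi> x" using \<phi>z aff[of \<theta> y] \<theta>(1) by (simp add: algebra_simps)
  have th: "\<phi> x / (\<phi> x - \<phi> y) = \<theta>" and ne: "\<phi> x - \<phi> y \<noteq> 0"
  proof -
    have e: "\<theta> * (\<phi> x - \<phi> y) = \<phi> x" using \<phi>y by (simp add: algebra_simps)
    then show "\<phi> x - \<phi> y \<noteq> 0" using \<phi>x by auto
    then show "\<phi> x / (\<phi> x - \<phi> y) = \<theta>" using e by (simp add: field_simps)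
  qed
  define \<tau> where "\<tau> w = \<phi> x / (\<phi> x - \<phi> w)" for w
  define g where "g w = (1 - \<tau> w) *\<^sub>R x + \<tau> w *\<^sub>R w" for w
  have c\<tau>: "isCont \<tau> y" unfolding \<tau>_def \<phi>_def using ne by (intro continuous_intros) (simp add: \<phi>_def)
  have cg: "isCont g y" unfolding g_def by (intro continuous_intros c\<tau>)
  have gy: "g y = z" using th \<theta>(1) by (simp add: g_def \<tau>_def)
  have "\<forall>\<^sub>F w in nhds y. \<tau> w \<in> {0<..<1}"
  proof (rule topological_tendstoD)
    show "(\<tau> \<longlongrightarrow> \<tau> y) (nhds y)" using c\<tau> unfolding isCont_def tendsto_at_iff_tendsto_nhds .
    show "\<tau> y \<in> {0<..<1}" using th \<theta> by (simp add: \<tau>_def)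
  qed simp
  moreover have "\<forall>\<^sub>F w in nhds y. g w \<in> ball z e"
  proof (rule topological_tendstoD)
    show "(g \<longlongrightarrow> g y) (nhds y)" using cg unfolding isCont_def tendsto_at_iff_tendsto_nhds .
    show "g y \<in> ball z e" using gy e(1) by simp
  qed simp
  ultimately have "\<forall>\<^sub>F w in nhds y. \<tau> w \<in> {0<..<1} \<and> g w \<in> ball z e" by eventually_elim auto
  then obtain d where d: "d > 0" "\<And>w. dist w y < d \<Longrightarrow> \<tau> w \<in> {0<..<1} \<and> g w \<in> ball z e"
    unfolding eventually_nhds_metric by blast
  show thesis
  proof (rule that[OF d(1)])
    fix y' assume "y' \<in> ball y d"
    then have w: "\<tau> y' \<in> {0<..<1}" "g y' \<in> ball z e" using d(2)[of y'] by (auto simp: dist_commute)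
    then have w3: "\<phi> x - \<phi> y' \<noteq> 0" by (auto simp: \<tau>_def)
    have "\<phi> (g y') = (1 - \<tau> y') * \<phi> x + \<tau> y' * \<phi> y'" unfolding g_def by (rule aff)
    also have "\<dots> = \<phi> x - \<tau> y' * (\<phi> x - \<phi> y')" by (simp add: algebra_simps)
    also have "\<dots> = 0" using w3 by (simp add: \<tau>_def)
    finally have "g y' \<in> wall" using e(2)[OF w(2)] by (simp add: \<phi>_def)
    moreover have "g y' \<in> closed_segment x y'" unfolding in_segment g_def using w(1) by (intro exI[of _ "\<tau> y'"]) auto
    ultimately show "closed_segment x y' \<inter> wall \<noteq> {}" by blast
  qed
next
  case False
  have mono: "a \<in> B" if "t \<in> T" "z - t \<in> P" "a \<in> active (z - t)" for t a
    by (rule wall_monochromatic[OF z(1) _ that]) (use False in blast)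
  obtain e where e: "e > 0" "\<And>t a y. t \<in> T \<Longrightarrow> a \<in> N \<Longrightarrow> y \<in> ball z e \<Longrightarrow> y - t \<in> fct a \<Longrightarrow> z - t \<in> fct a"
    by (rule facets_locally_finite[of z]) (rule that; blast)
  have fw: "w \<in> wall" if "t \<in> T" "a \<in> N" "w \<in> ball z e" "w - t \<in> fct a" for t a w
  proof -
    have "z - t \<in> fct a" by (rule e(2)[OF that])
    then have "a \<in> B" using mono[OF that(1), of a] that(2) by (simp add: active_def fct_iff)
    then show ?thesis unfolding wall_def using that by blast
  qed
  have xy: "x \<noteq> y"
  proof
    assume "x = y"
    then have "z = x" using \<theta>(1) by (simp add: algebra_simps)
    then show False using z(1) x BN unfolding wall_def by (auto simp: fct_iff)
  qed
  define \<delta> where "\<delta> = min (min \<theta> (1 - \<theta>)) (e / (4 * norm (y - x)))"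
  have d: "\<delta> > 0" "\<delta> \<le> \<theta>" "\<delta> \<le> 1 - \<theta>" using \<theta> e(1) xy by (auto simp: \<delta>_def)
  have "\<delta> * norm (y - x) \<le> e / (4 * norm (y - x)) * norm (y - x)" by (intro mult_right_mono) (auto simp: \<delta>_def)
  then have dn: "\<delta> * norm (y - x) < e / 2" using xy e(1) by simp
  define pt where "pt s w = (1 - s) *\<^sub>R x + s *\<^sub>R w" for s w
  \<comment> \<open>points of the segment shortly before and after \<open>z\<close>; the points \<open>p'\<close> and \<open>q'\<close> correspond to them on a nearby segment\<close>
  define p where "p = pt (\<theta> - \<delta>) y"
  define q where "q = pt (\<theta> + \<delta>) y"
  have pz: "p = z - \<delta> *\<^sub>R (y - x)" and qz: "q = z + \<delta> *\<^sub>R (y - x)"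
    unfolding p_def q_def pt_def \<theta>(1) by (simp_all add: algebra_simps)
  obtain ep where ep: "ep > 0" "\<And>t w. t \<in> T \<Longrightarrow> w \<in> ball p ep \<Longrightarrow> w - t \<in> P \<Longrightarrow> p - t \<in> P"
    by (rule locally_finite[of p]) (rule that; blast)
  obtain eq where eq: "eq > 0" "\<And>t w. t \<in> T \<Longrightarrow> w \<in> ball q eq \<Longrightarrow> w - t \<in> P \<Longrightarrow> q - t \<in> P"
    by (rule locally_finite[of q]) (rule that; blast)
  show thesis
  proof (rule that[of "min (e / 2) (min ep eq)"])
    show "min (e / 2) (min ep eq) > 0" using e ep eq by simp
    fix y' assume y': "y' \<in> ball y (min (e / 2) (min ep eq))"
    show "closed_segment x y' \<inter> wall \<noteq> {}"
    proof
      assume avoid: "closed_segment x y' \<inter> wall = {}"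
      have close: "dist (pt s y) (pt s y') \<le> dist y y'" if "0 \<le> s" "s \<le> 1" for s
      proof -
        have "pt s y - pt s y' = s *\<^sub>R (y - y')" by (simp add: pt_def algebra_simps)
        then have "dist (pt s y) (pt s y') = s * dist y y'" using that by (simp add: dist_norm)
        then show ?thesis using that by (simp add: mult_left_le_one_le)
      qed
      define p' where "p' = pt (\<theta> - \<delta>) y'"
      define q' where "q' = pt (\<theta> + \<delta>) y'"
      have pp: "dist p p' \<le> dist y y'" "dist q q' \<le> dist y y'"
        unfolding p_def p'_def q_def q'_def using d by (auto intro!: close)
      then have p'p: "p' \<in> ball p ep" and q'q: "q' \<in> ball q eq" and "dist p p' < e / 2" "dist q q' < e / 2" using y' by auto
      moreover have "dist z p < e / 2" "dist z q < e / 2" using dn d(1) by (simp_all add: pz qz dist_norm)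
      ultimately have "p' \<in> ball z e" "q' \<in> ball z e"
        using dist_triangle[of z p' p] dist_triangle[of z q' q] by auto
      then have sub: "closed_segment p' q' \<subseteq> ball z e" by (simp add: closed_segment_subset)
      have "p' \<in> closed_segment x y'" "q' \<in> closed_segment x y'"
        unfolding in_segment p'_def q'_def pt_def using d by (intro exI[of _ "\<theta> - \<delta>"] exI[of _ "\<theta> + \<delta>"]; simp)+
      then have sub2: "closed_segment p' q' \<subseteq> closed_segment x y'" by (simp add: closed_segment_subset)
      obtain t where t: "t \<in> T" "p' - t \<in> P" using cover by blast
      have "q' - t \<in> P"
      proof (rule ccontr)
        assume "q' - t \<notin> P"
        then have "closed_segment p' q' \<inter> frontier ((+) t ` P) \<noteq> {}"
          using t(2) by (intro connected_Int_frontier) (auto simp: mem_translation_iff[symmetric])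
        then obtain w where w: "w \<in> closed_segment p' q'" "w \<in> frontier ((+) t ` P)" by blast
        then have "w - t \<in> frontier P" by (metis mem_translation_iff frontier_translation image_iff add_diff_cancel_left')
        then have "w - t \<in> P" "w - t \<notin> interior P" using closed by (auto simp: frontier_def)
        then obtain a where "a \<in> N" "a \<bullet> (w - t) = 1" using frontier_fct by blast
        then have "w \<in> wall" using fw[OF t(1)] w(1) sub \<open>w - t \<in> P\<close> by (auto simp: fct_iff)
        then show False using avoid sub2 w(1) by blast
      qed
      then have pq: "p - t \<in> P" "q - t \<in> P" using ep(2)[OF t(1) p'p] eq(2)[OF t(1) q'q] t(2) by blast+
      have at: "a \<bullet> (p - t) = a \<bullet> (z - t) - \<delta> * (a \<bullet> (y - x))" "a \<bullet> (q - t) = a \<bullet> (z - t) + \<delta> * (a \<bullet> (y - x))" for a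
        by (simp_all add: pz qz inner_diff_right inner_add_right algebra_simps)
      have zP: "z - t \<in> P"
        unfolding mem_P_iff
      proof
        fix a assume "a \<in> N"
        then have "a \<bullet> (p - t) \<le> 1" "a \<bullet> (q - t) \<le> 1" using N_le pq by auto
        then show "a \<bullet> (z - t) \<le> 1" using at[of a] by linarith
      qed
      obtain t0 b where t0: "t0 \<in> T" "b \<in> B" "z - t0 \<in> fct b" using z(1) unfolding wall_def by blast
      have "z - t \<notin> interior P"
      proof
        assume i: "z - t \<in> interior P"
        have "z - t0 \<in> P" "b \<bullet> (z - t0) = 1" using t0(3) by (auto simp: fct_iff)
        then have "t0 = t" using interior_unique[OF t0(1) t(1) _ i] by blast
        then have "b \<bullet> (z - t0) < 1" using i BN[OF t0(2)] interior_iff by blast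
        then show False using \<open>b \<bullet> (z - t0) = 1\<close> by simp
      qed
      then obtain a where a: "a \<in> N" "a \<bullet> (z - t) = 1" using frontier_fct zP by blast
      have "a \<bullet> (p - t) \<le> 1" "a \<bullet> (q - t) \<le> 1" using N_le[OF a(1)] pq by auto
      then have "\<delta> * (a \<bullet> (y - x)) = 0" using a(2) at[of a] by linarith
      then have 0: "a \<bullet> (y - x) = 0" using d(1) by simp
      have "a \<bullet> (z - t) = a \<bullet> (x - t) + \<theta> * (a \<bullet> (y - x))"
        unfolding \<theta>(1) by (simp add: inner_diff_right inner_add_right algebra_simps)
      then have "a \<bullet> (x - t) = 1" using a(2) 0 by simp
      then show False using x[OF t(1) a(1)] by blast
    qed
  qed
qed

end

section \<open>Normals and shifts of different colours are orthogonal\<close>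

lemma exists_orthogonal_coefficients:
  fixes p1 p2 p3 q1 q2 q3 :: real
  shows "\<exists>r s w. (r, s, w) \<noteq> (0, 0, 0) \<and> r * p1 + s * p2 + w * p3 = 0 \<and> r * q1 + s * q2 + w * q3 = 0"
proof -
  define x y z where "x = p2 * q3 - p3 * q2" "y = p3 * q1 - p1 * q3" "z = p1 * q2 - p2 * q1"
  note xyz = this
  have cross: "x * p1 + y * p2 + z * p3 = 0" "x * q1 + y * q2 + z * q3 = 0"
    by (simp_all add: xyz algebra_simps)
  show ?thesis
  proof (cases "(x, y, z) = (0, 0, 0)")
    case False
    then show ?thesis using cross by blast
  next
    case True
    then have 0: "p2 * q3 = p3 * q2" "p3 * q1 = p1 * q3" "p1 * q2 = p2 * q1" by (auto simp: xyz)
    show ?thesis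
    proof (cases "(p1, p2) = (0, 0)")
      case False
      then show ?thesis using 0 by (intro exI[of _ p2] exI[of _ "- p1"] exI[of _ 0]) (auto simp: algebra_simps)
    next
      case p: True
      show ?thesis
      proof (cases "(q1, q2) = (0, 0)")
        case False
        then show ?thesis using p by (intro exI[of _ q2] exI[of _ "- q1"] exI[of _ 0]) (auto simp: algebra_simps)
      next
        case True
        then show ?thesis using p by (intro exI[of _ 1] exI[of _ 0] exI[of _ 0]) auto
      qed
    qed
  qed
qed

text \<open>The three equations describe a flat of codimension three; together with the direction \<open>v\<close> and
  the origin it spans a proper subspace. The two conditions on the normal
  \<open>n = r a + s b + w c\<close> are linear equations in three unknowns.\<close>

lemma hyperplane_through_flat:
  fixes a b c v t :: "'a::euclidean_space"
  assumes a: "a \<noteq> 0" and b: "\<And>r. b \<noteq> r *\<^sub>R a" and c: "c \<notin> span {a, b}"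
  shows "\<exists>n. n \<noteq> 0 \<and> n \<bullet> v = 0 \<and>
    (\<forall>z. a \<bullet> (z - t) = 1 \<longrightarrow> b \<bullet> (z - t) = 1 \<longrightarrow> c \<bullet> (z - t) = 1 \<longrightarrow> n \<bullet> z = 0)"
proof -
  obtain r s w where rsw: "(r, s, w) \<noteq> (0, 0, 0)"
      "r * (1 + a \<bullet> t) + s * (1 + b \<bullet> t) + w * (1 + c \<bullet> t) = 0" "r * (a \<bullet> v) + s * (b \<bullet> v) + w * (c \<bullet> v) = 0"
    using exists_orthogonal_coefficients[of "1 + a \<bullet> t" "1 + b \<bullet> t" "1 + c \<bullet> t" "a \<bullet> v" "b \<bullet> v" "c \<bullet> v"] by blast
  define n where "n = r *\<^sub>R a + s *\<^sub>R b + w *\<^sub>R c"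
  have "n \<noteq> 0"
  proof
    assume n0: "n = 0"
    have w0: "w = 0"
    proof (rule ccontr)
      assume "w \<noteq> 0"
      have "c = (1 / w) *\<^sub>R n + ((- r / w) *\<^sub>R a + (- s / w) *\<^sub>R b)"
        using \<open>w \<noteq> 0\<close> by (simp add: n_def algebra_simps)
      then have "c = (- r / w) *\<^sub>R a + (- s / w) *\<^sub>R b" unfolding n0 by simp
      then show False using c unfolding mem_span_pair by blast
    qed
    have "s = 0"
    proof (rule ccontr)
      assume "s \<noteq> 0"
      have "b = (1 / s) *\<^sub>R n + (- r / s) *\<^sub>R a" using \<open>s \<noteq> 0\<close> w0 by (simp add: n_def algebra_simps)
      then have "b = (- r / s) *\<^sub>R a" unfolding n0 by simp
      then show False using b by blast
    qed
    then show False using rsw(1) n0 w0 a by (simp add: n_def)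
  qed
  moreover have "n \<bullet> v = 0" using rsw(3) by (simp add: n_def inner_add_left)
  moreover have "n \<bullet> z = 0" if "a \<bullet> (z - t) = 1" "b \<bullet> (z - t) = 1" "c \<bullet> (z - t) = 1" for z
  proof -
    have "a \<bullet> z = 1 + a \<bullet> t" "b \<bullet> z = 1 + b \<bullet> t" "c \<bullet> z = 1 + c \<bullet> t" using that by (simp_all add: inner_diff_right)
    then show ?thesis using rsw(2) by (simp add: n_def inner_add_left)
  qed
  ultimately show ?thesis by blast
qed

context centred_tiling
begin

text \<open>Any other facet through the centre of the facet \<open>a\<close> would, by symmetry, contain all of it.\<close>

lemma half_shift_active:
  assumes a: "a \<in> N"
  shows "(1/2) *\<^sub>R shift a \<in> P" "active ((1/2) *\<^sub>R shift a) = {a}"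
proof -
  let ?m = "(1/2) *\<^sub>R shift a"
  obtain y where y: "y \<in> fct a" using fct_ne[OF a] by blast
  have "y \<in> P" "shift a - y \<in> P" using y shift_reflect[OF a y] fct_subset by auto
  then have "(1/2) *\<^sub>R y + (1/2) *\<^sub>R (shift a - y) \<in> P" using convex by (intro convexD) auto
  then show "?m \<in> P" by (simp add: algebra_simps)
  have "c = a" if c: "c \<in> N" "c \<bullet> ?m = 1" for c
  proof -
    have "fct a \<subseteq> fct c"
    proof
      fix y assume y: "y \<in> fct a"
      then have yP: "y \<in> P" "shift a - y \<in> P" using shift_reflect[OF a y] fct_subset by auto
      have "c \<bullet> y \<le> 1" "c \<bullet> (shift a - y) \<le> 1" using N_le[OF c(1)] yP by auto
      then have "c \<bullet> y = 1" using c(2) by (simp add: inner_diff_right)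
      then show "y \<in> fct c" using yP by (simp add: fct_iff)
    qed
    then show ?thesis using fct_subset_eq[OF c(1) a] by simp
  qed
  moreover have "a \<bullet> ?m = 1" using inner_shift[OF a] by simp
  ultimately show "active ?m = {a}" using a by (auto simp: active_def)
qed

lemma multiple_in_T:
  assumes "t \<in> T"
  shows "real_of_int k *\<^sub>R t \<in> T"
proof -
  have nat: "real n *\<^sub>R t \<in> T" for n
  proof (induction n)
    case (Suc n)
    then show ?case using T_add[OF assms] by (simp add: scaleR_left_distrib)
  qed (use zero_T in simp)
  show ?thesis
  proof (cases "k \<ge> 0")
    case True then show ?thesis using nat[of "nat k"] by simp
  next
    case False then show ?thesis using T_uminus[OF nat[of "nat (- k)"]] by simp
  qed
qed

end

context coloured_tiling
begin

text \<open>The axis runs through the centres of the facets \<open>a\<close> of the tiles at the multiples of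
  \<open>shift a\<close> and otherwise through the interiors of these tiles.\<close>

lemma axis_avoids_wall:
  assumes a: "a \<in> A"
  shows "s *\<^sub>R shift a \<notin> wall"
proof
  assume "s *\<^sub>R shift a \<in> wall"
  then obtain t b where t: "t \<in> T" "b \<in> B" "s *\<^sub>R shift a - t \<in> fct b" unfolding wall_def by blast
  \<comment> \<open>the rounding that makes \<open>r = 1/2\<close> the only case on the boundary\<close>
  define k where "k = \<lceil>s - 1/2\<rceil>"
  define r where "r = s - real_of_int k"
  have r: "- 1/2 < r" "r \<le> 1/2" unfolding r_def k_def by linarith+
  define t' where "t' = t - real_of_int k *\<^sub>R shift a"
  have t': "t' \<in> T" "r *\<^sub>R shift a - t' \<in> fct b"
    using T_diff[OF t(1) multiple_in_T[OF shift_in_T[OF AN[OF a]]]] t(3)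
    by (auto simp: t'_def r_def algebra_simps)
  then have t'P: "r *\<^sub>R shift a - t' \<in> P" "b \<in> active (r *\<^sub>R shift a - t')" using BN[OF t(2)] by (auto simp: fct_iff active_def)
  let ?m = "(1/2) *\<^sub>R shift a"
  note m = half_shift_active[OF AN[OF a]]
  show False
  proof (cases "r = 1/2")
    case False
    have "r *\<^sub>R shift a \<in> interior P"
      unfolding interior_iff
    proof
      fix c assume c: "c \<in> N"
      have "c \<bullet> ?m \<le> 1" "- (c \<bullet> ?m) \<le> 1" using N_le[OF c m(1)] N_le[OF c sym[OF m(1)]] by auto
      then have "\<bar>c \<bullet> shift a\<bar> \<le> 2" by simp
      moreover have "\<bar>r\<bar> < 1/2" using r False by linarith
      ultimately have "\<bar>r\<bar> * \<bar>c \<bullet> shift a\<bar> < 1"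
        using mult_left_mono[of "\<bar>c \<bullet> shift a\<bar>" 2 "\<bar>r\<bar>"] by linarith
      then have "\<bar>r * (c \<bullet> shift a)\<bar> < 1" by (simp add: abs_mult)
      then show "c \<bullet> (r *\<^sub>R shift a) < 1" by (simp add: abs_less_iff)
    qed
    then have i: "r *\<^sub>R shift a - 0 \<in> interior P" by simp
    then have "t' = 0" using interior_unique[OF t'(1) zero_T t'P(1)] by blast
    then show False using i t'P(2) interior_iff by (auto simp: active_def)
  next
    case True
    have mr: "?m - 0 \<in> rel_interior (fct a)"
    proof -
      have "c \<bullet> ?m < 1" if c: "c \<in> N" "c \<noteq> a" for c
      proof -
        have "c \<notin> active ?m" using m(2) c(2) by blast
        then show ?thesis using N_le[OF c(1) m(1)] c(1) by (auto simp: active_def)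
      qed
      then show ?thesis using rel_interior_fctI[OF AN[OF a], of ?m] inner_shift[OF AN[OF a]] by simp
    qed
    show False
    proof (cases "t' = 0")
      case True
      then have "b \<in> active ?m" using t'P(2) \<open>r = 1/2\<close> by simp
      then show False using m(2) AB_neq[OF a t(2)] by auto
    next
      case False
      have "t' = 0 + shift a"
        by (rule neighbour_shift[OF zero_T t'(1) False[symmetric] AN[OF a] mr]) (use t'P(1) \<open>r = 1/2\<close> in simp)
      then have "r *\<^sub>R shift a - t' = - ?m" unfolding \<open>r = 1/2\<close>
        by (simp add: algebra_simps scaleR_left_distrib[symmetric])
      then have "b \<in> active (- ?m)" using t'P(2) by simp
      then have "b = - a" unfolding active_uminus m(2) by simp
      then show False using A_uminus[OF a] AB_neq t(2) by blast
    qed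
  qed
qed

text \<open>The points other than \<open>s * v\<close> on the rays from \<open>s * v\<close> through \<open>x\<close> are generic, and \<open>x\<close> is
  in no hyperplane of a facet.\<close>

definition wall_generic :: "'a \<Rightarrow> 'a \<Rightarrow> bool" where
  "wall_generic v x \<longleftrightarrow> (\<forall>t\<in>T. \<forall>a\<in>N. a \<bullet> (x - t) \<noteq> 1) \<and>
     (\<forall>\<theta><1. \<forall>s. generic ((1 - \<theta>) *\<^sub>R x + \<theta> *\<^sub>R (s *\<^sub>R v)))"

lemma wall_generic_exists:
  assumes U: "open U" "U \<noteq> {}"
  obtains x where "x \<in> U" "wall_generic v x"
proof -
  define good where "good h n \<longleftrightarrow> (case h of (t, a, b, c) \<Rightarrow> n \<noteq> 0 \<and> n \<bullet> v = 0 \<and>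
      (\<forall>z. a \<bullet> (z - t) = 1 \<longrightarrow> b \<bullet> (z - t) = 1 \<longrightarrow> c \<bullet> (z - t) = 1 \<longrightarrow> n \<bullet> z = 0))" for h and n :: 'a
  define H where "H = {h \<in> (\<lambda>h. (SOME n. good h n, 0::real)) ` (T \<times> N \<times> N \<times> N). fst h \<noteq> 0}
      \<union> (\<lambda>(t, a). (a, 1 + a \<bullet> t)) ` (T \<times> N)"
  have cH: "countable H"
    unfolding H_def using countable_T countable_finite[OF finite_N]
    by (intro countable_Un countable_image countable_Collect countable_SIGMA) auto
  have nzH: "n \<noteq> 0" if "(n, d) \<in> H" for n d using that N_nonzero unfolding H_def by auto
  obtain x where x: "x \<in> U" and xH: "\<And>n d. (n, d) \<in> H \<Longrightarrow> n \<bullet> x \<noteq> d"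
    by (rule open_avoids_hyperplanes[OF U cH]) (use nzH that in blast)+
  have "a \<bullet> (x - t) \<noteq> 1" if "t \<in> T" "a \<in> N" for t a
  proof -
    have "(a, 1 + a \<bullet> t) \<in> H" unfolding H_def using that by force
    from xH[OF this] show ?thesis by (simp add: inner_diff_right)
  qed
  moreover have "generic ((1 - \<theta>) *\<^sub>R x + \<theta> *\<^sub>R (s *\<^sub>R v))" if th: "\<theta> < 1" for \<theta> s
    unfolding generic_def
  proof (intro ballI impI subsetI)
    define z where "z = (1 - \<theta>) *\<^sub>R x + \<theta> *\<^sub>R (s *\<^sub>R v)"
    fix t a b c
    assume t: "t \<in> T" and "(1 - \<theta>) *\<^sub>R x + \<theta> *\<^sub>R (s *\<^sub>R v) - t \<in> P"
      and "a \<in> active ((1 - \<theta>) *\<^sub>R x + \<theta> *\<^sub>R (s *\<^sub>R v) - t)" "b \<in> active ((1 - \<theta>) *\<^sub>R x + \<theta> *\<^sub>R (s *\<^sub>R v) - t)"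
      and ne: "a \<noteq> b" and "c \<in> active ((1 - \<theta>) *\<^sub>R x + \<theta> *\<^sub>R (s *\<^sub>R v) - t)"
    then have az: "a \<in> N" "b \<in> N" "c \<in> N" "a \<bullet> (z - t) = 1" "b \<bullet> (z - t) = 1" "c \<bullet> (z - t) = 1"
      unfolding z_def active_def by auto
    show "c \<in> span {a, b}"
    proof (rule ccontr)
      assume "c \<notin> span {a, b}"
      then have "\<exists>n. good (t, a, b, c) n"
        using hyperplane_through_flat[OF N_nonzero[OF az(1)] not_multiple[OF az(1,2) ne az(4,5)], of c v t]
        unfolding good_def by auto
      define n where "n = (SOME n. good (t, a, b, c) n)"
      have "good (t, a, b, c) n" unfolding n_def by (rule someI_ex) fact
      then have n: "n \<noteq> 0" "n \<bullet> v = 0" "n \<bullet> z = 0" using az(4-6) unfolding good_def by auto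
      have "(n, 0) \<in> H" unfolding H_def n_def using t az n(1)[unfolded n_def] by force
      then have "n \<bullet> x \<noteq> 0" using xH by blast
      moreover have "(1 - \<theta>) * (n \<bullet> x) = 0" using n(2,3) unfolding z_def by (simp add: inner_add_right)
      ultimately show False using th by simp
    qed
  qed
  ultimately show thesis using that x unfolding wall_generic_def by blast
qed

text \<open>The set of parameters \<open>s\<close> with this property is open because the wall is closed, its
  complement is open by \<open>wall_crossing\<close>, and it contains zero.\<close>

lemma ray_avoids_wall:
  assumes a: "a \<in> A" and x: "x \<in> interior P" and wg: "wall_generic (shift a) x"
  shows "closed_segment x (s *\<^sub>R shift a) \<inter> wall = {}"
proof -
  define v where "v = shift a"
  have x1: "c \<bullet> (x - t) \<noteq> 1" if "t \<in> T" "c \<in> N" for t c using wg that unfolding wall_generic_def by blast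
  have gen: "generic ((1 - \<theta>) *\<^sub>R x + \<theta> *\<^sub>R (s *\<^sub>R v))" if "\<theta> < 1" for \<theta> s
    using wg that unfolding wall_generic_def v_def by blast
  have xwall: "x \<notin> wall" using x1 BN unfolding wall_def by (auto simp: fct_iff)
  define G where "G = {s. closed_segment x (s *\<^sub>R v) \<inter> wall = {}}"
  have "open G"
    unfolding open_dist
  proof
    fix s assume "s \<in> G"
    then obtain d where d: "d > 0" "\<And>p q. p \<in> closed_segment x (s *\<^sub>R v) \<Longrightarrow> q \<in> wall \<Longrightarrow> d \<le> dist p q"
      using separate_compact_closed[OF compact_segment closed_wall, of x "s *\<^sub>R v"] unfolding G_def by auto
    have "s' \<in> G" if s': "dist s' s < d / (norm v + 1)" for s'
      unfolding G_def
    proof (clarify, rule ccontr)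
      assume "closed_segment x (s' *\<^sub>R v) \<inter> wall \<noteq> {}"
      then obtain \<theta> where th: "0 \<le> \<theta>" "\<theta> \<le> 1" "(1 - \<theta>) *\<^sub>R x + \<theta> *\<^sub>R (s' *\<^sub>R v) \<in> wall" by (auto simp: in_segment)
      let ?p = "(1 - \<theta>) *\<^sub>R x + \<theta> *\<^sub>R (s *\<^sub>R v)" and ?q = "(1 - \<theta>) *\<^sub>R x + \<theta> *\<^sub>R (s' *\<^sub>R v)"
      have "?p \<in> closed_segment x (s *\<^sub>R v)" using th by (auto simp: in_segment)
      then have "d \<le> dist ?p ?q" using d(2) th(3) by blast
      also have "?p - ?q = (\<theta> * (s - s')) *\<^sub>R v" by (simp add: algebra_simps)
      then have "dist ?p ?q = \<theta> * \<bar>s - s'\<bar> * norm v" using th by (simp add: dist_norm abs_mult)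
      also have "\<dots> \<le> 1 * \<bar>s - s'\<bar> * norm v" using th by (intro mult_right_mono) auto
      also have "\<dots> \<le> \<bar>s - s'\<bar> * (norm v + 1)" by (simp add: mult_left_mono)
      also have "\<dots> < d"
      proof -
        have "norm v + 1 > 0" using norm_ge_zero[of v] by linarith
        then show ?thesis using s' by (simp add: dist_real_def abs_minus_commute pos_less_divide_eq)
      qed
      finally show False by simp
    qed
    moreover have "d / (norm v + 1) > 0" using d(1) by (simp add: add_nonneg_pos)
    ultimately show "\<exists>e>0. \<forall>y. dist y s < e \<longrightarrow> y \<in> G" by blast
  qed
  moreover have "open (- G)"
    unfolding open_dist
  proof
    fix s assume "s \<in> - G"
    then obtain z where z: "z \<in> closed_segment x (s *\<^sub>R v)" "z \<in> wall" unfolding G_def by blast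
    then obtain \<theta> where th: "0 \<le> \<theta>" "\<theta> \<le> 1" "z = (1 - \<theta>) *\<^sub>R x + \<theta> *\<^sub>R (s *\<^sub>R v)" by (auto simp: in_segment)
    have "\<theta> \<noteq> 0" using th(3) z(2) xwall by auto
    moreover have "\<theta> \<noteq> 1" using th(3) z(2) axis_avoids_wall[OF a, of s] by (auto simp: v_def)
    ultimately have th': "0 < \<theta>" "\<theta> < 1" using th by auto
    have "generic z" unfolding th(3) by (rule gen[OF th'(2)])
    then obtain e where e: "e > 0" "\<And>y'. y' \<in> ball (s *\<^sub>R v) e \<Longrightarrow> closed_segment x y' \<inter> wall \<noteq> {}"
      using wall_crossing[OF z(2) _ th(3) th' x1] by blast
    have "s' \<in> - G" if s': "dist s' s < e / (norm v + 1)" for s'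
    proof -
      have "norm v + 1 > 0" using norm_ge_zero[of v] by linarith
      then have "\<bar>s' - s\<bar> * (norm v + 1) < e" using s' by (simp add: dist_real_def pos_less_divide_eq)
      moreover have "dist (s *\<^sub>R v) (s' *\<^sub>R v) = \<bar>s' - s\<bar> * norm v"
        using abs_minus_commute[of s s'] by (simp add: dist_norm scaleR_diff_left[symmetric])
      ultimately have "dist (s *\<^sub>R v) (s' *\<^sub>R v) < e" unfolding distrib_left by (smt (verit) abs_ge_zero)
      then show ?thesis using e(2)[of "s' *\<^sub>R v"] unfolding G_def by simp
    qed
    moreover have "e / (norm v + 1) > 0" using e(1) by (simp add: add_nonneg_pos)
    ultimately show "\<exists>e>0. \<forall>y. dist y s < e \<longrightarrow> y \<in> - G" by blast
  qed
  moreover have "0 \<in> G"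
  proof -
    have "closed_segment x 0 \<subseteq> interior P"
      using x zero_interior convex_interior[OF convex] by (simp add: closed_segment_subset)
    moreover have "w \<notin> wall" if "w \<in> interior P" for w
    proof
      assume "w \<in> wall"
      then obtain t b where t: "t \<in> T" "b \<in> B" "w - t \<in> fct b" unfolding wall_def by blast
      then have "w - t \<in> P" "b \<bullet> (w - t) = 1" by (auto simp: fct_iff)
      then have "t = 0" using interior_unique[OF t(1) zero_T] that by simp
      then show False using that \<open>b \<bullet> (w - t) = 1\<close> BN[OF t(2)] interior_iff by auto
    qed
    ultimately show ?thesis unfolding G_def by auto
  qed
  ultimately have "G = UNIV" using clopen[of G] by (auto simp: closed_def)
  then show ?thesis unfolding G_def v_def by blast
qed

text \<open>Otherwise, with \<open>v = shift a\<close>, the point \<open>s * v\<close> is beyond the hyperplane of \<open>b\<close> for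
  large \<open>s\<close>. Segments from \<open>x\<close> to such points become parallel to \<open>v\<close>, so they cross the
  hyperplane near the projection \<open>\<pi> x\<close> of \<open>x\<close> along \<open>v\<close>. If \<open>x\<close> is chosen such that \<open>\<pi> x\<close> is
  close to the centre of the facet \<open>b\<close>, they cross it inside this facet.\<close>

lemma mixed_orthogonal_aux:
  assumes a: "a \<in> A" and b: "b \<in> B"
  shows "b \<bullet> shift a \<le> 0"
proof (rule ccontr)
  define v where "v = shift a"
  assume "\<not> b \<bullet> shift a \<le> 0"
  then have bv: "b \<bullet> v > 0" by (simp add: v_def)
  let ?f = "(1/2) *\<^sub>R shift b"
  note f = half_shift_active[OF BN[OF b]]
  have bf: "b \<bullet> ?f = 1" using inner_shift[OF BN[OF b]] by simp
  obtain ef where ef: "ef > 0" "\<And>y. y \<in> ball ?f ef \<Longrightarrow> (\<And>c. c \<in> active ?f \<Longrightarrow> c \<bullet> y \<le> 1) \<Longrightarrow> y \<in> P"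
    using active_determines_nearby[OF f(1)] by metis
  have near_f: "y \<in> wall" if y: "y \<in> ball ?f ef" "b \<bullet> y = 1" for y
  proof -
    have "y \<in> P" using y by (intro ef(2)) (auto simp: f(2))
    then have "y - 0 \<in> fct b" using y(2) by (simp add: fct_iff)
    then show ?thesis unfolding wall_def using zero_T b by blast
  qed
  define \<pi> where "\<pi> x = x + ((1 - b \<bullet> x) / (b \<bullet> v)) *\<^sub>R v" for x
  have "continuous_on UNIV \<pi>" unfolding \<pi>_def using bv by (intro continuous_intros) auto
  then have oU: "open (interior P \<inter> \<pi> -` ball ?f ef)"
    by (intro open_Int open_vimage) auto
  have neU: "interior P \<inter> \<pi> -` ball ?f ef \<noteq> {}"
  proof -
    obtain e where e: "e > 0" "\<And>d. 0 < d \<Longrightarrow> d \<le> e \<Longrightarrow> ?f + d *\<^sub>R (- v) \<in> interior P"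
      by (rule move_along[OF f(1), of "- v"]) (rule that; use f(2) bv in auto)
    have "b \<bullet> (?f - e *\<^sub>R v) = 1 - e * (b \<bullet> v)" using bf by (simp add: inner_diff_right)
    then have "\<pi> (?f - e *\<^sub>R v) = ?f" unfolding \<pi>_def using bv by simp
    then have "?f - e *\<^sub>R v \<in> interior P \<inter> \<pi> -` ball ?f ef" using e(2)[of e] e(1) ef(1) by simp
    then show ?thesis by blast
  qed
  obtain x where "x \<in> interior P \<inter> \<pi> -` ball ?f ef" and wg: "wall_generic v x"
    by (rule wall_generic_exists[OF oU neU])
  then have x: "x \<in> interior P" "\<pi> x \<in> ball ?f ef" by auto
  have bx: "b \<bullet> x < 1" using x(1) BN[OF b] interior_iff by blast
  \<comment> \<open>the point where the segment from \<open>x\<close> to \<open>s * v\<close> meets the hyperplane of \<open>b\<close>\<close>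
  define g where "g s = (let \<tau> = (1 - b \<bullet> x) / (s * (b \<bullet> v) - b \<bullet> x) in (1 - \<tau>) *\<^sub>R x + \<tau> *\<^sub>R (s *\<^sub>R v))" for s
  have lim: "(g \<longlongrightarrow> \<pi> x) at_top"
  proof -
    define \<tau> where "\<tau> s = (1 - b \<bullet> x) / (s * (b \<bullet> v) - b \<bullet> x)" for s
    have inf: "filterlim (\<lambda>s. s * (b \<bullet> v) - b \<bullet> x) at_top at_top"
    proof -
      have "filterlim (\<lambda>s. - (b \<bullet> x) + s * (b \<bullet> v)) at_top at_top"
        using bv by (intro filterlim_tendsto_add_at_top[OF tendsto_const] filterlim_at_top_mult_tendsto_pos[OF tendsto_const] filterlim_ident) 
      then show ?thesis by simp
    qed
    have t0: "(\<tau> \<longlongrightarrow> 0) at_top" unfolding \<tau>_def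
      by (rule tendsto_divide_0[OF tendsto_const]) (rule filterlim_at_top_imp_at_infinity[OF inf])
    have t1: "((\<lambda>s. \<tau> s * s) \<longlongrightarrow> (1 - b \<bullet> x) / (b \<bullet> v)) at_top"
    proof -
      have "\<forall>\<^sub>F s in at_top. s * (b \<bullet> v) - b \<bullet> x > 0" using inf unfolding filterlim_at_top_dense by blast
      then have "\<forall>\<^sub>F s in at_top. (1 - b \<bullet> x) / (b \<bullet> v) + \<tau> s * ((b \<bullet> x) / (b \<bullet> v)) = \<tau> s * s"
      proof eventually_elim
        case (elim s)
        then have "\<tau> s * (s * (b \<bullet> v) - b \<bullet> x) = 1 - b \<bullet> x" by (simp add: \<tau>_def)
        then have "1 - b \<bullet> x + \<tau> s * (b \<bullet> x) = \<tau> s * s * (b \<bullet> v)" by (simp add: algebra_simps)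
        then have "(1 - b \<bullet> x + \<tau> s * (b \<bullet> x)) / (b \<bullet> v) = \<tau> s * s" using bv by simp
        then show ?case by (simp add: add_divide_distrib)
      qed
      moreover have "((\<lambda>s. (1 - b \<bullet> x) / (b \<bullet> v) + \<tau> s * ((b \<bullet> x) / (b \<bullet> v))) \<longlongrightarrow> (1 - b \<bullet> x) / (b \<bullet> v) + 0 * ((b \<bullet> x) / (b \<bullet> v))) at_top"
        by (intro tendsto_intros t0)
      ultimately show ?thesis using tendsto_cong by force
    qed
    have "((\<lambda>s. (1 - \<tau> s) *\<^sub>R x + (\<tau> s * s) *\<^sub>R v) \<longlongrightarrow> (1 - 0) *\<^sub>R x + ((1 - b \<bullet> x) / (b \<bullet> v)) *\<^sub>R v) at_top"
      by (intro tendsto_intros t0 t1)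
    then show ?thesis unfolding g_def Let_def \<pi>_def \<tau>_def[symmetric] by simp
  qed
  have "\<forall>\<^sub>F s in at_top. g s \<in> ball ?f ef" by (rule topological_tendstoD[OF lim _ x(2)]) simp
  moreover have "\<forall>\<^sub>F s in at_top. s > 1 / (b \<bullet> v)" by (rule eventually_gt_at_top)
  ultimately have "\<forall>\<^sub>F s in at_top. g s \<in> ball ?f ef \<and> s > 1 / (b \<bullet> v)" by eventually_elim auto
  then obtain s where s: "g s \<in> ball ?f ef" "s > 1 / (b \<bullet> v)"
    using eventually_happens'[OF trivial_limit_at_top_linorder] by blast
  define \<tau> where "\<tau> = (1 - b \<bullet> x) / (s * (b \<bullet> v) - b \<bullet> x)"
  have sb: "s * (b \<bullet> v) > 1" using s(2) bv by (simp add: pos_divide_less_eq)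
  then have \<tau>: "0 \<le> \<tau>" "\<tau> \<le> 1" "\<tau> * (s * (b \<bullet> v) - b \<bullet> x) = 1 - b \<bullet> x" using bx by (auto simp: \<tau>_def)
  have gs: "g s = (1 - \<tau>) *\<^sub>R x + \<tau> *\<^sub>R (s *\<^sub>R v)" by (simp add: g_def Let_def \<tau>_def)
  have "b \<bullet> g s = b \<bullet> x + \<tau> * (s * (b \<bullet> v) - b \<bullet> x)" unfolding gs by (simp add: inner_add_right algebra_simps)
  then have "g s \<in> wall" using \<tau>(3) near_f[OF s(1)] by simp
  moreover have "g s \<in> closed_segment x (s *\<^sub>R v)" unfolding gs in_segment using \<tau> by blast
  ultimately show False using ray_avoids_wall[OF a x(1) wg[unfolded v_def], of s] unfolding v_def by blast
qed

lemma mixed_orthogonal: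
  assumes "a \<in> A" "b \<in> B"
  shows "b \<bullet> shift a = 0"
  using mixed_orthogonal_aux[OF assms] mixed_orthogonal_aux[OF A_uminus[OF assms(1)] assms(2)]
    shift_uminus[OF AN[OF assms(1)]] by simp

end

section \<open>The direct decomposition\<close>

lemma translation_injective:
  fixes P :: "'a::euclidean_space set"
  assumes "bounded P" "P \<noteq> {}" "(+) t ` P = (+) s ` P"
  shows "t = s"
proof -
  have "t - s = 0"
  proof (rule bounded_translation_into_self[OF assms(1,2)])
    fix x assume "x \<in> P"
    then have "t + x \<in> (+) s ` P" using assms(3) by blast
    then show "x + (t - s) \<in> P" unfolding mem_translation_iff by (simp add: algebra_simps)
  qed
  then show ?thesis by simp
qed

lemma parallelohedron_in_translation:
  assumes P: "parallelohedron_in L P" and c: "c \<in> L"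
  shows "parallelohedron_in L ((+) c ` P)"
proof -
  obtain T where L: "subspace L" and p: "polytope P" "P \<subseteq> L" "aff_dim P = int (dim L)" and T: "T \<subseteq> L" "face_to_face_tiling L {(+) t ` P | t. t \<in> T}"
    using P unfolding parallelohedron_in_def by blast
  have "{(+) t ` (+) c ` P | t. t \<in> (\<lambda>t. t - c) ` T} = {(+) t ` P | t. t \<in> T}"
  proof -
    have e: "(+) (t - c) ` (+) c ` P = (+) t ` P" for t
      unfolding image_image by (rule image_cong) auto
    show ?thesis by (simp only: Setcompr_eq_image image_image[of "\<lambda>t. (+) t ` (+) c ` P"] e Collect_mem_eq)
  qed
  moreover have "(\<lambda>t. t - c) ` T \<subseteq> L" using T(1) c L by (auto intro: subspace_diff)
  moreover have "(+) c ` P \<subseteq> L" using p(2) c L by (auto intro: subspace_add)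
  moreover have "polytope ((+) c ` P)" using p(1) by (simp add: polytope_translation_eq)
  ultimately show ?thesis
    unfolding parallelohedron_in_def using L p(3) T(2) by (auto simp: aff_dim_translation_eq intro!: exI[of _ "(\<lambda>t. t - c) ` T"])
qed

context centred_tiling
begin

text \<open>The tiles at the translations in \<open>L1\<close>, intersected with \<open>L1\<close>, tile \<open>L1\<close>: slicing by a subspace
  preserves faces, and relative interior points of the slice are interior points of \<open>P\<close> because
  the origin is one.\<close>

lemma factor_parallelohedron:
  assumes L: "subspace L1" "subspace L2"
    and T: "\<And>t. t \<in> T \<Longrightarrow> \<exists>t1\<in>T \<inter> L1. \<exists>t2\<in>L2. t = t1 + t2"
    and proj: "\<And>x1 x2. x1 \<in> L1 \<Longrightarrow> x2 \<in> L2 \<Longrightarrow> x1 + x2 \<in> P \<Longrightarrow> x1 \<in> P"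
  shows "parallelohedron_in L1 (P \<inter> L1)"
proof -
  let ?Q = "P \<inter> L1"
  have aff: "affine L1" using L(1) subspace_imp_affine by blast
  have poly: "polytope ?Q"
    using bounded polyhedron aff
    by (auto simp: polytope_eq_bounded_polyhedron affine_imp_polyhedron intro: polyhedron_Int bounded_subset)
  have "0 \<in> L1" using L(1) subspace_0 by blast
  then have "L1 \<inter> interior P \<noteq> {}" using zero_interior by blast
  then have "affine hull (L1 \<inter> P) = L1" 
    using affine_hull_affine_Int_nonempty_interior[OF aff, of P] aff by (simp add: affine_hull_eq)
  then have dim: "aff_dim ?Q = int (dim L1)"
    by (metis Int_commute aff_dim_affine_hull aff_dim_subspace L(1))
  have relint: "x \<in> interior P" if x: "x \<in> rel_interior ?Q" for x
  proof -
    have "0 \<in> ?Q" using zero_in \<open>0 \<in> L1\<close> by blast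
    moreover have "convex ?Q" using convex aff affine_imp_convex convex_Int by blast
    ultimately obtain e where e: "e > 1" "(1 - e) *\<^sub>R 0 + e *\<^sub>R x \<in> ?Q"
      using convex_rel_interior_if2[of ?Q x] x by (metis equals0D hull_inc)
    show ?thesis
      unfolding interior_iff
    proof
      fix a assume a: "a \<in> N"
      have "e * (a \<bullet> x) \<le> 1" using N_le[OF a, of "e *\<^sub>R x"] e by simp
      show "a \<bullet> x < 1"
      proof (rule ccontr)
        assume "\<not> a \<bullet> x < 1"
        then have "e * 1 \<le> e * (a \<bullet> x)" using e(1) by (intro mult_left_mono) auto
        then have "e \<le> e * (a \<bullet> x)" by (simp only: mult_1_right)
        then show False using \<open>e * (a \<bullet> x) \<le> 1\<close> e(1) by linarith
      qed
    qed
  qed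
  note mt = mem_translation_iff
  have tile: "(+) t ` ?Q = (+) t ` P \<inter> L1" if "t \<in> L1" for t
  proof (rule set_eqI)
    fix x
    have "x - t \<in> L1 \<longleftrightarrow> x \<in> L1"
      using subspace_diff[OF L(1) _ that, of x] subspace_add[OF L(1) _ that, of "x - t"] by auto
    then show "x \<in> (+) t ` ?Q \<longleftrightarrow> x \<in> (+) t ` P \<inter> L1" by (simp add: mt)
  qed
  have "face_to_face_tiling L1 {(+) t ` ?Q | t. t \<in> T \<inter> L1}"
    unfolding face_to_face_tiling_def
  proof (intro conjI ballI impI)
    fix C assume "C \<in> {(+) t ` ?Q | t. t \<in> T \<inter> L1}"
    then obtain t where t: "t \<in> T" "t \<in> L1" "C = (+) t ` ?Q" by blast
    show "polytope C" using poly t by (simp add: polytope_translation_eq)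
    show "C \<subseteq> L1" unfolding t(3) tile[OF t(2)] by blast
    show "aff_dim C = int (dim L1)" using dim t by (simp add: aff_dim_translation_eq)
    fix D assume "D \<in> {(+) t ` ?Q | t. t \<in> T \<inter> L1}" and "C \<noteq> D"
    then obtain s where s: "s \<in> T" "s \<in> L1" "D = (+) s ` ?Q" "t \<noteq> s" using t by blast
    show "rel_interior C \<inter> rel_interior D = {}"
    proof (rule ccontr)
      assume "rel_interior C \<inter> rel_interior D \<noteq> {}"
      then obtain y where "y \<in> rel_interior C" "y \<in> rel_interior D" by blast
      then have "y - t \<in> rel_interior ?Q" "y - s \<in> rel_interior ?Q"
        unfolding t s rel_interior_translation mt by auto
      then show False using relint disj[OF t(1) s(1,4)] by blast
    qed
    have *: "((+) t ` P \<inter> (+) s ` P) \<inter> L1 face_of (+) t ` P \<inter> L1" if "t \<in> T" "s \<in> T" "t \<noteq> s" for t s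
    proof -
      have "(+) t ` (P \<inter> (+) (s - t) ` P) face_of (+) t ` P" using face[OF that] by simp
      moreover have "(+) t ` (P \<inter> (+) (s - t) ` P) = (+) t ` P \<inter> (+) s ` P"
        by (auto simp: image_Int image_image)
      ultimately show ?thesis using face_of_slice aff affine_imp_convex by metis
    qed
    have eq: "C \<inter> D = ((+) t ` P \<inter> (+) s ` P) \<inter> L1" unfolding t(3) s(3) tile[OF t(2)] tile[OF s(2)] by blast
    have C: "C = (+) t ` P \<inter> L1" and D: "D = (+) s ` P \<inter> L1" using t(3) s(3) tile[OF t(2)] tile[OF s(2)] by auto
    show "C \<inter> D face_of C" using *[OF t(1) s(1,4)] unfolding eq[symmetric] C[symmetric] .
    have eq': "((+) s ` P \<inter> (+) t ` P) \<inter> L1 = C \<inter> D" unfolding eq by blast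
    show "C \<inter> D face_of D" using *[OF s(1) t(1) s(4)[symmetric]] unfolding eq' D[symmetric] .
  next
    show "\<Union> {(+) t ` ?Q | t. t \<in> T \<inter> L1} = L1"
    proof
      show "\<Union> {(+) t ` ?Q | t. t \<in> T \<inter> L1} \<subseteq> L1" using tile by blast
      show "L1 \<subseteq> \<Union> {(+) t ` ?Q | t. t \<in> T \<inter> L1}"
      proof
        fix x assume x: "x \<in> L1"
        obtain t where t: "t \<in> T" "x - t \<in> P" using cover by blast
        obtain t1 t2 where t12: "t1 \<in> T \<inter> L1" "t2 \<in> L2" "t = t1 + t2" using T[OF t(1)] by blast
        have "x - t1 \<in> L1" "- t2 \<in> L2" using x t12 L by (auto intro: subspace_diff subspace_neg)
        moreover have "(x - t1) + (- t2) \<in> P" using t(2) t12(3) by (simp add: algebra_simps)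
        ultimately have "x - t1 \<in> ?Q" using proj by blast
        then have "x \<in> (+) t1 ` ?Q" by (metis add.commute diff_add_cancel image_eqI)
        then show "x \<in> \<Union> {(+) t ` ?Q | t. t \<in> T \<inter> L1}" using t12(1) by blast
      qed
    qed
  qed
  then show ?thesis
    unfolding parallelohedron_in_def using L(1) poly dim by blast
qed

end

context coloured_tiling
begin

lemma swap: "coloured_tiling P T B A"
proof unfold_locales
  show "B \<union> A = N" "B \<inter> A = {}" using AB by auto
  show "- a \<in> B" if "a \<in> B" for a using that by (rule B_uminus)
  show "- a \<in> A" if "a \<in> A" for a using that by (rule A_uminus)
  show "card {m \<in> N. m \<in> span {a, b}} \<noteq> 6" if "a \<in> B" "b \<in> A" "z \<in> P" "active z = {a, b}" for a b z
    using no_six[OF that(2,1,3)] that(4) by (simp add: insert_commute)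
qed

text \<open>The shifts of colour \<open>A\<close> are in \<open>L1\<close> and those of colour \<open>B\<close> in \<open>L2\<close>. They span the space and
  reach all tiles, so both the space and the set of translations split; an inequality of colour
  \<open>A\<close> sees only the component in \<open>L1\<close>, one of colour \<open>B\<close> only that in \<open>L2\<close>.\<close>

lemma direct_decomposition:
  defines "L1 \<equiv> {x. \<forall>b\<in>B. b \<bullet> x = 0}" and "L2 \<equiv> {x. \<forall>a\<in>A. a \<bullet> x = 0}"
  shows "subspace L1" "subspace L2" "L1 \<inter> L2 = {0}" "{x + y | x y. x \<in> L1 \<and> y \<in> L2} = UNIV"
    "P = {x + y | x y. x \<in> P \<inter> L1 \<and> y \<in> P \<inter> L2}" "parallelohedron_in L1 (P \<inter> L1)" "parallelohedron_in L2 (P \<inter> L2)"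
proof -
  show s1: "subspace L1" and s2: "subspace L2"
    by (auto simp: L1_def L2_def subspace_def inner_add_right)
  have z: "0 \<in> L1" "0 \<in> L2" using s1 s2 subspace_0 by auto
  show int: "L1 \<inter> L2 = {0}"
  proof
    show "L1 \<inter> L2 \<subseteq> {0}"
    proof
      fix x assume "x \<in> L1 \<inter> L2"
      then have "\<forall>a\<in>A \<union> B. a \<bullet> x = 0" by (auto simp: L1_def L2_def)
      then show "x \<in> {0}" using N_spans unfolding AB(1) by blast
    qed
  qed (use z in blast)
  have sA: "shift a \<in> L1" if "a \<in> A" for a using mixed_orthogonal[OF that] by (simp add: L1_def)
  have sB: "shift b \<in> L2" if "b \<in> B" for b
    using coloured_tiling.mixed_orthogonal[OF swap that] by (simp add: L2_def)
  have "{x + y | x y. x \<in> L1 \<and> y \<in> L2} = UNIV"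
  proof (rule shifts_span)
    show "subspace {x + y | x y. x \<in> L1 \<and> y \<in> L2}" by (rule subspace_sums[OF s1 s2])
    fix a assume "a \<in> N"
    then consider "shift a \<in> L1" | "shift a \<in> L2" using sA sB AB by blast
    then show "shift a \<in> {x + y | x y. x \<in> L1 \<and> y \<in> L2}"
      using z by cases (metis (mono_tags, lifting) add.right_neutral add.left_neutral mem_Collect_eq)+
  qed
  then show sp: "{x + y | x y. x \<in> L1 \<and> y \<in> L2} = UNIV" .
  have T12: "\<exists>t1\<in>T \<inter> L1. \<exists>t2\<in>T \<inter> L2. t = t1 + t2" if "t \<in> T" for t
  proof (rule T_induct[where Q = "\<lambda>t. \<exists>t1\<in>T \<inter> L1. \<exists>t2\<in>T \<inter> L2. t = t1 + t2", OF zero_T _ _ that])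
    show "\<exists>t1\<in>T \<inter> L1. \<exists>t2\<in>T \<inter> L2. 0 = t1 + t2" using zero_T z by force
    fix t a assume a: "a \<in> N" and "\<exists>t1\<in>T \<inter> L1. \<exists>t2\<in>T \<inter> L2. t = t1 + t2"
    then obtain t1 t2 where t: "t1 \<in> T \<inter> L1" "t2 \<in> T \<inter> L2" "t = t1 + t2" by blast
    consider "a \<in> A" | "a \<in> B" using a AB by blast
    then show "\<exists>t1\<in>T \<inter> L1. \<exists>t2\<in>T \<inter> L2. t + shift a = t1 + t2"
    proof cases
      case 1
      then have "t1 + shift a \<in> T \<inter> L1" using t(1) sA[OF 1] shift_in(1)[OF _ a] s1 subspace_add by blast
      then show ?thesis using t(2,3) by (intro bexI[of _ "t1 + shift a"] bexI[of _ t2]) (simp_all add: ac_simps)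
    next
      case 2
      then have "t2 + shift a \<in> T \<inter> L2" using t(2) sB[OF 2] shift_in(1)[OF _ a] s2 subspace_add by blast
      then show ?thesis using t(1,3) by (intro bexI[of _ t1] bexI[of _ "t2 + shift a"]) (simp_all add: ac_simps)
    qed
  qed
  have P12: "x1 + x2 \<in> P \<longleftrightarrow> x1 \<in> P \<and> x2 \<in> P" if "x1 \<in> L1" "x2 \<in> L2" for x1 x2
  proof -
    have A: "a \<bullet> x2 = 0" if "a \<in> A" for a using \<open>x2 \<in> L2\<close> that by (simp add: L2_def)
    have B: "b \<bullet> x1 = 0" if "b \<in> B" for b using \<open>x1 \<in> L1\<close> that by (simp add: L1_def)
    show ?thesis unfolding mem_P_iff AB(1)[symmetric] ball_Un using A B by (auto simp: inner_add_right)
  qed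
  have dec: "\<exists>x1\<in>L1. \<exists>x2\<in>L2. x = x1 + x2" for x
  proof -
    have "x \<in> {x + y | x y. x \<in> L1 \<and> y \<in> L2}" unfolding sp by simp
    then show ?thesis by blast
  qed
  show "P = {x + y | x y. x \<in> P \<inter> L1 \<and> y \<in> P \<inter> L2}"
  proof (intro equalityI subsetI)
    fix x assume "x \<in> P"
    moreover obtain x1 x2 where "x1 \<in> L1" "x2 \<in> L2" "x = x1 + x2" using dec by blast
    ultimately show "x \<in> {x + y | x y. x \<in> P \<inter> L1 \<and> y \<in> P \<inter> L2}" using P12 by blast
  qed (use P12 in blast)
  show "parallelohedron_in L1 (P \<inter> L1)"
    by (rule factor_parallelohedron[OF s1 s2]) (use T12 P12 in blast)+
  have T12': "\<exists>t1\<in>T \<inter> L2. \<exists>t2\<in>L1. t = t1 + t2" if "t \<in> T" for t using T12[OF that] by (metis Int_iff add.commute)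
  have P12': "x1 \<in> P" if "x1 \<in> L2" "x2 \<in> L1" "x1 + x2 \<in> P" for x1 x2 using P12[OF that(2,1)] that(3) by (simp add: add.commute)
  show "parallelohedron_in L2 (P \<inter> L2)"
    by (rule factor_parallelohedron[OF s2 s1 T12' P12'])
qed

end

text \<open>Moving the centre of symmetry to the origin does not change the set of tiles, and translating
  the whole tiling puts one tile at the origin.\<close>

lemma parallelohedron_centred_tiling:
  fixes P :: "'a::euclidean_space set"
  assumes "parallelohedron P"
  obtains c T where "centred_tiling ((+) (- c) ` P) T"
proof -
  obtain T0 where p: "polytope P" "aff_dim P = int (dim (UNIV :: 'a set))"
    and T0: "face_to_face_tiling UNIV {(+) t ` P | t. t \<in> T0}"
    using assms unfolding parallelohedron_in_def by blast
  have comp: "compact P" "convex P" "bounded P" using p(1) by (auto simp: polytope_imp_compact polytope_imp_convex polytope_imp_bounded)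
  have "affine hull P = UNIV" using p(2) by (simp add: aff_dim_eq_full)
  then have ri: "rel_interior P = interior P" by (simp add: rel_interior_interior)
  have "P \<noteq> {}" using p(2) by auto
  then have ne: "interior P \<noteq> {}" using ri rel_interior_eq_empty[OF comp(2)] by simp
  have inj: "(+) t ` P \<noteq> (+) s ` P" if "t \<noteq> s" for t s
    using translation_injective[OF comp(3) \<open>P \<noteq> {}\<close>] that by blast
  note mt = mem_translation_iff
  have T0': "rel_interior ((+) t ` P) \<inter> rel_interior ((+) s ` P) = {} \<and> (+) t ` P \<inter> (+) s ` P face_of (+) t ` P"
    if "t \<in> T0" "s \<in> T0" "t \<noteq> s" for t s
  proof -
    have m: "(+) t ` P \<in> {(+) t ` P | t. t \<in> T0}" "(+) s ` P \<in> {(+) t ` P | t. t \<in> T0}" using that by blast+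
    have "\<forall>C\<in>{(+) t ` P | t. t \<in> T0}. \<forall>D\<in>{(+) t ` P | t. t \<in> T0}. C \<noteq> D \<longrightarrow>
        rel_interior C \<inter> rel_interior D = {} \<and> C \<inter> D face_of C \<and> C \<inter> D face_of D"
      using T0 unfolding face_to_face_tiling_def by simp
    from this[THEN bspec, OF m(1), THEN bspec, OF m(2)] show ?thesis using inj[OF that(3)] by simp
  qed
  have disj: "x - s \<notin> interior P" if "t \<in> T0" "s \<in> T0" "t \<noteq> s" "x - t \<in> interior P" for t s x
  proof -
    have "rel_interior ((+) t ` P) \<inter> rel_interior ((+) s ` P) = {}"
      using T0'[OF that(1-3)] by blast
    then have "(+) t ` interior P \<inter> (+) s ` interior P = {}" by (simp add: rel_interior_translation ri)
    moreover have "x \<in> (+) t ` interior P" using that(4) unfolding mt .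
    ultimately have "x \<notin> (+) s ` interior P" by blast
    then show ?thesis unfolding mt .
  qed
  have cover: "\<exists>t\<in>T0. x - t \<in> P" for x
  proof -
    have "x \<in> \<Union> {(+) t ` P | t. t \<in> T0}" using T0 unfolding face_to_face_tiling_def by simp
    then show ?thesis using mt by blast
  qed
  obtain c where c: "\<And>x. x \<in> P \<Longrightarrow> 2 *\<^sub>R c - x \<in> P"
  proof (rule translative_tile_centrally_symmetric[OF comp(1,2) ne _ cover])
    fix t s assume "t \<in> T0" "s \<in> T0" "t \<noteq> s"
    then show "(+) t ` interior P \<inter> (+) s ` interior P = {}" using disj mt by blast
  qed (rule that; blast)
  obtain t0 where t0: "t0 \<in> T0" using cover by blast
  define Q where "Q = (+) (- c) ` P"
  have Q: "x \<in> Q \<longleftrightarrow> x + c \<in> P" for x unfolding Q_def mt by simp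
  have iQ: "x \<in> interior Q \<longleftrightarrow> x + c \<in> interior P" for x unfolding Q_def interior_translation mt by simp
  define T where "T = (\<lambda>t. t - t0) ` T0"
  have "centred_tiling Q T"
  proof
    show "polytope Q" unfolding Q_def polytope_translation_eq by (rule p(1))
    show "interior Q \<noteq> {}" unfolding Q_def interior_translation using ne by simp
    show "- x \<in> Q" if "x \<in> Q" for x
      using c[of "x + c"] that unfolding Q by (simp add: algebra_simps scaleR_2)
    show "0 \<in> T" using t0 by (auto simp: T_def)
    show "\<exists>t\<in>T. x - t \<in> Q" for x
    proof -
      obtain t where "t \<in> T0" "x + c + t0 - t \<in> P" using cover by blast
      then show ?thesis unfolding T_def Q by (intro bexI[of _ "t - t0"]) (auto simp: algebra_simps)
    qed
  next
    fix t s x assume "t \<in> T" "s \<in> T" "t \<noteq> s" "x - t \<in> interior Q"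
    then obtain t' s' where t: "t' \<in> T0" "s' \<in> T0" "t' \<noteq> s'" "t = t' - t0" "s = s' - t0" "x - t + c \<in> interior P"
      unfolding T_def iQ by auto
    have e: "(x + c + t0) - t' = x - t + c" unfolding t(4) by simp
    have "(x + c + t0) - t' \<in> interior P" unfolding e by (rule t(6))
    then have "(x + c + t0) - s' \<notin> interior P" by (rule disj[OF t(1-3)])
    then show "x - s \<notin> interior Q" unfolding iQ t(5) by (simp add: algebra_simps)
  next
    fix t s assume "t \<in> T" "s \<in> T" "t \<noteq> s"
    then obtain t' s' where t: "t' \<in> T0" "s' \<in> T0" "t' \<noteq> s'" "t = t' - t0" "s = s' - t0"
      unfolding T_def by auto
    have "(+) t' ` P \<inter> (+) s' ` P face_of (+) t' ` P"
      using T0'[OF t(1-3)] by blast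
    moreover have "(+) t' ` P = (+) (t' + c) ` Q"
      by (rule set_eqI) (simp only: mt Q diff_add_eq_diff_diff_swap diff_add_cancel, simp add: diff_diff_add)
    moreover have "(+) t' ` P \<inter> (+) s' ` P = (+) (t' + c) ` (Q \<inter> (+) (s - t) ` Q)"
    proof (rule set_eqI)
      fix x
      have e: "x - (t' + c) + c = x - t'" "x - (t' + c) - (s - t) + c = x - s'" by (simp_all add: t(4,5))
      show "x \<in> (+) t' ` P \<inter> (+) s' ` P \<longleftrightarrow> x \<in> (+) (t' + c) ` (Q \<inter> (+) (s - t) ` Q)"
        unfolding Int_iff mt Q e ..
    qed
    ultimately have "(+) (t' + c) ` (Q \<inter> (+) (s - t) ` Q) face_of (+) (t' + c) ` Q" by simp
    then show "Q \<inter> (+) (s - t) ` Q face_of Q" by simp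
  qed
  then show thesis using that unfolding Q_def by blast
qed

section \<open>The red Venkov graph\<close>

context centred_polytope
begin

lemma affine_hull_ridge:
  assumes N: "a \<in> N" "b \<in> N" "a \<noteq> b" and z: "z \<in> P" and act: "active z = {a, b}"
  shows "affine hull (fct a \<inter> fct b) = {x. a \<bullet> x = 1} \<inter> {x. b \<bullet> x = 1}" (is "_ = ?S")
proof
  show "affine hull (fct a \<inter> fct b) \<subseteq> ?S"
    by (rule hull_minimal) (auto simp: fct_def intro: affine_Int affine_hyperplane)
  obtain e where e: "e > 0" "\<And>y. y \<in> ball z e \<Longrightarrow> (\<And>b. b \<in> active z \<Longrightarrow> b \<bullet> y \<le> 1) \<Longrightarrow> y \<in> P"
    using active_determines_nearby[OF z] by metis
  have az: "a \<bullet> z = 1" "b \<bullet> z = 1" using act by (auto simp: active_def)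
  have "?S \<inter> ball z e \<subseteq> fct a \<inter> fct b"
  proof
    fix y assume y: "y \<in> ?S \<inter> ball z e"
    then have "y \<in> P" by (intro e(2)) (auto simp: act)
    then show "y \<in> fct a \<inter> fct b" using y by (simp add: fct_iff)
  qed
  then have "affine hull (?S \<inter> ball z e) \<subseteq> affine hull (fct a \<inter> fct b)" by (rule hull_mono)
  moreover have "affine hull (?S \<inter> ball z e) = ?S"
  proof -
    have S: "affine ?S" by (intro affine_Int affine_hyperplane)
    moreover have "?S \<inter> ball z e \<noteq> {}" using az e(1) by auto
    ultimately have "affine hull (?S \<inter> ball z e) = affine hull ?S" by (intro affine_hull_affine_Int_open) auto
    then show ?thesis using S by (simp only: affine_hull_eq)
  qed
  ultimately show "?S \<subseteq> affine hull (fct a \<inter> fct b)" by simp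
qed

lemma aff_dim_ridge:
  assumes N: "a \<in> N" "b \<in> N" "a \<noteq> b" and z: "a \<bullet> z = 1" "b \<bullet> z = 1"
  shows "aff_dim ({x. a \<bullet> x = 1} \<inter> {x. b \<bullet> x = 1}) = int DIM('a) - 2"
proof -
  let ?D = "{y. \<forall>x\<in>span {a, b}. orthogonal x y}"
  have "?D = {y. a \<bullet> y = 0 \<and> b \<bullet> y = 0}"
  proof (rule set_eqI)
    fix y
    have "(\<forall>x\<in>span {a, b}. orthogonal x y) \<longleftrightarrow> a \<bullet> y = 0 \<and> b \<bullet> y = 0"
      by (auto simp: orthogonal_def mem_span_pair inner_add_left intro: span_base)
    then show "y \<in> ?D \<longleftrightarrow> y \<in> {y. a \<bullet> y = 0 \<and> b \<bullet> y = 0}" by simp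
  qed
  then have eq: "{x. a \<bullet> x = 1} \<inter> {x. b \<bullet> x = 1} = (+) z ` ?D"
    using z by (auto simp: mem_translation_iff inner_diff_right inner_add_right)
  have "independent {a, b}"
  proof (rule independent_insertI)
    show "a \<notin> span {b}"
    proof
      assume "a \<in> span {b}"
      then obtain t where "a = t *\<^sub>R b" by (auto simp: span_singleton)
      then show False using not_multiple[OF N(2,1) N(3)[symmetric] z(2,1)] by blast
    qed
    show "independent {b}" using N_nonzero[OF N(2)] by simp
  qed
  then have "dim (span {a, b}) = 2" using N(3) by (simp add: dim_eq_card_independent)
  then have "dim ?D + 2 = DIM('a)"
    using dim_subspace_orthogonal_to_vectors[of "span {a, b}" UNIV] by (simp add: orthogonal_commute)
  moreover have "subspace ?D" by (auto simp: subspace_def orthogonal_def inner_add_right)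
  ultimately show ?thesis unfolding eq by (simp add: aff_dim_translation_eq aff_dim_subspace)
qed

end

locale translated_polytope = centred_polytope Q for Q :: "'a::euclidean_space set" +
  fixes c :: 'a and P :: "'a set"
  assumes P_eq: "P = (+) c ` Q"
begin

definition facet_at :: "'a \<Rightarrow> 'a set" where "facet_at a = (+) c ` fct a"

definition vertex :: "'a \<Rightarrow> 'a set set" where "vertex a = {facet_at a, facet_at (- a)}"

lemma facet_iff: "F facet_of P \<longleftrightarrow> (\<exists>a\<in>N. F = facet_at a)"
proof
  assume F: "F facet_of P"
  have eq: "F = (+) c ` ((+) (- c) ` F)" by (simp add: image_image)
  have "(+) (- c) ` F facet_of Q"
  proof -
    have "(+) c ` ((+) (- c) ` F) face_of (+) c ` Q" using F unfolding P_eq facet_of_def by (simp add: image_image)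
    then have "(+) (- c) ` F face_of Q" unfolding face_of_translation_eq .
    moreover have "aff_dim ((+) (- c) ` F) = aff_dim Q - 1" "(+) (- c) ` F \<noteq> {}"
      using F aff_dim_translation_eq[of c Q] aff_dim_translation_eq[of "- c" F] unfolding facet_of_def P_eq by auto
    ultimately show ?thesis unfolding facet_of_def by blast
  qed
  then obtain a where a: "a \<in> N" "(+) (- c) ` F = fct a" by (rule facet_obtain)
  have "F = facet_at a" using eq unfolding a(2) facet_at_def .
  then show "\<exists>a\<in>N. F = facet_at a" using a(1) by blast
next
  assume "\<exists>a\<in>N. F = facet_at a"
  then obtain a where a: "a \<in> N" "F = facet_at a" by blast
  show "F facet_of P"
    using fct_facet[OF a(1)] unfolding a(2) facet_at_def P_eq facet_of_def aff_dim_translation_eq face_of_translation_eq by blast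
qed

lemma facet_at_inj: "a \<in> N \<Longrightarrow> b \<in> N \<Longrightarrow> facet_at a = facet_at b \<Longrightarrow> a = b"
  unfolding facet_at_def inj_image_eq_iff[OF inj_on_add] by (rule fct_inj)

lemma vertex_eq_iff: "a \<in> N \<Longrightarrow> b \<in> N \<Longrightarrow> vertex a = vertex b \<longleftrightarrow> b = a \<or> b = - a"
  unfolding vertex_def doubleton_eq_iff using facet_at_inj N_uminus by (metis minus_minus)

lemma vertex_uminus: "vertex (- a) = vertex a" by (auto simp: vertex_def)

lemma facet_at_reflect: "(\<lambda>x. 2 *\<^sub>R c - x) ` facet_at a = facet_at (- a)"
proof -
  have "(\<lambda>x. 2 *\<^sub>R c - x) ` facet_at a = (\<lambda>x. c + (- x)) ` fct a"
    unfolding facet_at_def image_image by (rule image_cong) (auto simp: scaleR_2)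
  also have "\<dots> = facet_at (- a)" unfolding facet_at_def fct_uminus image_image ..
  finally show ?thesis .
qed

lemma P_reflect: "(\<lambda>x. 2 *\<^sub>R c - x) ` P = P"
proof -
  have "(\<lambda>x. 2 *\<^sub>R c - x) ` P = (\<lambda>x. c + x) ` uminus ` Q"
    unfolding P_eq image_image by (rule image_cong) (auto simp: scaleR_2)
  then show ?thesis unfolding uminus_image P_eq .
qed

lemma centre_unique:
  assumes "(\<lambda>x. 2 *\<^sub>R d - x) ` P = P"
  shows "d = c"
proof -
  have "(+) (2 *\<^sub>R d - 2 *\<^sub>R c) ` P = (\<lambda>x. 2 *\<^sub>R d - x) ` (\<lambda>x. 2 *\<^sub>R c - x) ` P"
    unfolding image_image by (rule image_cong) auto
  also have "\<dots> = (+) 0 ` P" unfolding P_reflect assms by simp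
  finally have "2 *\<^sub>R d - 2 *\<^sub>R c = 0"
    using bounded zero_in by (intro translation_injective[of P]) (auto simp: P_eq bounded_translation)
  then show ?thesis by simp
qed

lemma antipodal_iff: "antipodal P F F' \<longleftrightarrow> (\<exists>a\<in>N. F = facet_at a \<and> F' = facet_at (- a))"
proof
  assume ap: "antipodal P F F'"
  then obtain d where d: "F facet_of P" "(\<lambda>x. 2 *\<^sub>R d - x) ` P = P" "(\<lambda>x. 2 *\<^sub>R d - x) ` F = F'"
    unfolding antipodal_def by blast
  obtain a where a: "a \<in> N" "F = facet_at a" using d(1) facet_iff by blast
  then show "\<exists>a\<in>N. F = facet_at a \<and> F' = facet_at (- a)" using d(3) unfolding centre_unique[OF d(2)] facet_at_reflect[symmetric] by blast
next
  assume "\<exists>a\<in>N. F = facet_at a \<and> F' = facet_at (- a)"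
  then obtain a where a: "a \<in> N" "F = facet_at a" "F' = facet_at (- a)" by blast
  then show "antipodal P F F'"
    unfolding antipodal_def facet_iff using N_uminus[OF a(1)] P_reflect facet_at_reflect by blast
qed

lemma venkov_vertices_eq: "venkov_vertices P = vertex ` N"
  unfolding venkov_vertices_def antipodal_iff vertex_def by blast

lemma red_edge_iff:
  assumes "a \<in> N" "b \<in> N"
  shows "{vertex a, vertex b} \<in> snd (red_venkov_graph P) \<longleftrightarrow> vertex a \<noteq> vertex b \<and> (\<exists>B. k_belt 6 P B \<and> vertex a \<union> vertex b \<subseteq> B)"
proof -
  have v: "vertex a \<in> venkov_vertices P" "vertex b \<in> venkov_vertices P" using assms venkov_vertices_eq by auto
  have "{vertex a, vertex b} \<in> snd (red_venkov_graph P) \<longleftrightarrow>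
      (\<exists>v w. {vertex a, vertex b} = {v, w} \<and> v \<in> venkov_vertices P \<and> w \<in> venkov_vertices P \<and> venkov_adjacent P Red v w)"
    unfolding red_venkov_graph_def venkov_graph_def by auto
  also have "\<dots> \<longleftrightarrow> venkov_adjacent P Red (vertex a) (vertex b) \<or> venkov_adjacent P Red (vertex b) (vertex a)"
    using v unfolding doubleton_eq_iff by blast
  also have "\<dots> \<longleftrightarrow> vertex a \<noteq> vertex b \<and> (\<exists>B. k_belt 6 P B \<and> vertex a \<union> vertex b \<subseteq> B)"
    by (auto simp: Un_commute)
  finally show ?thesis .
qed

lemma affine_hull_facet_at: "a \<in> N \<Longrightarrow> affine hull (facet_at a) = {x. a \<bullet> (x - c) = 1}"
  unfolding facet_at_def affine_hull_translation affine_hull_fct by (auto simp: mem_translation_iff)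

lemma parallel_iff:
  assumes m: "m \<in> N" and G: "x0 \<in> affine hull G"
  shows "parallel_to_face (facet_at m) G \<longleftrightarrow> (\<forall>x\<in>affine hull G. m \<bullet> (x - x0) = 0)"
proof
  assume "parallel_to_face (facet_at m) G"
  then obtain S where S: "affine_parallel (affine hull G) S" "S \<subseteq> {x. m \<bullet> (x - c) = 1}"
    unfolding parallel_to_face_def affine_hull_facet_at[OF m] by blast
  then obtain d where d: "S = (+) d ` (affine hull G)" unfolding affine_parallel_def by blast
  show "\<forall>x\<in>affine hull G. m \<bullet> (x - x0) = 0"
  proof
    fix x assume "x \<in> affine hull G"
    then have "m \<bullet> (d + x - c) = 1" "m \<bullet> (d + x0 - c) = 1" using S(2) G unfolding d by auto
    then show "m \<bullet> (x - x0) = 0" by (simp add: inner_add_right inner_diff_right)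
  qed
next
  assume *: "\<forall>x\<in>affine hull G. m \<bullet> (x - x0) = 0"
  obtain y where y: "y \<in> fct m" using fct_ne[OF m] by blast
  have "(+) (c + y - x0) ` (affine hull G) \<subseteq> {x. m \<bullet> (x - c) = 1}"
    using * y by (auto simp: fct_iff inner_add_right inner_diff_right)
  then show "parallel_to_face (facet_at m) G"
    unfolding parallel_to_face_def affine_hull_facet_at[OF m] affine_parallel_def by blast
qed

lemma belt_eq:
  assumes "x0 \<in> affine hull G"
  shows "belt P G = facet_at ` {m \<in> N. \<forall>x\<in>affine hull G. m \<bullet> (x - x0) = 0}"
  unfolding belt_def facet_iff using parallel_iff[OF _ assms] by auto

lemma card_facets_at: "M \<subseteq> N \<Longrightarrow> card (facet_at ` M) = card M"
  using facet_at_inj by (intro card_image inj_onI) blast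

text \<open>The facets parallel to the ridge are those whose normal is orthogonal to its directions, that
  is, lies in the plane of \<open>a\<close> and \<open>b\<close>.\<close>

lemma ridge_six_belt:
  assumes N: "a \<in> N" "b \<in> N" "a \<noteq> b" and z: "z \<in> Q" and act: "active z = {a, b}"
    and six: "card {m \<in> N. m \<in> span {a, b}} = 6"
  obtains B where "k_belt 6 P B" "vertex a \<union> vertex b \<subseteq> B"
proof -
  let ?G = "(+) c ` (fct a \<inter> fct b)" and ?S = "{x. a \<bullet> x = 1} \<inter> {x. b \<bullet> x = 1}"
  have az: "a \<bullet> z = 1" "b \<bullet> z = 1" using act by (auto simp: active_def)
  have hull: "affine hull ?G = (+) c ` ?S"
    unfolding affine_hull_translation affine_hull_ridge[OF N z act] ..
  have x0: "c + z \<in> affine hull ?G" unfolding hull using az by auto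
  have "fct a \<inter> fct b face_of Q" using face_of_Int fct_face N by blast
  then have face: "?G face_of P" unfolding P_eq by simp
  have ne: "?G \<noteq> {}" using az z by (auto simp: fct_iff)
  have "aff_dim ?G = aff_dim ?S" using affine_hull_ridge[OF N z act]
    by (metis aff_dim_affine_hull aff_dim_translation_eq)
  then have dim: "aff_dim ?G = aff_dim P - 2"
    unfolding aff_dim_ridge[OF N az] P_eq aff_dim_translation_eq aff_dim_P .
  have "(\<forall>x\<in>affine hull ?G. m \<bullet> (x - (c + z)) = 0) \<longleftrightarrow> m \<in> span {a, b}" for m
  proof
    assume *: "\<forall>x\<in>affine hull ?G. m \<bullet> (x - (c + z)) = 0"
    show "m \<in> span {a, b}"
    proof (rule mem_span_pair_orthogonal)
      fix y assume "a \<bullet> y = 0" "b \<bullet> y = 0"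
      then have "c + (z + y) \<in> affine hull ?G" unfolding hull using az by (auto simp: inner_add_right)
      then have "m \<bullet> (c + (z + y) - (c + z)) = 0" using * by blast
      then show "m \<bullet> y = 0" by simp
    qed
  next
    assume "m \<in> span {a, b}"
    then obtain p q where "m = p *\<^sub>R a + q *\<^sub>R b" unfolding mem_span_pair by blast
    then show "\<forall>x\<in>affine hull ?G. m \<bullet> (x - (c + z)) = 0"
      unfolding hull using az by (auto simp: inner_add_left inner_add_right inner_diff_right distrib_left)
  qed
  then have belt: "belt P ?G = facet_at ` {m \<in> N. m \<in> span {a, b}}" unfolding belt_eq[OF x0] by simp
  have "card (belt P ?G) = 6" unfolding belt using six by (subst card_facets_at) auto
  then have "k_belt 6 P (belt P ?G)" unfolding k_belt_def using face ne dim by blast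
  moreover have "vertex a \<union> vertex b \<subseteq> belt P ?G"
    unfolding belt vertex_def using N N_uminus by (auto intro!: imageI span_base span_neg)
  ultimately show thesis using that by blast
qed

lemma disconnected_colouring:
  assumes "graph_disconnected (red_venkov_graph P)"
  obtains A B where "A \<noteq> {}" "B \<noteq> {}" "A \<union> B = N" "A \<inter> B = {}"
    "\<And>a. a \<in> A \<Longrightarrow> - a \<in> A" "\<And>b. b \<in> B \<Longrightarrow> - b \<in> B"
    "\<And>a b z. a \<in> A \<Longrightarrow> b \<in> B \<Longrightarrow> z \<in> Q \<Longrightarrow> active z = {a, b} \<Longrightarrow> card {m \<in> N. m \<in> span {a, b}} \<noteq> 6"
proof -
  have fst: "fst (red_venkov_graph P) = vertex ` N" by (simp add: red_venkov_graph_def venkov_graph_def venkov_vertices_eq)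
  obtain \<A> \<B> where AB: "\<A> \<noteq> {}" "\<B> \<noteq> {}" "\<A> \<inter> \<B> = {}" "\<A> \<union> \<B> = vertex ` N"
    "\<And>v w. v \<in> \<A> \<Longrightarrow> w \<in> \<B> \<Longrightarrow> {v, w} \<notin> snd (red_venkov_graph P)"
  proof -
    from assms obtain \<A> \<B> where "\<A> \<noteq> {} \<and> \<B> \<noteq> {} \<and> \<A> \<inter> \<B> = {} \<and> \<A> \<union> \<B> = vertex ` N \<and>
        (\<forall>a\<in>\<A>. \<forall>b\<in>\<B>. {a, b} \<notin> snd (red_venkov_graph P))"
      unfolding graph_disconnected_def fst by (elim exE)
    then show thesis by (intro that[of \<A> \<B>]) simp_all
  qed
  define A where "A = {a \<in> N. vertex a \<in> \<A>}"
  define B where "B = {a \<in> N. vertex a \<in> \<B>}"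
  show thesis
  proof (rule that[of A B])
    obtain v w where "v \<in> \<A>" "w \<in> \<B>" using AB(1,2) by blast
    moreover from this have "v \<in> vertex ` N" "w \<in> vertex ` N" using AB(4) by blast+
    ultimately show "A \<noteq> {}" "B \<noteq> {}" unfolding A_def B_def by auto
    have "a \<in> A \<union> B" if "a \<in> N" for a
    proof -
      have "vertex a \<in> \<A> \<union> \<B>" unfolding AB(4) using that by (rule imageI)
      then show ?thesis using that by (auto simp: A_def B_def)
    qed
    then show "A \<union> B = N" by (auto simp: A_def B_def)
    show "A \<inter> B = {}" using AB(3) by (auto simp: A_def B_def)
    show "- a \<in> A" if "a \<in> A" for a using that N_uminus vertex_uminus by (simp add: A_def)
    show "- a \<in> B" if "a \<in> B" for a using that N_uminus vertex_uminus by (simp add: B_def)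
    fix a b z assume ab: "a \<in> A" "b \<in> B" and z: "z \<in> Q" "active z = {a, b}"
    have N: "a \<in> N" "b \<in> N" and ne: "vertex a \<noteq> vertex b" using ab AB(3) by (auto simp: A_def B_def)
    then have "a \<noteq> b" by blast
    show "card {m \<in> N. m \<in> span {a, b}} \<noteq> 6"
    proof
      assume "card {m \<in> N. m \<in> span {a, b}} = 6"
      then obtain Bt where "k_belt 6 P Bt" "vertex a \<union> vertex b \<subseteq> Bt" using ridge_six_belt[OF N \<open>a \<noteq> b\<close> z] by blast
      then have "{vertex a, vertex b} \<in> snd (red_venkov_graph P)" using red_edge_iff[OF N] ne by blast
      then show False using AB(5) ab by (auto simp: A_def B_def)
    qed
  qed
qed

text \<open>The points of the facet have components on which \<open>a\<close> is constant. If \<open>a\<close> were nonzero on both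
  subspaces, one could move within the hyperplane of the facet, which is its affine hull, along
  \<open>u1 - u2\<close> and so change \<open>a\<close> on the component in \<open>L1\<close>.\<close>

lemma facet_normal_perp:
  assumes P12: "P = {x + y | x y. x \<in> P1 \<and> y \<in> P2}" and sub: "P1 \<subseteq> L1" "P2 \<subseteq> L2"
    and L: "subspace L1" "subspace L2" "L1 \<inter> L2 = {0}" and a: "a \<in> N"
  shows "(\<forall>x\<in>L1. a \<bullet> x = 0) \<or> (\<forall>x\<in>L2. a \<bullet> x = 0)"
proof (rule ccontr)
  assume "\<not> ?thesis"
  then obtain v1 v2 where v: "v1 \<in> L1" "a \<bullet> v1 \<noteq> 0" "v2 \<in> L2" "a \<bullet> v2 \<noteq> 0" by blast
  define u1 where "u1 = (1 / (a \<bullet> v1)) *\<^sub>R v1"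
  define u2 where "u2 = (1 / (a \<bullet> v2)) *\<^sub>R v2"
  have u: "u1 \<in> L1" "u2 \<in> L2" "a \<bullet> u1 = 1" "a \<bullet> u2 = 1"
    using v L by (auto simp: u1_def u2_def intro: subspace_scale)
  have uniq: "x1 = y1 \<and> x2 = y2" if "x1 \<in> L1" "y1 \<in> L1" "x2 \<in> L2" "y2 \<in> L2" "x1 + x2 = y1 + y2" for x1 x2 y1 y2
  proof -
    have "x1 - y1 = y2 - x2" using that(5) by (simp add: algebra_simps)
    then have "x1 - y1 \<in> L1 \<inter> L2" using that L subspace_diff by (metis IntI)
    then show ?thesis using L(3) that(5) by auto
  qed
  have le: "a \<bullet> (x - c) \<le> 1" if "x \<in> P" for x
  proof -
    have "x - c \<in> Q" using that unfolding P_eq mem_translation_iff .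
    then show ?thesis by (rule N_le[OF a])
  qed
  obtain y where y: "y \<in> fct a" using fct_ne[OF a] by blast
  then have "c + y \<in> P" "a \<bullet> (c + y - c) = 1" by (auto simp: P_eq fct_iff)
  then obtain q1 q2 where q': "q1 \<in> P1" "q2 \<in> P2" "c + y = q1 + q2" unfolding P12 by blast
  moreover have "a \<bullet> (q1 + q2 - c) = 1" unfolding q'(3)[symmetric] by (fact \<open>a \<bullet> (c + y - c) = 1\<close>)
  ultimately have q: "q1 \<in> P1" "q2 \<in> P2" "c + y = q1 + q2" "a \<bullet> (q1 + q2 - c) = 1" by auto
  have "facet_at a \<subseteq> {x1 + x2 | x1 x2. x1 \<in> L1 \<and> x2 \<in> L2 \<and> a \<bullet> x1 = a \<bullet> q1 \<and> a \<bullet> x2 = a \<bullet> q2}" (is "_ \<subseteq> ?S")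
  proof
    fix x assume "x \<in> facet_at a"
    then have xP: "x \<in> P" and ax: "a \<bullet> (x - c) = 1" unfolding facet_at_def P_eq by (auto simp: fct_iff)
    obtain x1 x2 where x: "x1 \<in> P1" "x2 \<in> P2" "x = x1 + x2" using xP unfolding P12 by blast
    have "x1 + q2 \<in> P" "q1 + x2 \<in> P" using x q unfolding P12 by blast+
    then have "a \<bullet> (x1 + q2 - c) \<le> 1" "a \<bullet> (q1 + x2 - c) \<le> 1" using le by blast+
    then have "a \<bullet> x1 = a \<bullet> q1 \<and> a \<bullet> x2 = a \<bullet> q2"
      using ax q(4) unfolding x(3) by (simp add: inner_add_right inner_diff_right)
    then show "x \<in> ?S" using x sub by blast
  qed
  moreover have "affine ?S"
    unfolding affine_def
  proof (intro ballI allI impI)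
    fix x y :: 'a and u w :: real assume x: "x \<in> ?S" and y: "y \<in> ?S" and uw: "u + w = 1"
    obtain x1 x2 where x: "x1 \<in> L1" "x2 \<in> L2" "a \<bullet> x1 = a \<bullet> q1" "a \<bullet> x2 = a \<bullet> q2" "x = x1 + x2" using x by blast
    obtain y1 y2 where y: "y1 \<in> L1" "y2 \<in> L2" "a \<bullet> y1 = a \<bullet> q1" "a \<bullet> y2 = a \<bullet> q2" "y = y1 + y2" using y by blast
    have "u *\<^sub>R x1 + w *\<^sub>R y1 \<in> L1" "u *\<^sub>R x2 + w *\<^sub>R y2 \<in> L2" using x y L by (auto intro: subspace_add subspace_scale)
    moreover have "a \<bullet> (u *\<^sub>R x1 + w *\<^sub>R y1) = a \<bullet> q1" "a \<bullet> (u *\<^sub>R x2 + w *\<^sub>R y2) = a \<bullet> q2"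
      using uw by (simp_all add: inner_add_right x(3,4) y(3,4) distrib_right[symmetric])
    moreover have "u *\<^sub>R x + w *\<^sub>R y = (u *\<^sub>R x1 + w *\<^sub>R y1) + (u *\<^sub>R x2 + w *\<^sub>R y2)"
      unfolding x(5) y(5) by (simp add: algebra_simps)
    ultimately show "u *\<^sub>R x + w *\<^sub>R y \<in> ?S" by blast
  qed
  ultimately have hull: "{x. a \<bullet> (x - c) = 1} \<subseteq> ?S"
    unfolding affine_hull_facet_at[OF a, symmetric] by (rule hull_minimal)
  have "a \<bullet> ((q1 + u1) + (q2 - u2) - c) = 1" using q(4) u by (simp add: inner_add_right inner_diff_right)
  then obtain s1 s2 where s: "s1 \<in> L1" "s2 \<in> L2" "a \<bullet> s1 = a \<bullet> q1" "(q1 + u1) + (q2 - u2) = s1 + s2"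
    using hull by blast
  have "q1 + u1 \<in> L1" "q2 - u2 \<in> L2" using q sub u L by (auto intro: subspace_add subspace_diff)
  then have "q1 + u1 = s1" using uniq[OF _ s(1) _ s(2,4)] by blast
  then have "a \<bullet> q1 + a \<bullet> u1 = a \<bullet> s1" by (simp add: inner_add_right[symmetric])
  then show False using s(3) u(3) by simp
qed

text \<open>A belt of a ridge consists of the facets with normal in the plane orthogonal to the ridge. If
  it contains \<open>a\<close> and \<open>b\<close> of different kinds, a further normal \<open>p a + q b\<close> of either kind is
  a multiple of \<open>a\<close> or of \<open>b\<close>.\<close>

lemma product_disconnected:
  assumes dp: "direct_product P P1 P2" and dims: "aff_dim P1 < int DIM('a)" "aff_dim P2 < int DIM('a)"
  shows "graph_disconnected (red_venkov_graph P)"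
proof -
  obtain L1 L2 where P12: "P = {x + y | x y. x \<in> P1 \<and> y \<in> P2}" and L: "subspace L1" "subspace L2" "L1 \<inter> L2 = {0}"
    and sp: "{x + y | x y. x \<in> L1 \<and> y \<in> L2} = UNIV" and par: "parallelohedron_in L1 P1" "parallelohedron_in L2 P2"
    using dp unfolding direct_product_def by blast
  have sub: "P1 \<subseteq> L1" "P2 \<subseteq> L2" and d: "dim L1 < DIM('a)" "dim L2 < DIM('a)"
    using par dims unfolding parallelohedron_in_def by auto
  note perp = facet_normal_perp[OF P12 sub L]
  define A where "A = {a \<in> N. \<forall>x\<in>L2. a \<bullet> x = 0}"
  define B where "B = {a \<in> N. \<forall>x\<in>L1. a \<bullet> x = 0}"
  have AB: "A \<union> B = N" using perp by (auto simp: A_def B_def)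
  have both: "a = 0" if "\<forall>x\<in>L1. a \<bullet> x = 0" "\<forall>x\<in>L2. a \<bullet> x = 0" for a
  proof -
    have "a \<in> {x + y | x y. x \<in> L1 \<and> y \<in> L2}" unfolding sp by simp
    then obtain x y where xy: "a = x + y" "x \<in> L1" "y \<in> L2" by blast
    then have "a \<bullet> x = 0" "a \<bullet> y = 0" using that by blast+
    then have "a \<bullet> (x + y) = 0" by (simp add: inner_add_right)
    then have "a \<bullet> a = 0" unfolding xy(1)[symmetric] .
    then show ?thesis by simp
  qed
  have AB0: "A \<inter> B = {}" using both N_nonzero by (auto simp: A_def B_def)
  have ne: "\<exists>a\<in>N. \<exists>x\<in>L. a \<bullet> x \<noteq> 0" if "dim L' < DIM('a)" "L \<subseteq> {0} \<Longrightarrow> L' = UNIV" for L L' :: "'a set"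
  proof -
    have "\<not> L \<subseteq> {0}" using that by auto
    then obtain x where "x \<in> L" "x \<noteq> 0" by blast
    then show ?thesis using N_spans by blast
  qed
  have "L1 \<subseteq> {0} \<Longrightarrow> L2 = UNIV" "L2 \<subseteq> {0} \<Longrightarrow> L1 = UNIV" using sp by force+
  then obtain a b where a: "a \<in> N" "\<exists>x\<in>L1. a \<bullet> x \<noteq> 0" and b: "b \<in> N" "\<exists>x\<in>L2. b \<bullet> x \<noteq> 0"
    using ne[OF d(2), of L1] ne[OF d(1), of L2] by metis
  have "a \<in> A" "b \<in> B" using perp[OF a(1)] a perp[OF b(1)] b by (auto simp: A_def B_def)
  then have neAB: "A \<noteq> {}" "B \<noteq> {}" by auto
  have neg: "- a \<in> A" if "a \<in> A" for a using that N_uminus by (simp add: A_def)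
  have negB: "- a \<in> B" if "a \<in> B" for a using that N_uminus by (simp add: B_def)
  have multiple: "m = a \<or> m = - a" if ma: "m \<in> N" "a \<in> N" "m = p *\<^sub>R a" for m a p
  proof -
    obtain z where z: "z \<in> fct a" using fct_ne[OF ma(2)] by blast
    then have zP: "z \<in> Q" "a \<bullet> z = 1" by (auto simp: fct_iff)
    show ?thesis
    proof (cases "p \<ge> 0")
      case True
      then show ?thesis using corner[OF ma(2,2,1), of p 0 z] ma(3) zP by simp
    next
      case False
      moreover have "- m = (- p) *\<^sub>R a + 0 *\<^sub>R a" using ma(3) by simp
      ultimately have "- m = a" using corner[OF ma(2,2) N_uminus[OF ma(1)] _ _ _ zP(1,2,2), of "- p" 0] by auto
      then show ?thesis by auto
    qed
  qed
  have no_edge: "{vertex a, vertex b} \<notin> snd (red_venkov_graph P)" if a: "a \<in> A" and b: "b \<in> B" for a b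
  proof
    assume "{vertex a, vertex b} \<in> snd (red_venkov_graph P)"
    moreover have N: "a \<in> N" "b \<in> N" using a b by (auto simp: A_def B_def)
    ultimately obtain Bt where Bt: "k_belt 6 P Bt" "vertex a \<union> vertex b \<subseteq> Bt" using red_edge_iff by blast
    then obtain G where G: "G \<noteq> {}" "aff_dim G = aff_dim P - 2" "Bt = belt P G" "card Bt = 6"
      unfolding k_belt_def by blast
    obtain x0 where x0: "x0 \<in> affine hull G" using G(1) by (metis all_not_in_conv hull_inc)
    define D where "D = (+) (- x0) ` (affine hull G)"
    have D: "x \<in> D \<longleftrightarrow> x0 + x \<in> affine hull G" for x unfolding D_def mem_translation_iff by (simp add: add.commute)
    have sD: "subspace D" using affine_diffs_subspace[of "affine hull G" x0] x0 unfolding D_def by (simp add: image_def)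
    have "aff_dim D = int DIM('a) - 2"
      unfolding D_def aff_dim_translation_eq using G(2) aff_dim_P by (simp add: P_eq aff_dim_translation_eq)
    then have dD: "int (dim D) = int DIM('a) - 2" using sD by (simp add: aff_dim_subspace)
    have perpD: "(\<forall>x\<in>affine hull G. m \<bullet> (x - x0) = 0) \<longleftrightarrow> (\<forall>y\<in>D. m \<bullet> y = 0)" for m
    proof
      assume *: "\<forall>x\<in>affine hull G. m \<bullet> (x - x0) = 0"
      show "\<forall>y\<in>D. m \<bullet> y = 0"
      proof
        fix y assume "y \<in> D"
        then have "m \<bullet> (x0 + y - x0) = 0" using * D by blast
        then show "m \<bullet> y = 0" by simp
      qed
    next
      assume *: "\<forall>y\<in>D. m \<bullet> y = 0"
      show "\<forall>x\<in>affine hull G. m \<bullet> (x - x0) = 0"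
      proof
        fix x assume "x \<in> affine hull G"
        then have "x - x0 \<in> D" unfolding D by simp
        then show "m \<bullet> (x - x0) = 0" using * by blast
      qed
    qed
    have belt: "Bt = facet_at ` {m \<in> N. \<forall>y\<in>D. m \<bullet> y = 0}" unfolding G(3) belt_eq[OF x0] perpD ..
    have in_belt: "m \<in> {m \<in> N. \<forall>y\<in>D. m \<bullet> y = 0}" if "m \<in> N" "facet_at m \<in> Bt" for m
      using that facet_at_inj unfolding belt by blast
    have aD: "\<forall>y\<in>D. a \<bullet> y = 0" and bD: "\<forall>y\<in>D. b \<bullet> y = 0"
      using in_belt[OF N(1)] in_belt[OF N(2)] Bt(2) by (auto simp: vertex_def)
    let ?E = "{y. \<forall>x\<in>D. orthogonal x y}"
    have dE: "dim ?E = 2"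
      using dim_subspace_orthogonal_to_vectors[OF sD subspace_UNIV] dD by simp
    have sE: "subspace ?E" by (auto simp: subspace_def orthogonal_def inner_add_right)
    have "independent {a, b}"
    proof (rule independent_insertI)
      show "a \<notin> span {b}"
      proof
        assume "a \<in> span {b}"
        then obtain t where "a = t *\<^sub>R b" by (auto simp: span_singleton)
        then have "a = b \<or> a = - b" using multiple[OF N] by blast
        then have "a \<in> B" using b negB by auto
        then show False using a AB0 by blast
      qed
      show "independent {b}" using N_nonzero[OF N(2)] by simp
    qed
    moreover have ab: "a \<noteq> b" using a b AB0 by blast
    ultimately have d2: "dim (span {a, b}) = 2" by (simp add: dim_eq_card_independent)
    have subE: "span {a, b} \<subseteq> ?E"
      using aD bD by (intro span_minimal sE) (auto simp: orthogonal_def inner_commute)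
    have E: "span {a, b} = ?E" using subspace_dim_equal[OF subspace_span sE subE] dE d2 by simp
    have "{m \<in> N. \<forall>y\<in>D. m \<bullet> y = 0} \<subseteq> {a, - a, b, - b}"
    proof
      fix m assume "m \<in> {m \<in> N. \<forall>y\<in>D. m \<bullet> y = 0}"
      then have m: "m \<in> N" "m \<in> ?E" by (auto simp: orthogonal_def inner_commute)
      then obtain p q where pq: "m = p *\<^sub>R a + q *\<^sub>R b" unfolding E[symmetric] mem_span_pair by blast
      consider "m \<in> A" | "m \<in> B" using m(1) AB by blast
      then show "m \<in> {a, - a, b, - b}"
      proof cases
        case 1
        then have "\<forall>x\<in>L2. (q *\<^sub>R b) \<bullet> x = 0" using a unfolding pq A_def by (auto simp: inner_add_left)
        moreover have "\<forall>x\<in>L1. (q *\<^sub>R b) \<bullet> x = 0" using b by (simp add: B_def)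
        ultimately have "q *\<^sub>R b = 0" using both by blast
        then show ?thesis using multiple[OF m(1) N(1), of p] pq by auto
      next
        case 2
        then have "\<forall>x\<in>L1. (p *\<^sub>R a) \<bullet> x = 0" using b unfolding pq B_def by (auto simp: inner_add_left)
        moreover have "\<forall>x\<in>L2. (p *\<^sub>R a) \<bullet> x = 0" using a by (simp add: A_def)
        ultimately have "p *\<^sub>R a = 0" using both by blast
        then show ?thesis using multiple[OF m(1) N(2), of q] pq by auto
      qed
    qed
    then have "card {m \<in> N. \<forall>y\<in>D. m \<bullet> y = 0} \<le> card {a, - a, b, - b}" by (intro card_mono) auto
    also have "\<dots> \<le> 4" by (simp add: card_insert_if)
    finally have "card Bt \<le> 4" unfolding belt by (subst card_facets_at) auto
    then show False using G(4) by simp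
  qed
  show ?thesis
    unfolding graph_disconnected_def
  proof (intro exI conjI ballI)
    show "vertex ` A \<noteq> {}" "vertex ` B \<noteq> {}" using neAB by auto
    show "vertex ` A \<inter> vertex ` B = {}"
    proof (rule ccontr)
      assume "vertex ` A \<inter> vertex ` B \<noteq> {}"
      then obtain a b where ab: "a \<in> A" "b \<in> B" "vertex a = vertex b" by blast
      then have "b = a \<or> b = - a" using vertex_eq_iff by (auto simp: A_def B_def)
      then have "b \<in> A" using ab(1) neg by auto
      then show False using ab AB0 by blast
    qed
    show "vertex ` A \<union> vertex ` B = fst (red_venkov_graph P)"
      using AB by (auto simp: red_venkov_graph_def venkov_graph_def venkov_vertices_eq)
    show "{v, w} \<notin> snd (red_venkov_graph P)" if "v \<in> vertex ` A" "w \<in> vertex ` B" for v w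
      using that no_edge by blast
  qed
qed

end

theorem mainTheorem1:
  fixes P :: "(real ^ 'n) set"
  assumes "parallelohedron P"
  shows "(\<exists>P\<^sub>1 P\<^sub>2. direct_product P P\<^sub>1 P\<^sub>2 \<and>
            aff_dim P\<^sub>1 < int CARD('n) \<and> aff_dim P\<^sub>2 < int CARD('n))
         \<longleftrightarrow> graph_disconnected (red_venkov_graph P)"
proof
  obtain c T where T: "centred_tiling ((+) (- c) ` P) T"
    using parallelohedron_centred_tiling[OF assms] by blast
  define Q where "Q = (+) (- c) ` P"
  interpret centred_tiling Q T using T unfolding Q_def .
  interpret translated_polytope Q c P
    by unfold_locales (simp add: Q_def image_image)
  {
    assume "\<exists>P\<^sub>1 P\<^sub>2. direct_product P P\<^sub>1 P\<^sub>2 \<and> aff_dim P\<^sub>1 < int CARD('n) \<and> aff_dim P\<^sub>2 < int CARD('n)"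
    then show "graph_disconnected (red_venkov_graph P)" using product_disconnected by auto
  next
    assume disc: "graph_disconnected (red_venkov_graph P)"
    show "\<exists>P\<^sub>1 P\<^sub>2. direct_product P P\<^sub>1 P\<^sub>2 \<and> aff_dim P\<^sub>1 < int CARD('n) \<and> aff_dim P\<^sub>2 < int CARD('n)"
    proof (rule disconnected_colouring[OF disc])
      fix A B assume ne: "A \<noteq> {}" "B \<noteq> {}" and AB: "A \<union> B = N" "A \<inter> B = {}"
        "\<And>a. a \<in> A \<Longrightarrow> - a \<in> A" "\<And>b. b \<in> B \<Longrightarrow> - b \<in> B"
        "\<And>a b z. a \<in> A \<Longrightarrow> b \<in> B \<Longrightarrow> z \<in> Q \<Longrightarrow> active z = {a, b} \<Longrightarrow> card {m \<in> N. m \<in> span {a, b}} \<noteq> 6"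
      interpret coloured_tiling Q T A B by unfold_locales (fact AB)+
      define L1 where "L1 = {x. \<forall>b\<in>B. b \<bullet> x = 0}"
      define L2 where "L2 = {x. \<forall>a\<in>A. a \<bullet> x = 0}"
      note dec = direct_decomposition[folded L1_def L2_def]
      have "c \<in> {x + y | x y. x \<in> L1 \<and> y \<in> L2}" unfolding dec(4) by simp
      then obtain c1 c2 where c: "c1 \<in> L1" "c2 \<in> L2" "c = c1 + c2" by blast
      let ?P1 = "(+) c1 ` (Q \<inter> L1)" and ?P2 = "(+) c2 ` (Q \<inter> L2)"
      have par: "parallelohedron_in L1 ?P1" "parallelohedron_in L2 ?P2"
        using parallelohedron_in_translation dec(6,7) c(1,2) by blast+
      have "P = {x + y | x y. x \<in> ?P1 \<and> y \<in> ?P2}"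
      proof -
        have "P = (+) c ` {x + y | x y. x \<in> Q \<inter> L1 \<and> y \<in> Q \<inter> L2}" using P_eq dec(5) by simp
        also have "\<dots> = {x + y | x y. x \<in> ?P1 \<and> y \<in> ?P2}"
        proof (intro equalityI subsetI)
          fix z assume "z \<in> (+) c ` {x + y | x y. x \<in> Q \<inter> L1 \<and> y \<in> Q \<inter> L2}"
          then obtain x y where "x \<in> Q \<inter> L1" "y \<in> Q \<inter> L2" "z = (c1 + x) + (c2 + y)" unfolding c(3) by (auto simp: ac_simps)
          then show "z \<in> {x + y | x y. x \<in> ?P1 \<and> y \<in> ?P2}" by blast
        next
          fix z assume "z \<in> {x + y | x y. x \<in> ?P1 \<and> y \<in> ?P2}"
          then obtain x y where "x \<in> Q \<inter> L1" "y \<in> Q \<inter> L2" "z = (c1 + x) + (c2 + y)" by blast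
          then have "z = c + (x + y)" "x \<in> Q \<inter> L1" "y \<in> Q \<inter> L2" unfolding c(3) by (auto simp: ac_simps)
          then show "z \<in> (+) c ` {x + y | x y. x \<in> Q \<inter> L1 \<and> y \<in> Q \<inter> L2}" by blast
        qed
        finally show ?thesis .
      qed
      then have "direct_product P ?P1 ?P2"
        unfolding direct_product_def using dec(1-4) par by blast
      moreover have lt: "dim L < DIM(real ^ 'n)" if "subspace L" "L \<noteq> UNIV" for L :: "(real ^ 'n) set"
        using that by (metis dim_eq_full dim_subset_UNIV less_le span_eq_iff)
      have "L1 \<noteq> UNIV" "L2 \<noteq> UNIV"
      proof -
        obtain a b where "a \<in> A" "b \<in> B" using ne by blast
        moreover have "a \<bullet> a \<noteq> 0" "b \<bullet> b \<noteq> 0" using N_nonzero AN BN calculation by auto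
        ultimately show "L1 \<noteq> UNIV" "L2 \<noteq> UNIV" unfolding L1_def L2_def by blast+
      qed
      then have "aff_dim ?P1 < int CARD('n)" "aff_dim ?P2 < int CARD('n)"
        using lt[OF dec(1)] lt[OF dec(2)] par unfolding parallelohedron_in_def by auto
      ultimately show "\<exists>P\<^sub>1 P\<^sub>2. direct_product P P\<^sub>1 P\<^sub>2 \<and> aff_dim P\<^sub>1 < int CARD('n) \<and> aff_dim P\<^sub>2 < int CARD('n)"
        by blast
    qed
  }
qed

end
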